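(* Let $R$ be a commutative ring and $M$ a Mittag-Leffler $R$-module. Let $P$ be a finitely presented $R$-module and $v\colon P\to M$ an $R$-linear map. Then the set $\mathrm{Pure}(v)=\{\mathfrak p\in\mathrm{Spec}(R): v_{\mathfrak p}\colon P_{\mathfrak p}\to M_{\mathfrak p}\text{ is a pure map of }R_{\mathfrak p}\text{-modules}\}$ is open in $\mathrm{Spec}(R)$.
   Context: All rings are commutative, not necessarily Noetherian. A map of $R$-modules $M\to N$ is pure if for every $R$-module $T$ the induced map $M\otimes_R T\to N\otimes_R T$ is injective. Two $R$-linear maps $f\colon P\to Q$ and $g\colon P\to M$ dominate each other if $\ker(f\otimes_R \mathrm{id}_N)=\ker(g\otimes_R\mathrm{id}_N)$ for every $R$-module $N$. An $R$-module $M$ is Mittag-Leffler if for every finitely presented $R$-module $P$ and every $R$-linear map $g\colon P\to M$ there exist a finitely presented $R$-module $Q$ and an $R$-linear map $f\colon P\to Q$ such that $f$ and $g$ dominate each other. *)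

theory Defs
  imports "HOL-Analysis.Abstract_Topology" "HOL-Algebra.Algebra"
begin

hide_const (open) Modules.module

section \<open>Linear maps and submodules\<close>

definition mod_hom ::
    "('a, 'c) ring_scheme \<Rightarrow> ('a, 'm, 'x) module_scheme \<Rightarrow> ('a, 'n, 'y) module_scheme \<Rightarrow> ('m \<Rightarrow> 'n) set" where
  "mod_hom R M N = {f \<in> carrier M \<rightarrow> carrier N.
     (\<forall>x\<in>carrier M. \<forall>y\<in>carrier M. f (x \<oplus>\<^bsub>M\<^esub> y) = f x \<oplus>\<^bsub>N\<^esub> f y) \<and>
     (\<forall>a\<in>carrier R. \<forall>x\<in>carrier M. f (a \<odot>\<^bsub>M\<^esub> x) = a \<odot>\<^bsub>N\<^esub> f x)}"

lemma mod_homI: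
  assumes "\<And>x. x \<in> carrier M \<Longrightarrow> f x \<in> carrier N"
    and "\<And>x y. x \<in> carrier M \<Longrightarrow> y \<in> carrier M \<Longrightarrow> f (x \<oplus>\<^bsub>M\<^esub> y) = f x \<oplus>\<^bsub>N\<^esub> f y"
    and "\<And>a x. a \<in> carrier R \<Longrightarrow> x \<in> carrier M \<Longrightarrow> f (a \<odot>\<^bsub>M\<^esub> x) = a \<odot>\<^bsub>N\<^esub> f x"
  shows "f \<in> mod_hom R M N"
  using assms by (auto simp: mod_hom_def)

lemma mod_homD:
  assumes "f \<in> mod_hom R M N"
  shows "x \<in> carrier M \<Longrightarrow> f x \<in> carrier N"
    and "x \<in> carrier M \<Longrightarrow> y \<in> carrier M \<Longrightarrow> f (x \<oplus>\<^bsub>M\<^esub> y) = f x \<oplus>\<^bsub>N\<^esub> f y"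
    and "a \<in> carrier R \<Longrightarrow> x \<in> carrier M \<Longrightarrow> f (a \<odot>\<^bsub>M\<^esub> x) = a \<odot>\<^bsub>N\<^esub> f x"
  using assms by (auto simp: mod_hom_def)

lemma mod_hom_id: "(\<lambda>x. x) \<in> mod_hom R M M"
  by (rule mod_homI) auto

lemma mod_hom_comp:
  "f \<in> mod_hom R M N \<Longrightarrow> g \<in> mod_hom R N K \<Longrightarrow> (\<lambda>x. g (f x)) \<in> mod_hom R M K"
  by (rule mod_homI) (auto simp: mod_homD)

lemma mod_hom_smult:
  assumes "module R M" "a \<in> carrier R"
  shows "(\<lambda>x. a \<odot>\<^bsub>M\<^esub> x) \<in> mod_hom R M M"
proof -
  interpret module R M by fact
  show ?thesis
    by (rule mod_homI) (use assms(2) in \<open>auto simp: smult_r_distr R.m_comm simp flip: smult_assoc1\<close>)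
qed

definition submodule_gen :: "('a, 'c) ring_scheme \<Rightarrow> ('a, 'm, 'x) module_scheme \<Rightarrow> 'm set \<Rightarrow> 'm set" where
  "submodule_gen R M A = \<Inter>{H. submodule H R M \<and> A \<subseteq> H}"

lemma submodule_module:
  assumes "module R M" "submodule H R M"
  shows "module R (M\<lparr>carrier := H\<rparr>)"
  using submodule.submodule_is_module[OF assms(2,1)] .

fun lincomb :: "('a, 'm, 'x) module_scheme \<Rightarrow> 'm list \<Rightarrow> 'a list \<Rightarrow> 'm" where
  "lincomb M (x # xs) (a # as) = a \<odot>\<^bsub>M\<^esub> x \<oplus>\<^bsub>M\<^esub> lincomb M xs as"
| "lincomb M _ _ = \<zero>\<^bsub>M\<^esub>"

lemma submodule_gen_submodule:
  assumes "module R M" "A \<subseteq> carrier M"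
  shows "submodule (submodule_gen R M A) R M"
proof -
  interpret module R M by fact
  have sub: "submodule_gen R M A \<subseteq> carrier M"
    unfolding submodule_gen_def using assms(2) carrier_is_submodule by blast
  have zero: "\<zero>\<^bsub>M\<^esub> \<in> H" if "submodule H R M" for H
    using subgroup.one_closed[OF submodule.axioms(1)[OF that]] by simp
  show ?thesis
  proof (rule submoduleI[OF sub])
    show "\<zero>\<^bsub>M\<^esub> \<in> submodule_gen R M A"
      unfolding submodule_gen_def using zero by blast
  next
    fix a assume "a \<in> submodule_gen R M A"
    then show "\<ominus>\<^bsub>M\<^esub> a \<in> submodule_gen R M A"
      unfolding submodule_gen_def using submoduleE(3) by blast
  next
    fix a b assume "a \<in> submodule_gen R M A" "b \<in> submodule_gen R M A"
    then show "a \<oplus>\<^bsub>M\<^esub> b \<in> submodule_gen R M A"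
      unfolding submodule_gen_def using submoduleE(5) by blast
  next
    fix a x assume "a \<in> carrier R" "x \<in> submodule_gen R M A"
    then show "a \<odot>\<^bsub>M\<^esub> x \<in> submodule_gen R M A"
      unfolding submodule_gen_def using submoduleE(4) by blast
  qed
qed

lemma submodule_gen_superset: "A \<subseteq> submodule_gen R M A"
  by (auto simp: submodule_gen_def)

lemma submodule_gen_least: "submodule H R M \<Longrightarrow> A \<subseteq> H \<Longrightarrow> submodule_gen R M A \<subseteq> H"
  by (auto simp: submodule_gen_def)

lemma lincomb_submodule:
  assumes "module R M" "set xs \<subseteq> carrier M"
  shows "submodule {lincomb M xs as | as. set as \<subseteq> carrier R \<and> length as = length xs} R M"
    and "set xs \<subseteq> {lincomb M xs as | as. set as \<subseteq> carrier R \<and> length as = length xs}"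
proof -
  interpret module R M by fact
  have closed: "lincomb M xs as \<in> carrier M" if "set xs \<subseteq> carrier M" "set as \<subseteq> carrier R" for xs as
    using that
  proof (induction xs arbitrary: as)
    case (Cons x xs as)
    then show ?case by (cases as) auto
  qed simp
  have ex0: "\<exists>as. lincomb M xs as = \<zero>\<^bsub>M\<^esub> \<and> set as \<subseteq> carrier R \<and> length as = length xs" if "set xs \<subseteq> carrier M" for xs
    using that
  proof (induction xs)
    case (Cons x xs)
    then obtain as where "lincomb M xs as = \<zero>\<^bsub>M\<^esub>" "set as \<subseteq> carrier R" "length as = length xs" by auto
    then show ?case using Cons.prems by (intro exI[of _ "\<zero>\<^bsub>R\<^esub> # as"]) auto
  qed auto
  have smult: "\<exists>bs. lincomb M xs bs = a \<odot>\<^bsub>M\<^esub> lincomb M xs as \<and> set bs \<subseteq> carrier R \<and> length bs = length xs"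
    if "set xs \<subseteq> carrier M" "set as \<subseteq> carrier R" "a \<in> carrier R" "length as = length xs" for xs as a
    using that
  proof (induction xs arbitrary: as)
    case (Cons x xs as)
    obtain b as' where as: "as = b # as'" using Cons.prems by (cases as) auto
    obtain bs where bs: "lincomb M xs bs = a \<odot>\<^bsub>M\<^esub> lincomb M xs as'" "set bs \<subseteq> carrier R" "length bs = length xs"
      using Cons.IH[of as'] Cons.prems as by auto
    then show ?case using Cons.prems as closed[of xs as']
      by (intro exI[of _ "a \<otimes>\<^bsub>R\<^esub> b # bs"]) (auto simp: smult_r_distr smult_assoc1)
  qed auto
  have add: "\<exists>cs. lincomb M xs cs = lincomb M xs as \<oplus>\<^bsub>M\<^esub> lincomb M xs bs \<and> set cs \<subseteq> carrier R \<and> length cs = length xs"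
    if "set xs \<subseteq> carrier M" "set as \<subseteq> carrier R" "set bs \<subseteq> carrier R" "length as = length xs" "length bs = length xs" for xs as bs
    using that
  proof (induction xs arbitrary: as bs)
    case (Cons x xs as bs)
    obtain a as' where as: "as = a # as'" using Cons.prems by (cases as) auto
    obtain b bs' where bs: "bs = b # bs'" using Cons.prems by (cases bs) auto
    obtain cs where cs: "lincomb M xs cs = lincomb M xs as' \<oplus>\<^bsub>M\<^esub> lincomb M xs bs'" "set cs \<subseteq> carrier R" "length cs = length xs"
      using Cons.IH[of as' bs'] Cons.prems as bs by auto
    show ?case using cs Cons.prems as bs closed[of xs as'] closed[of xs bs']
      by (intro exI[of _ "(a \<oplus>\<^bsub>R\<^esub> b) # cs"]) (auto simp: smult_l_distr M.a_ac)
  qed auto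
  have mem: "\<exists>as. x = lincomb M xs as \<and> set as \<subseteq> carrier R \<and> length as = length xs"
    if "set xs \<subseteq> carrier M" "x \<in> set xs" for x xs
    using that
  proof (induction xs)
    case (Cons y ys)
    show ?case
    proof (cases "x = y")
      case True
      obtain as where "lincomb M ys as = \<zero>\<^bsub>M\<^esub>" "set as \<subseteq> carrier R" "length as = length ys"
        using ex0[of ys] Cons.prems by auto
      then show ?thesis using True Cons.prems by (intro exI[of _ "\<one>\<^bsub>R\<^esub> # as"]) auto
    next
      case False
      then obtain as where "x = lincomb M ys as" "set as \<subseteq> carrier R" "length as = length ys"
        using Cons by auto
      then show ?thesis using Cons.prems closed[of ys as] by (intro exI[of _ "\<zero>\<^bsub>R\<^esub> # as"]) auto
    qed
  qed auto
  let ?H = "{lincomb M xs as | as. set as \<subseteq> carrier R \<and> length as = length xs}"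
  have sm: "a \<odot>\<^bsub>M\<^esub> x \<in> ?H" if "a \<in> carrier R" "x \<in> ?H" for a x
    using smult[OF assms(2) _ that(1)] that(2) by (smt (verit, ccfv_SIG) mem_Collect_eq)
  show "submodule ?H R M"
  proof (rule submoduleI)
    show "?H \<subseteq> carrier M" using closed assms(2) by auto
    show "\<zero>\<^bsub>M\<^esub> \<in> ?H" using ex0[OF assms(2)] by (smt (verit, ccfv_SIG) mem_Collect_eq)
    show "x \<oplus>\<^bsub>M\<^esub> y \<in> ?H" if "x \<in> ?H" "y \<in> ?H" for x y
      using add[OF assms(2)] that by (smt (verit, ccfv_SIG) mem_Collect_eq)
    show "\<ominus>\<^bsub>M\<^esub> x \<in> ?H" if "x \<in> ?H" for x
    proof -
      have "x \<in> carrier M" using that closed assms(2) by auto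
      then show ?thesis using sm[of "\<ominus>\<^bsub>R\<^esub> \<one>\<^bsub>R\<^esub>" x] that by (simp add: smult_l_minus)
    qed
  qed (rule sm)
  show "set xs \<subseteq> ?H" using mem[OF assms(2)] by auto
qed

lemma fg_inj_list:
  assumes "module R M" "finite A" "A \<subseteq> carrier M"
  shows "\<exists>h :: 'm \<Rightarrow> 'a list. inj_on h (submodule_gen (R :: ('a, 'c) ring_scheme) (M :: ('a, 'm, 'x) module_scheme) A)"
proof -
  obtain xs where xs: "set xs = A" using assms(2) finite_list by blast
  let ?L = "{as. set as \<subseteq> carrier R \<and> length as = length xs}"
  have "submodule_gen R M A \<subseteq> lincomb M xs ` ?L"
    using submodule_gen_least[OF lincomb_submodule(1)[OF assms(1), of xs]]
      lincomb_submodule(2)[OF assms(1), of xs] xs assms(3) by blast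
  then have "inj_on (inv_into ?L (lincomb M xs)) (submodule_gen R M A)"
    using inj_on_inv_into by blast
  then show ?thesis by blast
qed

definition transport :: "('m \<Rightarrow> 'n) \<Rightarrow> ('a, 'm, 'x) module_scheme \<Rightarrow> ('a, 'n) module" where
  "transport h M = (let k = inv_into (carrier M) h in
     \<lparr>carrier = h ` carrier M, monoid.mult = undefined, monoid.one = undefined,
      ring.zero = h \<zero>\<^bsub>M\<^esub>, ring.add = (\<lambda>x y. h (k x \<oplus>\<^bsub>M\<^esub> k y)),
      smult = (\<lambda>a x. h (a \<odot>\<^bsub>M\<^esub> k x))\<rparr>)"

lemma transport:
  assumes "module R M" "inj_on h (carrier M)"
  shows "module R (transport h M)"
    and "h \<in> mod_hom R M (transport h M)"
    and "inv_into (carrier M) h \<in> mod_hom R (transport h M) M"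
    and "h ` carrier M = carrier (transport h M)"
proof -
  interpret module R M by fact
  have k: "inv_into (carrier M) h (h x) = x" if "x \<in> carrier M" for x
    using assms(2) that by simp
  show "module R (transport h M)"
  proof (rule moduleI)
    show "abelian_group (transport h M)"
    proof (rule abelian_groupI)
      fix y assume "y \<in> carrier (transport h M)"
      then obtain x where x: "x \<in> carrier M" "y = h x" by (auto simp: transport_def Let_def)
      then show "\<exists>z\<in>carrier (transport h M). z \<oplus>\<^bsub>transport h M\<^esub> y = \<zero>\<^bsub>transport h M\<^esub>"
        by (intro bexI[of _ "h (\<ominus>\<^bsub>M\<^esub> x)"]) (auto simp: transport_def Let_def k M.l_neg)
    qed (auto simp: transport_def Let_def k M.a_ac)
  qed (auto simp: transport_def Let_def k smult_l_distr smult_r_distr smult_assoc1 R.is_cring)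
  show "h \<in> mod_hom R M (transport h M)"
    by (rule mod_homI) (auto simp: transport_def Let_def k)
  show "inv_into (carrier M) h \<in> mod_hom R (transport h M) M"
    by (rule mod_homI) (auto simp: transport_def Let_def k)
  show "h ` carrier M = carrier (transport h M)" by (simp add: transport_def Let_def)
qed

section \<open>Finitely presented modules\<close>

definition free_mod :: "('a, 'c) ring_scheme \<Rightarrow> nat \<Rightarrow> ('a, nat \<Rightarrow> 'a) module" where
  "free_mod R n = \<lparr>carrier = {..<n} \<rightarrow>\<^sub>E carrier R,
     monoid.mult = undefined, monoid.one = undefined,
     ring.zero = (\<lambda>i\<in>{..<n}. \<zero>\<^bsub>R\<^esub>),
     ring.add = (\<lambda>x y. \<lambda>i\<in>{..<n}. x i \<oplus>\<^bsub>R\<^esub> y i),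
     smult = (\<lambda>a x. \<lambda>i\<in>{..<n}. a \<otimes>\<^bsub>R\<^esub> x i)\<rparr>"

definition finitely_presented :: "('a, 'c) ring_scheme \<Rightarrow> ('a, 'm, 'x) module_scheme \<Rightarrow> bool" where
  "finitely_presented R M \<longleftrightarrow> module R M \<and>
     (\<exists>n. \<exists>\<phi>\<in>mod_hom R (free_mod R n) M.
        \<phi> ` carrier (free_mod R n) = carrier M \<and>
        (\<exists>A. finite A \<and> A \<subseteq> carrier (free_mod R n) \<and>
           a_kernel (free_mod R n) M \<phi> = submodule_gen R (free_mod R n) A))"

lemma free_mod_module:
  assumes "cring R"
  shows "module R (free_mod R n)"
proof -
  interpret cring R by fact
  show ?thesis
  proof (rule moduleI)
    show "abelian_group (free_mod R n)"
    proof (rule abelian_groupI)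
      fix x assume "x \<in> carrier (free_mod R n)"
      then show "\<exists>y\<in>carrier (free_mod R n). y \<oplus>\<^bsub>free_mod R n\<^esub> x = \<zero>\<^bsub>free_mod R n\<^esub>"
        by (intro bexI[of _ "\<lambda>i\<in>{..<n}. \<ominus>\<^bsub>R\<^esub> x i"])
          (auto simp: free_mod_def PiE_iff l_neg intro!: restrict_ext)
    qed (auto simp: free_mod_def PiE_iff a_ac fun_eq_iff restrict_def extensional_def)
  qed (auto simp: free_mod_def PiE_iff assms fun_eq_iff restrict_def extensional_def
      l_distr r_distr m_assoc)
qed

lemma finitely_presented_iso:
  assumes fp: "finitely_presented R P" and P': "module R P'"
    and h: "h \<in> mod_hom R P P'" and inj: "inj_on h (carrier P)" and surj: "h ` carrier P = carrier P'"
  shows "finitely_presented R P'"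
proof -
  have P: "module R P" using fp by (simp add: finitely_presented_def)
  interpret P: module R P by fact
  interpret P': module R P' by fact
  obtain n \<phi> A where \<phi>: "\<phi> \<in> mod_hom R (free_mod R n) P" "\<phi> ` carrier (free_mod R n) = carrier P"
    and A: "finite A" "A \<subseteq> carrier (free_mod R n)" "a_kernel (free_mod R n) P \<phi> = submodule_gen R (free_mod R n) A"
    using fp unfolding finitely_presented_def by blast
  have h0: "h \<zero>\<^bsub>P\<^esub> = \<zero>\<^bsub>P'\<^esub>"
    using mod_homD(3)[OF h, of "\<zero>\<^bsub>R\<^esub>" "\<zero>\<^bsub>P\<^esub>"] mod_homD(1)[OF h, of "\<zero>\<^bsub>P\<^esub>"] by simp
  have "h (\<phi> x) = \<zero>\<^bsub>P'\<^esub> \<longleftrightarrow> \<phi> x = \<zero>\<^bsub>P\<^esub>" if "x \<in> carrier (free_mod R n)" for x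
    using inj_on_eq_iff[OF inj mod_homD(1)[OF \<phi>(1) that] P.zero_closed] h0 by simp
  then have "a_kernel (free_mod R n) P' (\<lambda>x. h (\<phi> x)) = a_kernel (free_mod R n) P \<phi>"
    unfolding a_kernel_def' by auto
  moreover have "(\<lambda>x. h (\<phi> x)) ` carrier (free_mod R n) = carrier P'"
    using \<phi>(2) surj by (metis image_image)
  ultimately show ?thesis
    using P' A mod_hom_comp[OF \<phi>(1) h] unfolding finitely_presented_def by auto
qed

lemma finitely_presented_inj_list:
  assumes "finitely_presented (R :: ('a, 'c) ring_scheme) (P :: ('a, 'p, 'x) module_scheme)"
  shows "\<exists>h :: 'p \<Rightarrow> 'a list. inj_on h (carrier P)"
proof -
  obtain n \<phi> where \<phi>: "\<phi> ` carrier (free_mod R n) = carrier P"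
    using assms unfolding finitely_presented_def by blast
  let ?l = "\<lambda>x :: nat \<Rightarrow> 'a. map x [0..<n]"
  have l: "inj_on ?l (carrier (free_mod R n))"
  proof (rule inj_onI)
    fix x y assume "x \<in> carrier (free_mod R n)" "y \<in> carrier (free_mod R n)" "?l x = ?l y"
    then show "x = y"
      by (intro PiE_ext[of x "{..<n}" "\<lambda>_. carrier R" y]) (simp_all add: free_mod_def)
  qed
  have k: "inj_on (inv_into (carrier (free_mod R n)) \<phi>) (carrier P)"
    using \<phi> by (simp add: inj_on_inv_into)
  have "inv_into (carrier (free_mod R n)) \<phi> ` carrier P \<subseteq> carrier (free_mod R n)"
    using \<phi> by (auto intro: inv_into_into)
  then have "inj_on (?l \<circ> inv_into (carrier (free_mod R n)) \<phi>) (carrier P)"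
    using comp_inj_on[OF k inj_on_subset[OF l]] by blast
  then show ?thesis by blast
qed

lemma finitely_presented_transport:
  assumes "finitely_presented R P" "inj_on h (carrier P)"
  shows "finitely_presented R (transport h P)"
proof -
  have P: "module R P" using assms(1) by (simp add: finitely_presented_def)
  note tr = transport[OF P assms(2)]
  show ?thesis by (rule finitely_presented_iso[OF assms(1) tr(1,2) assms(2) tr(4)])
qed

section \<open>Tensor products\<close>

text \<open>
  \<open>M \<otimes>\<^sub>R N\<close> is the free abelian group on \<open>carrier M \<times> carrier N\<close> modulo the biadditivity and
  \<open>R\<close>-balancing relations; \<open>R\<close> acts through the first factor.
\<close>

definition tensor_rels ::
    "('a, 'c) ring_scheme \<Rightarrow> ('a, 'm, 'x) module_scheme \<Rightarrow> ('a, 'n, 'y) module_scheme \<Rightarrow> ('m \<times> 'n \<Rightarrow>\<^sub>0 int) set" where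
  "tensor_rels R M N =
     {frag_of (x \<oplus>\<^bsub>M\<^esub> x', y) - frag_of (x, y) - frag_of (x', y) | x x' y.
        x \<in> carrier M \<and> x' \<in> carrier M \<and> y \<in> carrier N} \<union>
     {frag_of (x, y \<oplus>\<^bsub>N\<^esub> y') - frag_of (x, y) - frag_of (x, y') | x y y'.
        x \<in> carrier M \<and> y \<in> carrier N \<and> y' \<in> carrier N} \<union>
     {frag_of (a \<odot>\<^bsub>M\<^esub> x, y) - frag_of (x, a \<odot>\<^bsub>N\<^esub> y) | a x y.
        a \<in> carrier R \<and> x \<in> carrier M \<and> y \<in> carrier N}"

abbreviation free_pairs ::
    "('a, 'm, 'x) module_scheme \<Rightarrow> ('a, 'n, 'y) module_scheme \<Rightarrow> ('m \<times> 'n \<Rightarrow>\<^sub>0 int) monoid" where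
  "free_pairs M N \<equiv> free_Abelian_group (carrier M \<times> carrier N)"

definition tensor_null ::
    "('a, 'c) ring_scheme \<Rightarrow> ('a, 'm, 'x) module_scheme \<Rightarrow> ('a, 'n, 'y) module_scheme \<Rightarrow> ('m \<times> 'n \<Rightarrow>\<^sub>0 int) set" where
  "tensor_null R M N = generate (free_pairs M N) (tensor_rels R M N)"

definition tensor_class ::
    "('a, 'c) ring_scheme \<Rightarrow> ('a, 'm, 'x) module_scheme \<Rightarrow> ('a, 'n, 'y) module_scheme
      \<Rightarrow> ('m \<times> 'n \<Rightarrow>\<^sub>0 int) \<Rightarrow> ('m \<times> 'n \<Rightarrow>\<^sub>0 int) set" where
  "tensor_class R M N c = r_coset (free_pairs M N) (tensor_null R M N) c"

definition pair_push :: "('m \<Rightarrow> 'm') \<Rightarrow> ('n \<Rightarrow> 'n') \<Rightarrow> ('m \<times> 'n \<Rightarrow>\<^sub>0 int) \<Rightarrow> ('m' \<times> 'n' \<Rightarrow>\<^sub>0 int)" where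
  "pair_push f g = frag_extend (\<lambda>(x, y). frag_of (f x, g y))"

text \<open>
  \<open>f \<otimes> g\<close> on cosets; for linear \<open>f\<close> and \<open>g\<close> the set under \<open>the_elem\<close> is a singleton
  (\<open>tensor_map_class\<close>).
\<close>

definition tensor_map ::
    "('a, 'c) ring_scheme \<Rightarrow> ('a, 'm', 'x) module_scheme \<Rightarrow> ('a, 'n', 'y) module_scheme
      \<Rightarrow> ('m \<Rightarrow> 'm') \<Rightarrow> ('n \<Rightarrow> 'n') \<Rightarrow> ('m \<times> 'n \<Rightarrow>\<^sub>0 int) set \<Rightarrow> ('m' \<times> 'n' \<Rightarrow>\<^sub>0 int) set" where
  "tensor_map R M' N' f g C = the_elem ((\<lambda>c. tensor_class R M' N' (pair_push f g c)) ` C)"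

definition tensor ::
    "('a, 'c) ring_scheme \<Rightarrow> ('a, 'm, 'x) module_scheme \<Rightarrow> ('a, 'n, 'y) module_scheme
      \<Rightarrow> ('a, ('m \<times> 'n \<Rightarrow>\<^sub>0 int) set) module" where
  "tensor R M N = \<lparr>carrier = carrier (free_pairs M N Mod tensor_null R M N),
     monoid.mult = undefined, monoid.one = undefined,
     ring.zero = \<one>\<^bsub>free_pairs M N Mod tensor_null R M N\<^esub>,
     ring.add = monoid.mult (free_pairs M N Mod tensor_null R M N),
     smult = (\<lambda>a. tensor_map R M N (\<lambda>x. a \<odot>\<^bsub>M\<^esub> x) (\<lambda>y. y))\<rparr>"

lemma tensor_rels_keys:
  assumes "module R M" "module R N" "c \<in> tensor_rels R M N"
  shows "Poly_Mapping.keys c \<subseteq> carrier M \<times> carrier N"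
proof -
  interpret M: module R M by fact
  interpret N: module R N by fact
  have sub: "Poly_Mapping.keys (b - d) \<subseteq> A" if "Poly_Mapping.keys b \<subseteq> A" "Poly_Mapping.keys d \<subseteq> A"
    for b d :: "'c \<times> 'e \<Rightarrow>\<^sub>0 int" and A
    using that keys_diff[of b d] by blast
  show ?thesis
    using assms(3) unfolding tensor_rels_def
    by (auto intro!: sub dest!: subsetD[OF keys_diff])
qed

lemma tensor_null_keys:
  assumes "module R M" "module R N" "c \<in> tensor_null R M N"
  shows "Poly_Mapping.keys c \<subseteq> carrier M \<times> carrier N"
proof -
  have "c \<in> carrier (free_pairs M N)"
    by (rule group.generate_in_carrier[OF group_free_Abelian_group _ assms(3)[unfolded tensor_null_def]])
       (use tensor_rels_keys[OF assms(1,2)] in auto)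
  then show ?thesis by simp
qed

lemma tensor_null_subgroup:
  assumes "module R M" "module R N"
  shows "subgroup (tensor_null R M N) (free_pairs M N)"
  unfolding tensor_null_def
  by (rule group.generate_is_subgroup) (use tensor_rels_keys[OF assms] in auto)

lemma tensor_null_zero: "0 \<in> tensor_null R M N"
  using generate.one[of "free_pairs M N"] by (simp add: tensor_null_def)

lemma tensor_null_rel: "c \<in> tensor_rels R M N \<Longrightarrow> c \<in> tensor_null R M N"
  by (simp add: tensor_null_def generate.incl)

lemma tensor_null_add:
  "c \<in> tensor_null R M N \<Longrightarrow> d \<in> tensor_null R M N \<Longrightarrow> c + d \<in> tensor_null R M N"
  using generate.eng[of c "free_pairs M N" _ d] by (simp add: tensor_null_def)

lemma tensor_null_minus:
  assumes "module R M" "module R N" "c \<in> tensor_null R M N"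
  shows "- c \<in> tensor_null R M N"
  using subgroup.m_inv_closed[OF tensor_null_subgroup[OF assms(1,2)] assms(3)]
    tensor_null_keys[OF assms] by simp

lemma tensor_null_diff:
  assumes "module R M" "module R N" "c \<in> tensor_null R M N" "d \<in> tensor_null R M N"
  shows "c - d \<in> tensor_null R M N"
  using tensor_null_add[OF assms(3) tensor_null_minus[OF assms(1,2,4)]] by simp

lemma tensor_null_induct [consumes 3, case_names zero rel minus add]:
  assumes "module R M" "module R N" "c \<in> tensor_null R M N"
    and "Q 0"
    and "\<And>c. c \<in> tensor_rels R M N \<Longrightarrow> Q c"
    and "\<And>c. c \<in> tensor_null R M N \<Longrightarrow> Q c \<Longrightarrow> Q (- c)"
    and "\<And>c d. c \<in> tensor_null R M N \<Longrightarrow> d \<in> tensor_null R M N \<Longrightarrow> Q c \<Longrightarrow> Q d \<Longrightarrow> Q (c + d)"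
  shows "Q c"
  using assms(3) unfolding tensor_null_def
proof (induction rule: generate.induct)
  case one
  then show ?case using assms(4) by simp
next
  case (incl h)
  then show ?case using assms(5) by simp
next
  case (inv h)
  then show ?case
    using assms(5,6) tensor_rels_keys[OF assms(1,2)] tensor_null_rel[of h R M N] by simp
next
  case (eng h1 h2)
  then show ?case using assms(7)[of h1 h2] by (simp add: tensor_null_def)
qed

lemma pair_push_simps [simp]:
  "pair_push f g 0 = 0"
  "pair_push f g (c + d) = pair_push f g c + pair_push f g d"
  "pair_push f g (c - d) = pair_push f g c - pair_push f g d"
  "pair_push f g (- c) = - pair_push f g c"
  "pair_push f g (frag_of (x, y)) = frag_of (f x, g y)"
  by (simp_all add: pair_push_def frag_extend_add frag_extend_diff frag_extend_minus)

lemma pair_push_cong: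
  assumes "Poly_Mapping.keys c \<subseteq> A \<times> B"
    and "\<And>x. x \<in> A \<Longrightarrow> f x = f' x" "\<And>y. y \<in> B \<Longrightarrow> g y = g' y"
  shows "pair_push f g c = pair_push f' g' c"
  unfolding pair_push_def by (rule frag_extend_eq) (use assms in auto)

lemma pair_push_keys:
  assumes "Poly_Mapping.keys c \<subseteq> A \<times> B"
    and "\<And>x. x \<in> A \<Longrightarrow> f x \<in> A'" "\<And>y. y \<in> B \<Longrightarrow> g y \<in> B'"
  shows "Poly_Mapping.keys (pair_push f g c) \<subseteq> A' \<times> B'"
  using keys_frag_extend[of "\<lambda>(x, y). frag_of (f x, g y)" c] assms
  by (fastforce simp: pair_push_def split: prod.splits)

lemma pair_push_push:
  "pair_push f g (pair_push f' g' c) = pair_push (\<lambda>x. f (f' x)) (\<lambda>y. g (g' y)) c"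
proof -
  have "Poly_Mapping.keys c \<subseteq> UNIV" by simp
  then show ?thesis
    by (induction c rule: frag_induction) auto
qed

lemma pair_push_id: "pair_push (\<lambda>x. x) (\<lambda>y. y) c = c"
proof -
  have "Poly_Mapping.keys c \<subseteq> UNIV" by simp
  then show ?thesis
    by (induction c rule: frag_induction) auto
qed

lemma pair_push_null:
  assumes "module R M" "module R N" "module R M'" "module R N'"
    and f: "f \<in> mod_hom R M M'" and g: "g \<in> mod_hom R N N'"
    and c: "c \<in> tensor_null R M N"
  shows "pair_push f g c \<in> tensor_null R M' N'"
  using assms(1,2) c
proof (induction rule: tensor_null_induct)
  case (rel c)
  have "pair_push f g c \<in> tensor_rels R M' N'"
    using rel unfolding tensor_rels_def
  proof (elim UnE CollectE exE conjE, goal_cases)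
    case (1 x x' y)
    then show ?case
      by (intro UnI1 CollectI exI[of _ "f x"] exI[of _ "f x'"] exI[of _ "g y"])
        (simp add: mod_homD[OF f] mod_homD[OF g])
  next
    case (2 x y y')
    then show ?case
      by (intro UnI1 UnI2 CollectI exI[of _ "f x"] exI[of _ "g y'"] exI[of _ "g y"])
        (simp add: mod_homD[OF f] mod_homD[OF g])
  next
    case (3 a x y)
    then show ?case
      by (intro UnI2 CollectI exI[of _ "f x"] exI[of _ a] exI[of _ "g y"])
        (simp add: mod_homD[OF f] mod_homD[OF g])
  qed
  then show ?case by (rule tensor_null_rel)
next
  case (minus c)
  then show ?case using tensor_null_minus[OF assms(3,4)] by simp
next
  case (add c d)
  then show ?case using tensor_null_add by fastforce
qed (simp add: tensor_null_zero)

lemma tensor_class_eq: "tensor_class R M N c = (\<lambda>n. n + c) ` tensor_null R M N"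
  by (auto simp: tensor_class_def r_coset_def)

lemma tensor_class_eq_iff:
  assumes "module R M" "module R N"
  shows "tensor_class R M N c = tensor_class R M N d \<longleftrightarrow> c - d \<in> tensor_null R M N"
proof
  assume "tensor_class R M N c = tensor_class R M N d"
  moreover have "0 + c \<in> tensor_class R M N c"
    unfolding tensor_class_eq using tensor_null_zero by blast
  ultimately obtain n where "n \<in> tensor_null R M N" "c = n + d"
    unfolding tensor_class_eq by auto
  then show "c - d \<in> tensor_null R M N" by simp
next
  assume cd: "c - d \<in> tensor_null R M N"
  have "n + c \<in> (\<lambda>n. n + d) ` tensor_null R M N" if "n \<in> tensor_null R M N" for n
    using tensor_null_add[OF that cd] by (intro image_eqI[of _ _ "n + (c - d)"]) auto
  moreover have "n + d \<in> (\<lambda>n. n + c) ` tensor_null R M N" if "n \<in> tensor_null R M N" for n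
    using tensor_null_diff[OF assms that cd] by (intro image_eqI[of _ _ "n - (c - d)"]) auto
  ultimately show "tensor_class R M N c = tensor_class R M N d"
    unfolding tensor_class_eq by blast
qed

lemma tensor_class_add:
  "tensor_class R M N c \<oplus>\<^bsub>tensor R M N\<^esub> tensor_class R M N d = tensor_class R M N (c + d)"
proof -
  have "n + c + (n' + d) \<in> (\<lambda>n. n + (c + d)) ` tensor_null R M N"
    if "n \<in> tensor_null R M N" "n' \<in> tensor_null R M N" for n n'
    using tensor_null_add[OF that] by (intro image_eqI[of _ _ "n + n'"]) auto
  moreover have "\<exists>n1\<in>tensor_null R M N. \<exists>n2\<in>tensor_null R M N. n + (c + d) = n1 + c + (n2 + d)"
    if "n \<in> tensor_null R M N" for n
    using that tensor_null_zero by (intro bexI[of _ n] bexI[of _ 0]) auto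
  ultimately show ?thesis
    by (auto simp: tensor_def set_mult_def tensor_class_eq)
qed

lemma tensor_zero: "\<zero>\<^bsub>tensor R M N\<^esub> = tensor_class R M N 0"
  by (simp add: tensor_def tensor_class_eq)

lemma tensor_carrier:
  "carrier (tensor R M N) = tensor_class R M N ` {c. Poly_Mapping.keys c \<subseteq> carrier M \<times> carrier N}"
  by (auto simp: tensor_def carrier_FactGroup tensor_class_def)

lemma tensor_map_class:
  assumes "module R M" "module R N" "module R M'" "module R N'"
    and f: "f \<in> mod_hom R M M'" and g: "g \<in> mod_hom R N N'"
  shows "tensor_map R M' N' f g (tensor_class R M N c) = tensor_class R M' N' (pair_push f g c)"
proof -
  have "tensor_class R M' N' (pair_push f g b) = tensor_class R M' N' (pair_push f g c)"
    if b: "b \<in> tensor_class R M N c" for b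
  proof -
    obtain n where "n \<in> tensor_null R M N" "b = n + c"
      using b by (auto simp: tensor_class_eq)
    then show ?thesis
      using pair_push_null[OF assms] by (simp add: tensor_class_eq_iff[OF assms(3,4)])
  qed
  moreover have "c \<in> tensor_class R M N c"
    using tensor_null_zero by (force simp: tensor_class_eq)
  ultimately have "(\<lambda>c. tensor_class R M' N' (pair_push f g c)) ` tensor_class R M N c
      = {tensor_class R M' N' (pair_push f g c)}"
    by blast
  then show ?thesis by (simp add: tensor_map_def)
qed

lemma tensor_smult_class:
  assumes "module R M" "module R N" "a \<in> carrier R"
  shows "a \<odot>\<^bsub>tensor R M N\<^esub> tensor_class R M N c
    = tensor_class R M N (pair_push (\<lambda>x. a \<odot>\<^bsub>M\<^esub> x) (\<lambda>y. y) c)"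
  by (simp add: tensor_def tensor_map_class assms mod_hom_id mod_hom_smult)

lemma pairs_induct [consumes 1, case_names zero of diff]:
  assumes "Poly_Mapping.keys c \<subseteq> A \<times> B"
    and "Q 0" and "\<And>x y. x \<in> A \<Longrightarrow> y \<in> B \<Longrightarrow> Q (frag_of (x, y))"
    and "\<And>c d. Q c \<Longrightarrow> Q d \<Longrightarrow> Q (c - d)"
  shows "Q c"
  using assms(1) by (induction c rule: frag_induction) (use assms in auto)

lemma tensor_module:
  assumes "module R M" "module R N"
  shows "module R (tensor R M N)"
proof -
  interpret M: module R M by fact
  interpret N: module R N by fact
  let ?T = "tensor R M N" and ?c = "tensor_class R M N" and ?K = "tensor_null R M N"
  let ?s = "\<lambda>a. pair_push (\<lambda>x. a \<odot>\<^bsub>M\<^esub> x) (\<lambda>y. y)"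
  note cls = tensor_class_eq_iff[OF assms]
  have smk: "Poly_Mapping.keys (?s a c) \<subseteq> carrier M \<times> carrier N"
    if "Poly_Mapping.keys c \<subseteq> carrier M \<times> carrier N" "a \<in> carrier R" for a c
    using that by (intro pair_push_keys[of _ "carrier M" "carrier N"]) auto
  show ?thesis
  proof (rule moduleI)
    show "cring R" by (rule M.R.is_cring)
    show "abelian_group ?T"
    proof (rule abelian_groupI)
      fix x assume "x \<in> carrier ?T"
      then obtain c where c: "x = ?c c" "Poly_Mapping.keys c \<subseteq> carrier M \<times> carrier N"
        by (auto simp: tensor_carrier)
      then show "\<exists>y\<in>carrier ?T. y \<oplus>\<^bsub>?T\<^esub> x = \<zero>\<^bsub>?T\<^esub>"
        by (intro bexI[of _ "?c (- c)"]) (auto simp: tensor_class_add tensor_zero tensor_carrier)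
    qed (auto simp: tensor_carrier tensor_class_add tensor_zero ac_simps dest!: subsetD[OF Poly_Mapping.keys_add])
    fix a x assume a: "a \<in> carrier R" and "x \<in> carrier ?T"
    then obtain c where c: "x = ?c c" "Poly_Mapping.keys c \<subseteq> carrier M \<times> carrier N"
      by (auto simp: tensor_carrier)
    show "a \<odot>\<^bsub>?T\<^esub> x \<in> carrier ?T"
      using c a smk by (auto simp: tensor_smult_class assms tensor_carrier)
    fix b assume b: "b \<in> carrier R"
    have "?s (a \<oplus>\<^bsub>R\<^esub> b) c - (?s a c + ?s b c) \<in> ?K"
      using c(2)
    proof (induction c rule: pairs_induct)
      case (of x y)
      have "frag_of (a \<odot>\<^bsub>M\<^esub> x \<oplus>\<^bsub>M\<^esub> b \<odot>\<^bsub>M\<^esub> x, y) - frag_of (a \<odot>\<^bsub>M\<^esub> x, y) - frag_of (b \<odot>\<^bsub>M\<^esub> x, y) \<in> tensor_rels R M N"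
        unfolding tensor_rels_def using of a b by auto
      then show ?case using of a b tensor_null_rel by (simp add: M.smult_l_distr diff_diff_add)
    next
      case (diff c d)
      then show ?case using tensor_null_diff[OF assms diff] by (simp add: algebra_simps)
    qed (simp add: tensor_null_zero)
    then show "(a \<oplus>\<^bsub>R\<^esub> b) \<odot>\<^bsub>?T\<^esub> x = a \<odot>\<^bsub>?T\<^esub> x \<oplus>\<^bsub>?T\<^esub> b \<odot>\<^bsub>?T\<^esub> x"
      using c a b by (simp add: tensor_smult_class assms tensor_class_add cls)
    have "?s (a \<otimes>\<^bsub>R\<^esub> b) c = ?s a (?s b c)"
      unfolding pair_push_push using c(2)
      by (rule pair_push_cong) (auto simp: M.smult_assoc1 a b)
    then show "(a \<otimes>\<^bsub>R\<^esub> b) \<odot>\<^bsub>?T\<^esub> x = a \<odot>\<^bsub>?T\<^esub> (b \<odot>\<^bsub>?T\<^esub> x)"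
      using c a b by (simp add: tensor_smult_class assms)
  next
    fix a x y assume a: "a \<in> carrier R" and "x \<in> carrier ?T" "y \<in> carrier ?T"
    then show "a \<odot>\<^bsub>?T\<^esub> (x \<oplus>\<^bsub>?T\<^esub> y) = a \<odot>\<^bsub>?T\<^esub> x \<oplus>\<^bsub>?T\<^esub> a \<odot>\<^bsub>?T\<^esub> y"
      by (auto simp: tensor_carrier tensor_class_add tensor_smult_class assms)
  next
    fix x assume "x \<in> carrier ?T"
    then obtain c where c: "x = ?c c" "Poly_Mapping.keys c \<subseteq> carrier M \<times> carrier N"
      by (auto simp: tensor_carrier)
    have "?s \<one>\<^bsub>R\<^esub> c = pair_push (\<lambda>x. x) (\<lambda>y. y) c"
      using c(2) by (rule pair_push_cong) auto
    then show "\<one>\<^bsub>R\<^esub> \<odot>\<^bsub>?T\<^esub> x = x"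
      using c by (simp add: tensor_smult_class assms pair_push_id)
  qed
qed

lemma tensor_map_hom:
  assumes "module R M" "module R N" "module R M'" "module R N'"
    and f: "f \<in> mod_hom R M M'" and g: "g \<in> mod_hom R N N'"
  shows "tensor_map R M' N' f g \<in> mod_hom R (tensor R M N) (tensor R M' N')"
proof (rule mod_homI)
  fix x assume "x \<in> carrier (tensor R M N)"
  then obtain c where c: "x = tensor_class R M N c" "Poly_Mapping.keys c \<subseteq> carrier M \<times> carrier N"
    by (auto simp: tensor_carrier)
  show "tensor_map R M' N' f g x \<in> carrier (tensor R M' N')"
    using pair_push_keys[OF c(2) mod_homD(1)[OF f] mod_homD(1)[OF g]]
    by (simp add: c(1) tensor_map_class[OF assms] tensor_carrier)
  fix a assume a: "a \<in> carrier R"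
  have "pair_push f g (pair_push (\<lambda>x. a \<odot>\<^bsub>M\<^esub> x) (\<lambda>y. y) c)
      = pair_push (\<lambda>x. a \<odot>\<^bsub>M'\<^esub> x) (\<lambda>y. y) (pair_push f g c)"
    unfolding pair_push_push using c(2)
    by (rule pair_push_cong) (auto simp: mod_homD[OF f] a)
  then show "tensor_map R M' N' f g (a \<odot>\<^bsub>tensor R M N\<^esub> x) = a \<odot>\<^bsub>tensor R M' N'\<^esub> tensor_map R M' N' f g x"
    using c a by (simp add: tensor_map_class[OF assms] tensor_smult_class assms(1-4))
next
  fix x y assume "x \<in> carrier (tensor R M N)" "y \<in> carrier (tensor R M N)"
  then show "tensor_map R M' N' f g (x \<oplus>\<^bsub>tensor R M N\<^esub> y)
      = tensor_map R M' N' f g x \<oplus>\<^bsub>tensor R M' N'\<^esub> tensor_map R M' N' f g y"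
    by (auto simp: tensor_carrier tensor_class_add tensor_map_class[OF assms])
qed

lemma incl_hom: "H \<subseteq> carrier M \<Longrightarrow> (\<lambda>x. x) \<in> mod_hom R (M\<lparr>carrier := H\<rparr>) M"
  by (rule mod_homI) auto

lemma tensor_relsI:
  "x \<in> carrier M \<Longrightarrow> x' \<in> carrier M \<Longrightarrow> y \<in> carrier N \<Longrightarrow>
    frag_of (x \<oplus>\<^bsub>M\<^esub> x', y) - frag_of (x, y) - frag_of (x', y) \<in> tensor_rels R M N"
  "x \<in> carrier M \<Longrightarrow> y \<in> carrier N \<Longrightarrow> y' \<in> carrier N \<Longrightarrow>
    frag_of (x, y \<oplus>\<^bsub>N\<^esub> y') - frag_of (x, y) - frag_of (x, y') \<in> tensor_rels R M N"
  "a \<in> carrier R \<Longrightarrow> x \<in> carrier M \<Longrightarrow> y \<in> carrier N \<Longrightarrow>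
    frag_of (a \<odot>\<^bsub>M\<^esub> x, y) - frag_of (x, a \<odot>\<^bsub>N\<^esub> y) \<in> tensor_rels R M N"
  unfolding tensor_rels_def by blast+

lemma tensor_null_local:
  assumes "module R M" "module R N" "c \<in> tensor_null R M N"
  shows "\<exists>A. finite A \<and> A \<subseteq> carrier N \<and>
    (\<forall>H. submodule H R N \<longrightarrow> A \<subseteq> H \<longrightarrow> c \<in> tensor_null R M (N\<lparr>carrier := H\<rparr>))"
  using assms
proof (induction rule: tensor_null_induct)
  case zero
  then show ?case by (intro exI[of _ "{}"]) (auto simp: tensor_null_zero)
next
  case (rel c)
  interpret N: module R N by fact
  have *: "\<exists>A. finite A \<and> A \<subseteq> carrier N \<and> (\<forall>H. A \<subseteq> H \<longrightarrow> c \<in> tensor_rels R M (N\<lparr>carrier := H\<rparr>))"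
    using rel[unfolded tensor_rels_def]
  proof (elim UnE CollectE exE conjE, goal_cases)
    case (1 x x' y)
    then have "c \<in> tensor_rels R M (N\<lparr>carrier := H\<rparr>)" if "{y} \<subseteq> H" for H
      using tensor_relsI(1)[of x M x' y "N\<lparr>carrier := H\<rparr>" R] that by simp
    then show ?case using 1 by (intro exI[of _ "{y}"]) simp
  next
    case (2 x y y')
    then have "c \<in> tensor_rels R M (N\<lparr>carrier := H\<rparr>)" if "{y, y'} \<subseteq> H" for H
      using tensor_relsI(2)[of x M y "N\<lparr>carrier := H\<rparr>" y' R] that by simp
    then show ?case using 2 by (intro exI[of _ "{y, y'}"]) simp
  next
    case (3 a x y)
    then have "c \<in> tensor_rels R M (N\<lparr>carrier := H\<rparr>)" if "{y} \<subseteq> H" for H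
      using tensor_relsI(3)[of a R x M y "N\<lparr>carrier := H\<rparr>"] that by simp
    then show ?case using 3 by (intro exI[of _ "{y}"]) simp
  qed
  obtain A where A: "finite A" "A \<subseteq> carrier N"
    "\<And>H. A \<subseteq> H \<Longrightarrow> c \<in> tensor_rels R M (N\<lparr>carrier := H\<rparr>)"
    using * by blast
  show ?case by (intro exI[of _ A]) (simp add: A tensor_null_rel)
next
  case (minus c)
  then obtain A where A: "finite A" "A \<subseteq> carrier N"
    "\<And>H. submodule H R N \<Longrightarrow> A \<subseteq> H \<Longrightarrow> c \<in> tensor_null R M (N\<lparr>carrier := H\<rparr>)" by blast
  show ?case
    by (intro exI[of _ A]) (simp add: A tensor_null_minus[OF assms(1) submodule_module[OF assms(2)]])
next
  case (add c d)
  then obtain A B where A: "finite A" "A \<subseteq> carrier N"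
    "\<And>H. submodule H R N \<Longrightarrow> A \<subseteq> H \<Longrightarrow> c \<in> tensor_null R M (N\<lparr>carrier := H\<rparr>)"
    and B: "finite B" "B \<subseteq> carrier N"
    "\<And>H. submodule H R N \<Longrightarrow> B \<subseteq> H \<Longrightarrow> d \<in> tensor_null R M (N\<lparr>carrier := H\<rparr>)" by blast
  then show ?case
    by (intro exI[of _ "A \<union> B"]) (simp add: tensor_null_add)
qed

lemma null_transfer:
  fixes R :: "('a, 'c) ring_scheme" and T :: "('a, 't, 'z) module_scheme"
  assumes "module R P" "module R Q" "module R M"
    and f: "f \<in> mod_hom R P Q" and g: "g \<in> mod_hom R P M"
    and fg: "\<And>(N :: ('a, 'a list) module) c. module R N \<Longrightarrow> Poly_Mapping.keys c \<subseteq> carrier P \<times> carrier N \<Longrightarrow>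
       pair_push f (\<lambda>y. y) c \<in> tensor_null R Q N \<Longrightarrow> pair_push g (\<lambda>y. y) c \<in> tensor_null R M N"
    and T: "module R T" and c: "Poly_Mapping.keys c \<subseteq> carrier P \<times> carrier T"
    and null: "pair_push f (\<lambda>y. y) c \<in> tensor_null R Q T"
  shows "pair_push g (\<lambda>y. y) c \<in> tensor_null R M T"
proof -
  obtain A where A: "finite A" "A \<subseteq> carrier T"
    "\<And>H. submodule H R T \<Longrightarrow> A \<subseteq> H \<Longrightarrow> pair_push f (\<lambda>y. y) c \<in> tensor_null R Q (T\<lparr>carrier := H\<rparr>)"
    using tensor_null_local[OF assms(2) T null] by blast
  define B where "B = A \<union> snd ` Poly_Mapping.keys c"
  have B: "finite B" "B \<subseteq> carrier T" using A c by (auto simp: B_def)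
  define H where "H = submodule_gen R T B"
  have H: "submodule H R T" "B \<subseteq> H"
    unfolding H_def using submodule_gen_submodule[OF T B(2)] submodule_gen_superset[of B R T] by auto
  have Hc: "H \<subseteq> carrier T" using module.submoduleE(1)[OF T H(1)] .
  obtain h :: "'t \<Rightarrow> 'a list" where h: "inj_on h H" using fg_inj_list[OF T B] H_def by blast
  let ?H = "T\<lparr>carrier := H\<rparr>"
  have mH: "module R ?H" by (rule submodule_module[OF T H(1)])
  have h': "inj_on h (carrier ?H)" using h by simp
  let ?N = "transport h ?H" and ?k = "inv_into H h"
  note tr = transport[OF mH h']
  have cH: "Poly_Mapping.keys c \<subseteq> carrier P \<times> H"
    using c H(2) by (force simp: B_def)
  have "pair_push f (\<lambda>y. y) c \<in> tensor_null R Q ?H" using A(3)[OF H(1)] H(2) by (auto simp: B_def)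
  then have "pair_push (\<lambda>x. x) h (pair_push f (\<lambda>y. y) c) \<in> tensor_null R Q ?N"
    by (rule pair_push_null[OF assms(2) mH assms(2) tr(1) mod_hom_id tr(2)])
  then have "pair_push f (\<lambda>y. y) (pair_push (\<lambda>x. x) h c) \<in> tensor_null R Q ?N"
    by (simp add: pair_push_push)
  moreover have "Poly_Mapping.keys (pair_push (\<lambda>x. x) h c) \<subseteq> carrier P \<times> carrier ?N"
    using cH tr(4) by (intro pair_push_keys[of _ "carrier P" H]) auto
  ultimately have "pair_push g (\<lambda>y. y) (pair_push (\<lambda>x. x) h c) \<in> tensor_null R M ?N"
    using fg[OF tr(1)] by blast
  then have "pair_push (\<lambda>x. x) (inv_into (carrier ?H) h) (pair_push g (\<lambda>y. y) (pair_push (\<lambda>x. x) h c)) \<in> tensor_null R M ?H"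
    by (rule pair_push_null[OF assms(3) tr(1) assms(3) mH mod_hom_id tr(3)])
  then have "pair_push g (\<lambda>y. inv_into H h (h y)) c \<in> tensor_null R M ?H"
    by (simp add: pair_push_push)
  also have "pair_push g (\<lambda>y. inv_into H h (h y)) c = pair_push g (\<lambda>y. y) c"
    using cH by (rule pair_push_cong) (auto simp: h)
  finally have "pair_push (\<lambda>x. x) (\<lambda>y. y) (pair_push g (\<lambda>y. y) c) \<in> tensor_null R M T"
    by (rule pair_push_null[OF assms(3) mH assms(3) T mod_hom_id incl_hom[OF Hc]])
  then show ?thesis by (simp add: pair_push_id)
qed

lemma kernel_mem_iff:
  assumes "module R P" "module R K" "module R N" "k \<in> mod_hom R P K"
    and "Poly_Mapping.keys c \<subseteq> carrier P \<times> carrier N"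
  shows "tensor_class R P N c \<in> a_kernel (tensor R P N) (tensor R K N) (tensor_map R K N k (\<lambda>y. y))
    \<longleftrightarrow> pair_push k (\<lambda>y. y) c \<in> tensor_null R K N"
  using assms unfolding a_kernel_def'
  by (simp add: tensor_carrier tensor_zero tensor_map_class mod_hom_id tensor_class_eq_iff image_eqI[OF refl])

lemma kernel_le_iff:
  assumes "module R P" "module R Q" "module R M" "module R N"
    and "f \<in> mod_hom R P Q" "g \<in> mod_hom R P M"
  shows "a_kernel (tensor R P N) (tensor R Q N) (tensor_map R Q N f (\<lambda>y. y)) \<subseteq>
         a_kernel (tensor R P N) (tensor R M N) (tensor_map R M N g (\<lambda>y. y)) \<longleftrightarrow>
   (\<forall>c. Poly_Mapping.keys c \<subseteq> carrier P \<times> carrier N \<longrightarrow>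
       pair_push f (\<lambda>y. y) c \<in> tensor_null R Q N \<longrightarrow> pair_push g (\<lambda>y. y) c \<in> tensor_null R M N)"
    (is "?K \<subseteq> ?L \<longleftrightarrow> ?r")
proof -
  have "?K \<subseteq> carrier (tensor R P N)" by (auto simp: a_kernel_def')
  then have "?K \<subseteq> ?L \<longleftrightarrow> (\<forall>c. Poly_Mapping.keys c \<subseteq> carrier P \<times> carrier N \<longrightarrow>
      tensor_class R P N c \<in> ?K \<longrightarrow> tensor_class R P N c \<in> ?L)"
    unfolding tensor_carrier by blast
  then show ?thesis by (simp add: kernel_mem_iff assms cong: imp_cong)
qed

section \<open>Purity, domination and the Mittag-Leffler condition\<close>

text \<open>
  A HOL formula cannot quantify over all types, so "every \<open>R\<close>-module" is rendered as every \<open>R\<close>-module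
  with carrier in \<open>'a list\<close>, where \<open>'a\<close> is the type of the scalars.  Every finitely generated
  \<open>R\<close>-module has a copy there, and this suffices: \<open>pure_map_all\<close> and \<open>dominate_all\<close> show that the
  test modules in \<open>'a list\<close> decide the condition for modules over any type, \<open>mittag_leffler_all\<close>
  gives the Mittag-Leffler property for \<open>P\<close> over any type, and \<open>dominate_copy\<close> shows that a
  dominating \<open>Q\<close> over any type can be replaced by one over \<open>'a list\<close>.
\<close>

definition pure_map ::
    "('a, 'c) ring_scheme \<Rightarrow> ('a, 'm, 'x) module_scheme \<Rightarrow> ('a, 'n, 'y) module_scheme \<Rightarrow> ('m \<Rightarrow> 'n) \<Rightarrow> bool" where
  "pure_map R M N f \<longleftrightarrow>
     (\<forall>T :: ('a, 'a list) module. module R T \<longrightarrow>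
        inj_on (tensor_map R N T f (\<lambda>t. t)) (carrier (tensor R M T)))"

definition dominate ::
    "('a, 'c) ring_scheme \<Rightarrow> ('a, 'p, 'x) module_scheme \<Rightarrow> ('a, 'q, 'y) module_scheme \<Rightarrow> ('a, 'm, 'z) module_scheme
      \<Rightarrow> ('p \<Rightarrow> 'q) \<Rightarrow> ('p \<Rightarrow> 'm) \<Rightarrow> bool" where
  "dominate R P Q M f g \<longleftrightarrow>
     (\<forall>N :: ('a, 'a list) module. module R N \<longrightarrow>
        a_kernel (tensor R P N) (tensor R Q N) (tensor_map R Q N f (\<lambda>y. y)) =
        a_kernel (tensor R P N) (tensor R M N) (tensor_map R M N g (\<lambda>y. y)))"

definition mittag_leffler :: "('a, 'c) ring_scheme \<Rightarrow> ('a, 'm, 'x) module_scheme \<Rightarrow> bool" where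
  "mittag_leffler R M \<longleftrightarrow> module R M \<and>
     (\<forall>P :: ('a, 'a list) module. \<forall>g\<in>mod_hom R P M. finitely_presented R P \<longrightarrow>
        (\<exists>Q :: ('a, 'a list) module. \<exists>f\<in>mod_hom R P Q.
           finitely_presented R Q \<and> dominate R P Q M f g))"

theorem dominate_all:
  assumes "module R P" "module R Q" "module R M"
    and "f \<in> mod_hom R P Q" "g \<in> mod_hom R P M"
    and dom: "dominate R P Q M f g" and N: "module R N"
  shows "a_kernel (tensor R P N) (tensor R Q N) (tensor_map R Q N f (\<lambda>y. y)) =
         a_kernel (tensor R P N) (tensor R M N) (tensor_map R M N g (\<lambda>y. y))"
  using null_transfer[OF assms(1-5) _ N] null_transfer[OF assms(1,3,2,5,4) _ N] dom
  by (simp add: dominate_def set_eq_subset kernel_le_iff assms)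

lemma inj_tensor_iff:
  assumes "module R M" "module R N" "module R T" "f \<in> mod_hom R M N"
  shows "inj_on (tensor_map R N T f (\<lambda>t. t)) (carrier (tensor R M T)) \<longleftrightarrow>
   (\<forall>c. Poly_Mapping.keys c \<subseteq> carrier M \<times> carrier T \<longrightarrow>
       pair_push f (\<lambda>y. y) c \<in> tensor_null R N T \<longrightarrow> c \<in> tensor_null R M T)" (is "?l \<longleftrightarrow> ?r")
proof
  assume inj: ?l
  show ?r
  proof (intro allI impI)
    fix c assume c: "Poly_Mapping.keys c \<subseteq> carrier M \<times> carrier T" "pair_push f (\<lambda>y. y) c \<in> tensor_null R N T"
    have "tensor_class R M T c = tensor_class R M T 0"
      by (rule inj_onD[OF inj])
        (use c in \<open>auto simp: tensor_carrier tensor_map_class assms mod_hom_id tensor_class_eq_iff\<close>)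
    then show "c \<in> tensor_null R M T" by (simp add: tensor_class_eq_iff assms)
  qed
next
  assume r: ?r
  show ?l
  proof (rule inj_onI)
    fix x y assume "x \<in> carrier (tensor R M T)" "y \<in> carrier (tensor R M T)"
      and eq: "tensor_map R N T f (\<lambda>t. t) x = tensor_map R N T f (\<lambda>t. t) y"
    then obtain c d where cd: "x = tensor_class R M T c" "y = tensor_class R M T d"
      "Poly_Mapping.keys c \<subseteq> carrier M \<times> carrier T" "Poly_Mapping.keys d \<subseteq> carrier M \<times> carrier T"
      by (auto simp: tensor_carrier)
    then have "pair_push f (\<lambda>y. y) (c - d) \<in> tensor_null R N T"
      using eq by (simp add: tensor_map_class assms mod_hom_id tensor_class_eq_iff)
    moreover have "Poly_Mapping.keys (c - d) \<subseteq> carrier M \<times> carrier T"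
      using cd keys_diff[of c d] by blast
    ultimately show "x = y" using r cd by (simp add: tensor_class_eq_iff assms)
  qed
qed

theorem pure_map_all:
  assumes "module R M" "module R N" "f \<in> mod_hom R M N"
    and pure: "pure_map R M N f" and T: "module R T"
  shows "inj_on (tensor_map R N T f (\<lambda>t. t)) (carrier (tensor R M T))"
  using null_transfer[OF assms(1,2,1,3) mod_hom_id _ T] pure
  by (simp add: pure_map_def inj_tensor_iff assms pair_push_id)

lemma dominate_iff:
  fixes R :: "('a, 'c) ring_scheme"
  assumes "module R P" "module R Q" "module R M" "f \<in> mod_hom R P Q" "g \<in> mod_hom R P M"
  shows "dominate R P Q M f g \<longleftrightarrow>
    (\<forall>(N :: ('a, 'a list) module) c. module R N \<longrightarrow> Poly_Mapping.keys c \<subseteq> carrier P \<times> carrier N \<longrightarrow>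
      (pair_push f (\<lambda>y. y) c \<in> tensor_null R Q N \<longleftrightarrow> pair_push g (\<lambda>y. y) c \<in> tensor_null R M N))"
  unfolding dominate_def set_eq_subset using assms by (auto simp: kernel_le_iff)

lemma null_inj_iff:
  assumes "module R Q" "module R N" "inj_on h (carrier Q)"
    and "Poly_Mapping.keys c \<subseteq> carrier Q \<times> carrier N"
  shows "pair_push h (\<lambda>y. y) c \<in> tensor_null R (transport h Q) N \<longleftrightarrow> c \<in> tensor_null R Q N"
proof
  note tr = transport[OF assms(1,3)]
  assume "pair_push h (\<lambda>y. y) c \<in> tensor_null R (transport h Q) N"
  then have "pair_push (inv_into (carrier Q) h) (\<lambda>y. y) (pair_push h (\<lambda>y. y) c) \<in> tensor_null R Q N"
    by (rule pair_push_null[OF tr(1) assms(2,1,2) tr(3) mod_hom_id])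
  also have "pair_push (inv_into (carrier Q) h) (\<lambda>y. y) (pair_push h (\<lambda>y. y) c) = pair_push (\<lambda>x. x) (\<lambda>y. y) c"
    unfolding pair_push_push using assms(4) by (rule pair_push_cong) (auto simp: assms(3))
  finally show "c \<in> tensor_null R Q N" by (simp add: pair_push_id)
next
  note tr = transport[OF assms(1,3)]
  assume "c \<in> tensor_null R Q N"
  then show "pair_push h (\<lambda>y. y) c \<in> tensor_null R (transport h Q) N"
    by (rule pair_push_null[OF assms(1,2) tr(1) assms(2) tr(2) mod_hom_id])
qed

theorem mittag_leffler_all:
  fixes R :: "('a, 'c) ring_scheme" and P :: "('a, 'p, 'y) module_scheme"
  assumes ml: "mittag_leffler R M" and fp: "finitely_presented R P" and g: "g \<in> mod_hom R P M"
  shows "\<exists>Q :: ('a, 'a list) module. \<exists>f\<in>mod_hom R P Q. finitely_presented R Q \<and> dominate R P Q M f g"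
proof -
  have M: "module R M" using ml by (simp add: mittag_leffler_def)
  have P: "module R P" using fp by (simp add: finitely_presented_def)
  obtain h :: "'p \<Rightarrow> 'a list" where h: "inj_on h (carrier P)"
    using finitely_presented_inj_list[OF fp] by blast
  note tr = transport[OF P h]
  let ?k = "inv_into (carrier P) h"
  have g': "(\<lambda>x. g (?k x)) \<in> mod_hom R (transport h P) M" by (rule mod_hom_comp[OF tr(3) g])
  obtain Q :: "('a, 'a list) module" and f
    where f: "f \<in> mod_hom R (transport h P) Q" and Q: "finitely_presented R Q"
      and dom: "dominate R (transport h P) Q M f (\<lambda>x. g (?k x))"
    using ml g' finitely_presented_transport[OF fp h] unfolding mittag_leffler_def by blast
  have mQ: "module R Q" using Q by (simp add: finitely_presented_def)
  have f': "(\<lambda>x. f (h x)) \<in> mod_hom R P Q" by (rule mod_hom_comp[OF tr(2) f])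
  have "dominate R P Q M (\<lambda>x. f (h x)) g"
    unfolding dominate_iff[OF P mQ M f' g]
  proof (intro allI impI)
    fix N :: "('a, 'a list) module" and c :: "_ \<Rightarrow>\<^sub>0 int"
    assume N: "module R N" and c: "Poly_Mapping.keys c \<subseteq> carrier P \<times> carrier N"
    have c': "Poly_Mapping.keys (pair_push h (\<lambda>y. y) c) \<subseteq> carrier (transport h P) \<times> carrier N"
      using c by (rule pair_push_keys) (use mod_homD(1)[OF tr(2)] in auto)
    have "pair_push (\<lambda>x. g (?k (h x))) (\<lambda>y. y) c = pair_push g (\<lambda>y. y) c"
      using c by (rule pair_push_cong) (auto simp: h)
    then show "pair_push (\<lambda>x. f (h x)) (\<lambda>y. y) c \<in> tensor_null R Q N \<longleftrightarrow> pair_push g (\<lambda>y. y) c \<in> tensor_null R M N"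
      using dom[unfolded dominate_iff[OF tr(1) mQ M f g'], rule_format, OF N c'] by (simp add: pair_push_push)
  qed
  then show ?thesis using f' Q by blast
qed

theorem dominate_copy:
  fixes R :: "('a, 'c) ring_scheme" and Q :: "('a, 'q, 'y) module_scheme"
  assumes P: "module R P" and M: "module R M" and g: "g \<in> mod_hom R P M"
    and fp: "finitely_presented R Q" and f: "f \<in> mod_hom R P Q" and dom: "dominate R P Q M f g"
  shows "\<exists>Q' :: ('a, 'a list) module. \<exists>f'\<in>mod_hom R P Q'. finitely_presented R Q' \<and> dominate R P Q' M f' g"
proof -
  have Q: "module R Q" using fp by (simp add: finitely_presented_def)
  obtain h :: "'q \<Rightarrow> 'a list" where h: "inj_on h (carrier Q)"
    using finitely_presented_inj_list[OF fp] by blast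
  note tr = transport[OF Q h]
  have f': "(\<lambda>x. h (f x)) \<in> mod_hom R P (transport h Q)" by (rule mod_hom_comp[OF f tr(2)])
  have "dominate R P (transport h Q) M (\<lambda>x. h (f x)) g"
    unfolding dominate_iff[OF P tr(1) M f' g]
  proof (intro allI impI)
    fix N :: "('a, 'a list) module" and c :: "_ \<Rightarrow>\<^sub>0 int"
    assume N: "module R N" and c: "Poly_Mapping.keys c \<subseteq> carrier P \<times> carrier N"
    have c': "Poly_Mapping.keys (pair_push f (\<lambda>y. y) c) \<subseteq> carrier Q \<times> carrier N"
      using c by (rule pair_push_keys) (use mod_homD(1)[OF f] in auto)
    show "pair_push (\<lambda>x. h (f x)) (\<lambda>y. y) c \<in> tensor_null R (transport h Q) N \<longleftrightarrow> pair_push g (\<lambda>y. y) c \<in> tensor_null R M N"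
      using null_inj_iff[OF Q N h c'] dom[unfolded dominate_iff[OF P Q M f g], rule_format, OF N c]
      by (simp add: pair_push_push)
  qed
  then show ?thesis using f' finitely_presented_transport[OF fp h] by blast
qed

section \<open>Localization\<close>

text \<open>
  Operations on fractions are given as unions over representatives; the unions are taken over
  constant families, so they pick out a single class (\<open>loc_add_frac\<close>, \<open>loc_smult_frac\<close>,
  \<open>loc_mult_frac\<close>, \<open>loc_map_frac\<close>).
\<close>

definition loc_rel ::
    "('a, 'c) ring_scheme \<Rightarrow> 'a set \<Rightarrow> ('a, 'm, 'x) module_scheme \<Rightarrow> (('m \<times> 'a) \<times> ('m \<times> 'a)) set" where
  "loc_rel R S M = {((x, s), (y, t)). x \<in> carrier M \<and> s \<in> S \<and> y \<in> carrier M \<and> t \<in> S \<and>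
     (\<exists>u\<in>S. u \<odot>\<^bsub>M\<^esub> (t \<odot>\<^bsub>M\<^esub> x) = u \<odot>\<^bsub>M\<^esub> (s \<odot>\<^bsub>M\<^esub> y))}"

definition loc_frac ::
    "('a, 'c) ring_scheme \<Rightarrow> 'a set \<Rightarrow> ('a, 'm, 'x) module_scheme \<Rightarrow> 'm \<Rightarrow> 'a \<Rightarrow> ('m \<times> 'a) set" where
  "loc_frac R S M x s = loc_rel R S M `` {(x, s)}"

definition self_module :: "('a, 'c) ring_scheme \<Rightarrow> ('a, 'a) module" where
  "self_module R = \<lparr>carrier = carrier R, monoid.mult = monoid.mult R, monoid.one = monoid.one R, ring.zero = ring.zero R, ring.add = ring.add R,
     smult = monoid.mult R\<rparr>"

definition loc_ring :: "('a, 'c) ring_scheme \<Rightarrow> 'a set \<Rightarrow> ('a \<times> 'a) set ring" where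
  "loc_ring R S =
    (let fr = loc_frac R S (self_module R) in
     \<lparr>carrier = (carrier R \<times> S) // loc_rel R S (self_module R),
      monoid.mult = (\<lambda>A B. \<Union>(a, s)\<in>A. \<Union>(b, t)\<in>B. fr (a \<otimes>\<^bsub>R\<^esub> b) (s \<otimes>\<^bsub>R\<^esub> t)),
      monoid.one = fr \<one>\<^bsub>R\<^esub> \<one>\<^bsub>R\<^esub>,
      ring.zero = fr \<zero>\<^bsub>R\<^esub> \<one>\<^bsub>R\<^esub>,
      ring.add = (\<lambda>A B. \<Union>(a, s)\<in>A. \<Union>(b, t)\<in>B.
               fr (t \<otimes>\<^bsub>R\<^esub> a \<oplus>\<^bsub>R\<^esub> s \<otimes>\<^bsub>R\<^esub> b) (s \<otimes>\<^bsub>R\<^esub> t))\<rparr>)"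

definition loc_module ::
    "('a, 'c) ring_scheme \<Rightarrow> 'a set \<Rightarrow> ('a, 'm, 'x) module_scheme
      \<Rightarrow> (('a \<times> 'a) set, ('m \<times> 'a) set) module" where
  "loc_module R S M =
    (let fr = loc_frac R S M in
     \<lparr>carrier = (carrier M \<times> S) // loc_rel R S M,
      monoid.mult = undefined, monoid.one = undefined,
      ring.zero = fr \<zero>\<^bsub>M\<^esub> \<one>\<^bsub>R\<^esub>,
      ring.add = (\<lambda>C D. \<Union>(x, s)\<in>C. \<Union>(y, t)\<in>D.
               fr (t \<odot>\<^bsub>M\<^esub> x \<oplus>\<^bsub>M\<^esub> s \<odot>\<^bsub>M\<^esub> y) (s \<otimes>\<^bsub>R\<^esub> t)),
      smult = (\<lambda>A C. \<Union>(a, s)\<in>A. \<Union>(x, t)\<in>C. fr (a \<odot>\<^bsub>M\<^esub> x) (s \<otimes>\<^bsub>R\<^esub> t))\<rparr>)"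

definition loc_map ::
    "('a, 'c) ring_scheme \<Rightarrow> 'a set \<Rightarrow> ('a, 'n, 'y) module_scheme \<Rightarrow> ('m \<Rightarrow> 'n)
      \<Rightarrow> ('m \<times> 'a) set \<Rightarrow> ('n \<times> 'a) set" where
  "loc_map R S N f C = (\<Union>(x, s)\<in>C. loc_frac R S N (f x) s)"

locale mult_subset = cring R for R (structure) and S +
  assumes S_subset: "S \<subseteq> carrier R" and one_mem_S: "\<one> \<in> S"
    and S_mult: "s \<in> S \<Longrightarrow> t \<in> S \<Longrightarrow> s \<otimes> t \<in> S"
begin

lemma S_carrier [simp]: "s \<in> S \<Longrightarrow> s \<in> carrier R"
  using S_subset by blast

end

lemma primeideal_mult_subset:
  assumes "primeideal p R"
  shows "mult_subset R (carrier R - p)"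
proof -
  interpret primeideal p R by fact
  show ?thesis
    by unfold_locales (use I_notcarr one_imp_carrier I_prime in auto)
qed

locale loc_setup = mult_subset R S + module R M for R (structure) and S and M (structure)
begin

lemma loc_relI:
  "\<lbrakk>x \<in> carrier M; y \<in> carrier M; s \<in> S; t \<in> S; u \<in> S; (u \<otimes> t) \<odot>\<^bsub>M\<^esub> x = (u \<otimes> s) \<odot>\<^bsub>M\<^esub> y\<rbrakk>
    \<Longrightarrow> ((x, s), (y, t)) \<in> loc_rel R S M"
  unfolding loc_rel_def by (auto simp: smult_assoc1)

lemma loc_relE:
  assumes "((x, s), (y, t)) \<in> loc_rel R S M"
  obtains u where "x \<in> carrier M" "y \<in> carrier M" "s \<in> S" "t \<in> S" "u \<in> S"
    "(u \<otimes> t) \<odot>\<^bsub>M\<^esub> x = (u \<otimes> s) \<odot>\<^bsub>M\<^esub> y"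
  using assms unfolding loc_rel_def by (auto simp: smult_assoc1)

lemma loc_rel_equiv: "equiv (carrier M \<times> S) (loc_rel R S M)"
proof (rule equivI)
  show "loc_rel R S M \<subseteq> (carrier M \<times> S) \<times> (carrier M \<times> S)"
    by (auto simp: loc_rel_def)
  show "refl_on (carrier M \<times> S) (loc_rel R S M)"
    by (rule refl_onI) (auto simp: loc_rel_def)
  show "sym (loc_rel R S M)"
    by (rule symI) (auto simp: loc_rel_def intro: sym)
  show "trans (loc_rel R S M)"
  proof (rule transI, clarify)
    fix x s y t z r
    assume "((x, s), (y, t)) \<in> loc_rel R S M" "((y, t), (z, r)) \<in> loc_rel R S M"
    then obtain u w where h: "x \<in> carrier M" "y \<in> carrier M" "z \<in> carrier M" "s \<in> S" "t \<in> S" "r \<in> S"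
      "u \<in> S" "w \<in> S" "(u \<otimes> t) \<odot>\<^bsub>M\<^esub> x = (u \<otimes> s) \<odot>\<^bsub>M\<^esub> y" "(w \<otimes> r) \<odot>\<^bsub>M\<^esub> y = (w \<otimes> t) \<odot>\<^bsub>M\<^esub> z"
      by (elim loc_relE) blast
    have "((u \<otimes> w \<otimes> t) \<otimes> r) \<odot>\<^bsub>M\<^esub> x = (w \<otimes> r) \<odot>\<^bsub>M\<^esub> ((u \<otimes> t) \<odot>\<^bsub>M\<^esub> x)"
      using h(1-8) by (simp flip: smult_assoc1 add: m_ac)
    also have "\<dots> = (u \<otimes> s) \<odot>\<^bsub>M\<^esub> ((w \<otimes> r) \<odot>\<^bsub>M\<^esub> y)"
      unfolding h(9) using h(1-8) by (simp flip: smult_assoc1 add: m_ac)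
    also have "\<dots> = ((u \<otimes> w \<otimes> t) \<otimes> s) \<odot>\<^bsub>M\<^esub> z"
      unfolding h(10) using h(1-8) by (simp flip: smult_assoc1 add: m_ac)
    finally show "((x, s), (z, r)) \<in> loc_rel R S M"
      using h(1-8) by (intro loc_relI[of _ _ _ _ "u \<otimes> w \<otimes> t"]) (auto simp: S_mult)
  qed
qed

lemma loc_frac_eqI:
  assumes "((x, s), (y, t)) \<in> loc_rel R S M"
  shows "loc_frac R S M x s = loc_frac R S M y t"
  unfolding loc_frac_def by (rule equiv_class_eq[OF loc_rel_equiv assms])

lemma loc_frac_eq_iff:
  assumes "x \<in> carrier M" "y \<in> carrier M" "s \<in> S" "t \<in> S"
  shows "loc_frac R S M x s = loc_frac R S M y t \<longleftrightarrow>
    (\<exists>u\<in>S. u \<odot>\<^bsub>M\<^esub> (t \<odot>\<^bsub>M\<^esub> x) = u \<odot>\<^bsub>M\<^esub> (s \<odot>\<^bsub>M\<^esub> y))"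
  using eq_equiv_class_iff[OF loc_rel_equiv, of "(x, s)" "(y, t)"] assms
  by (simp add: loc_frac_def loc_rel_def)

lemma loc_frac_cancel:
  assumes "x \<in> carrier M" "u \<in> S" "s \<in> S"
  shows "loc_frac R S M (u \<odot>\<^bsub>M\<^esub> x) (u \<otimes> s) = loc_frac R S M x s"
  by (rule loc_frac_eqI, rule loc_relI[of _ _ _ _ \<one>])
    (use assms in \<open>auto simp: S_mult one_mem_S m_ac simp flip: smult_assoc1\<close>)

lemma loc_carrier: "carrier (loc_module R S M) = {loc_frac R S M x s | x s. x \<in> carrier M \<and> s \<in> S}"
  by (auto simp: loc_module_def Let_def loc_frac_def quotient_def)

lemma loc_frac_mem: "x \<in> carrier M \<Longrightarrow> s \<in> S \<Longrightarrow>
    \<exists>y t. loc_frac R S M x s = loc_frac R S M y t \<and> y \<in> carrier M \<and> t \<in> S"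
  by blast

lemma loc_frac_carrier [simp]: "x \<in> carrier M \<Longrightarrow> s \<in> S \<Longrightarrow> loc_frac R S M x s \<in> carrier (loc_module R S M)"
  by (auto simp: loc_carrier)

lemma UN_loc_frac:
  assumes "x \<in> carrier M" "s \<in> S"
    and "\<And>x' s'. ((x, s), (x', s')) \<in> loc_rel R S M \<Longrightarrow> f x' s' = f x s"
  shows "(\<Union>(x', s')\<in>loc_frac R S M x s. f x' s') = f x s"
proof -
  have "(x, s) \<in> loc_frac R S M x s"
    using assms(1,2) equiv_class_self[OF loc_rel_equiv] by (auto simp: loc_frac_def)
  then have "loc_frac R S M x s \<noteq> {}" by blast
  then show ?thesis
    by (rule SUP_eq_const) (use assms(3) in \<open>auto simp: loc_frac_def\<close>)
qed

lemma loc_add_frac: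
  assumes "x \<in> carrier M" "s \<in> S" "y \<in> carrier M" "t \<in> S"
  shows "loc_frac R S M x s \<oplus>\<^bsub>loc_module R S M\<^esub> loc_frac R S M y t =
    loc_frac R S M (t \<odot>\<^bsub>M\<^esub> x \<oplus>\<^bsub>M\<^esub> s \<odot>\<^bsub>M\<^esub> y) (s \<otimes> t)"
proof -
  have *: "loc_frac R S M (t' \<odot>\<^bsub>M\<^esub> x' \<oplus>\<^bsub>M\<^esub> s' \<odot>\<^bsub>M\<^esub> y') (s' \<otimes> t') =
    loc_frac R S M (t \<odot>\<^bsub>M\<^esub> x \<oplus>\<^bsub>M\<^esub> s \<odot>\<^bsub>M\<^esub> y) (s \<otimes> t)"
    if rel: "((x, s), (x', s')) \<in> loc_rel R S M" "((y, t), (y', t')) \<in> loc_rel R S M"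
    for x s x' s' y t y' t'
  proof -
    obtain u w where h: "x \<in> carrier M" "x' \<in> carrier M" "y \<in> carrier M" "y' \<in> carrier M"
      "s \<in> S" "s' \<in> S" "t \<in> S" "t' \<in> S" "u \<in> S" "w \<in> S"
      "(u \<otimes> s') \<odot>\<^bsub>M\<^esub> x = (u \<otimes> s) \<odot>\<^bsub>M\<^esub> x'" "(w \<otimes> t') \<odot>\<^bsub>M\<^esub> y = (w \<otimes> t) \<odot>\<^bsub>M\<^esub> y'"
      using rel by (elim loc_relE) blast
    note c = h(1-10)
    have 1: "((u \<otimes> w) \<otimes> (s \<otimes> t)) \<odot>\<^bsub>M\<^esub> (t' \<odot>\<^bsub>M\<^esub> x') = ((u \<otimes> w) \<otimes> (s' \<otimes> t')) \<odot>\<^bsub>M\<^esub> (t \<odot>\<^bsub>M\<^esub> x)"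
    proof -
      have "((u \<otimes> w) \<otimes> (s \<otimes> t)) \<odot>\<^bsub>M\<^esub> (t' \<odot>\<^bsub>M\<^esub> x') = (w \<otimes> t \<otimes> t') \<odot>\<^bsub>M\<^esub> ((u \<otimes> s) \<odot>\<^bsub>M\<^esub> x')"
        using c by (simp flip: smult_assoc1 add: m_ac)
      then show ?thesis unfolding h(11)[symmetric] using c by (simp flip: smult_assoc1 add: m_ac)
    qed
    have 2: "((u \<otimes> w) \<otimes> (s \<otimes> t)) \<odot>\<^bsub>M\<^esub> (s' \<odot>\<^bsub>M\<^esub> y') = ((u \<otimes> w) \<otimes> (s' \<otimes> t')) \<odot>\<^bsub>M\<^esub> (s \<odot>\<^bsub>M\<^esub> y)"
    proof -
      have "((u \<otimes> w) \<otimes> (s \<otimes> t)) \<odot>\<^bsub>M\<^esub> (s' \<odot>\<^bsub>M\<^esub> y') = (u \<otimes> s \<otimes> s') \<odot>\<^bsub>M\<^esub> ((w \<otimes> t) \<odot>\<^bsub>M\<^esub> y')"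
        using c by (simp flip: smult_assoc1 add: m_ac)
      then show ?thesis unfolding h(12)[symmetric] using c by (simp flip: smult_assoc1 add: m_ac)
    qed
    show ?thesis
      by (rule loc_frac_eqI, rule loc_relI[of _ _ _ _ "u \<otimes> w"])
        (use c 1 2 in \<open>auto simp: S_mult smult_r_distr\<close>)
  qed
  have rf: "((x, s), (x, s)) \<in> loc_rel R S M" "((y, t), (y, t)) \<in> loc_rel R S M"
    using assms by (auto simp: loc_rel_def)
  have "(\<Union>(x', s')\<in>loc_frac R S M x s. \<Union>(y', t')\<in>loc_frac R S M y t.
      loc_frac R S M (t' \<odot>\<^bsub>M\<^esub> x' \<oplus>\<^bsub>M\<^esub> s' \<odot>\<^bsub>M\<^esub> y') (s' \<otimes> t')) =
    (\<Union>(x', s')\<in>loc_frac R S M x s. loc_frac R S M (t \<odot>\<^bsub>M\<^esub> x' \<oplus>\<^bsub>M\<^esub> s' \<odot>\<^bsub>M\<^esub> y) (s' \<otimes> t))"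
  proof (intro SUP_cong HOL.refl, clarify)
    fix x' s' assume "(x', s') \<in> loc_frac R S M x s"
    then have "((x', s'), (x', s')) \<in> loc_rel R S M"
      by (auto simp: loc_frac_def loc_rel_def)
    then show "(\<Union>(y', t')\<in>loc_frac R S M y t. loc_frac R S M (t' \<odot>\<^bsub>M\<^esub> x' \<oplus>\<^bsub>M\<^esub> s' \<odot>\<^bsub>M\<^esub> y') (s' \<otimes> t')) =
        loc_frac R S M (t \<odot>\<^bsub>M\<^esub> x' \<oplus>\<^bsub>M\<^esub> s' \<odot>\<^bsub>M\<^esub> y) (s' \<otimes> t)"
      using assms by (intro UN_loc_frac *)
  qed
  also have "\<dots> = loc_frac R S M (t \<odot>\<^bsub>M\<^esub> x \<oplus>\<^bsub>M\<^esub> s \<odot>\<^bsub>M\<^esub> y) (s \<otimes> t)"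
    by (rule UN_loc_frac) (use assms rf in \<open>auto intro!: *\<close>)
  finally show ?thesis by (simp add: loc_module_def Let_def)
qed


lemma loc_zero: "\<zero>\<^bsub>loc_module R S M\<^esub> = loc_frac R S M \<zero>\<^bsub>M\<^esub> \<one>"
  by (simp add: loc_module_def Let_def)

end

context mult_subset begin

lemma self_module_module: "module R (self_module R)"
proof (rule moduleI)
  show "abelian_group (self_module R)"
  proof (rule abelian_groupI)
    fix x assume "x \<in> carrier (self_module R)"
    then show "\<exists>y\<in>carrier (self_module R). y \<oplus>\<^bsub>self_module R\<^esub> x = \<zero>\<^bsub>self_module R\<^esub>"
      by (intro bexI[of _ "\<ominus> x"]) (auto simp: self_module_def l_neg)
  qed (auto simp: self_module_def a_ac)
qed (auto simp: self_module_def is_cring l_distr r_distr m_assoc)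

lemma self_setup: "loc_setup R S (self_module R)"
  using self_module_module by (simp add: loc_setup_def mult_subset_axioms)

abbreviation "rfrac a s \<equiv> loc_frac R S (self_module R) a s"

lemma self_simps: "carrier (self_module R) = carrier R" "add (self_module R) = add R"
  "smult (self_module R) = monoid.mult R" "ring.zero (self_module R) = ring.zero R"
  by (simp_all add: self_module_def)

lemma loc_ring_simps:
  "carrier (loc_ring R S) = carrier (loc_module R S (self_module R))"
  "add (loc_ring R S) = add (loc_module R S (self_module R))"
  "ring.zero (loc_ring R S) = ring.zero (loc_module R S (self_module R))"
  "monoid.mult (loc_ring R S) = smult (loc_module R S (self_module R))"
  "\<one>\<^bsub>loc_ring R S\<^esub> = rfrac \<one> \<one>"
  by (simp_all add: loc_ring_def loc_module_def Let_def self_module_def)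

lemma loc_ring_carrier: "carrier (loc_ring R S) = {rfrac a s | a s. a \<in> carrier R \<and> s \<in> S}"
  by (simp add: loc_ring_simps loc_setup.loc_carrier[OF self_setup] self_simps)

end

context loc_setup begin

lemma loc_smult_frac:
  assumes "a \<in> carrier R" "s \<in> S" "x \<in> carrier M" "t \<in> S"
  shows "rfrac a s \<odot>\<^bsub>loc_module R S M\<^esub> loc_frac R S M x t = loc_frac R S M (a \<odot>\<^bsub>M\<^esub> x) (s \<otimes> t)"
proof -
  have *: "loc_frac R S M (a' \<odot>\<^bsub>M\<^esub> x') (s' \<otimes> t') = loc_frac R S M (a \<odot>\<^bsub>M\<^esub> x) (s \<otimes> t)"
    if rel: "((a, s), (a', s')) \<in> loc_rel R S (self_module R)" "((x, t), (x', t')) \<in> loc_rel R S M"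
    for a s a' s' x t x' t'
  proof -
    obtain u w where h: "a \<in> carrier R" "a' \<in> carrier R" "x \<in> carrier M" "x' \<in> carrier M"
      "s \<in> S" "s' \<in> S" "t \<in> S" "t' \<in> S" "u \<in> S" "w \<in> S"
      "(u \<otimes> s') \<otimes> a = (u \<otimes> s) \<otimes> a'" "(w \<otimes> t') \<odot>\<^bsub>M\<^esub> x = (w \<otimes> t) \<odot>\<^bsub>M\<^esub> x'"
      using loc_setup.loc_relE[OF self_setup rel(1)] loc_relE[OF rel(2)] unfolding self_simps by metis
    note c = h(1-10)
    have "((u \<otimes> w) \<otimes> (s \<otimes> t)) \<odot>\<^bsub>M\<^esub> (a' \<odot>\<^bsub>M\<^esub> x') = ((u \<otimes> s) \<otimes> a') \<odot>\<^bsub>M\<^esub> ((w \<otimes> t) \<odot>\<^bsub>M\<^esub> x')"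
      using c by (simp flip: smult_assoc1 add: m_ac)
    also have "\<dots> = ((u \<otimes> w) \<otimes> (s' \<otimes> t')) \<odot>\<^bsub>M\<^esub> (a \<odot>\<^bsub>M\<^esub> x)"
      unfolding h(11,12)[symmetric] using c by (simp flip: smult_assoc1 add: m_ac)
    finally show ?thesis
      by (intro loc_frac_eqI loc_relI[of _ _ _ _ "u \<otimes> w"]) (use c in \<open>auto simp: S_mult\<close>)
  qed
  have refl: "((a, s), (a, s)) \<in> loc_rel R S (self_module R)" "((x, t), (x, t)) \<in> loc_rel R S M"
    using assms by (auto simp: loc_rel_def self_simps)
  have "(\<Union>(a', s')\<in>rfrac a s. \<Union>(x', t')\<in>loc_frac R S M x t. loc_frac R S M (a' \<odot>\<^bsub>M\<^esub> x') (s' \<otimes> t')) =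
    (\<Union>(a', s')\<in>rfrac a s. loc_frac R S M (a' \<odot>\<^bsub>M\<^esub> x) (s' \<otimes> t))"
  proof (intro SUP_cong HOL.refl, clarify)
    fix a' s' assume "(a', s') \<in> rfrac a s"
    then have "((a', s'), (a', s')) \<in> loc_rel R S (self_module R)"
      by (auto simp: loc_frac_def loc_rel_def self_simps)
    then show "(\<Union>(x', t')\<in>loc_frac R S M x t. loc_frac R S M (a' \<odot>\<^bsub>M\<^esub> x') (s' \<otimes> t')) =
        loc_frac R S M (a' \<odot>\<^bsub>M\<^esub> x) (s' \<otimes> t)"
      using assms by (intro UN_loc_frac *)
  qed
  also have "\<dots> = loc_frac R S M (a \<odot>\<^bsub>M\<^esub> x) (s \<otimes> t)"
    by (rule loc_setup.UN_loc_frac[OF self_setup]) (use assms refl in \<open>auto simp: self_simps intro!: *\<close>)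
  finally show ?thesis by (simp add: loc_module_def Let_def)
qed

lemma loc_abelian_group: "abelian_group (loc_module R S M)"
proof (rule abelian_groupI)
  fix A assume "A \<in> carrier (loc_module R S M)"
  then obtain x s where A: "A = loc_frac R S M x s" "x \<in> carrier M" "s \<in> S" by (auto simp: loc_carrier)
  have "s \<odot>\<^bsub>M\<^esub> (\<ominus>\<^bsub>M\<^esub> x) \<oplus>\<^bsub>M\<^esub> s \<odot>\<^bsub>M\<^esub> x = \<zero>\<^bsub>M\<^esub>"
    using A by (simp flip: smult_r_distr add: M.l_neg)
  then have "loc_frac R S M (\<ominus>\<^bsub>M\<^esub> x) s \<oplus>\<^bsub>loc_module R S M\<^esub> A = loc_frac R S M ((s \<otimes> s) \<odot>\<^bsub>M\<^esub> \<zero>\<^bsub>M\<^esub>) ((s \<otimes> s) \<otimes> \<one>)"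
    using A by (simp add: loc_add_frac)
  also have "\<dots> = \<zero>\<^bsub>loc_module R S M\<^esub>"
    unfolding loc_zero by (rule loc_frac_cancel) (use A in \<open>auto simp: S_mult one_mem_S\<close>)
  finally show "\<exists>B\<in>carrier (loc_module R S M). B \<oplus>\<^bsub>loc_module R S M\<^esub> A = \<zero>\<^bsub>loc_module R S M\<^esub>"
    using A by (intro bexI[of _ "loc_frac R S M (\<ominus>\<^bsub>M\<^esub> x) s"]) auto
qed (auto simp: loc_carrier loc_add_frac loc_zero S_mult one_mem_S smult_r_distr m_ac M.a_ac
    simp flip: smult_assoc1 intro!: loc_frac_mem)

end

context mult_subset begin

lemma loc_mult_frac:
  assumes "a \<in> carrier R" "s \<in> S" "b \<in> carrier R" "t \<in> S"
  shows "rfrac a s \<otimes>\<^bsub>loc_ring R S\<^esub> rfrac b t = rfrac (a \<otimes> b) (s \<otimes> t)"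
  using loc_setup.loc_smult_frac[OF self_setup] assms by (simp add: loc_ring_simps self_simps)

lemma loc_ring_add_frac:
  assumes "a \<in> carrier R" "s \<in> S" "b \<in> carrier R" "t \<in> S"
  shows "rfrac a s \<oplus>\<^bsub>loc_ring R S\<^esub> rfrac b t = rfrac (t \<otimes> a \<oplus> s \<otimes> b) (s \<otimes> t)"
  using loc_setup.loc_add_frac[OF self_setup] assms by (simp add: loc_ring_simps self_simps)

lemma rfrac_mem: "a \<in> carrier R \<Longrightarrow> s \<in> S \<Longrightarrow> \<exists>b t. rfrac a s = rfrac b t \<and> b \<in> carrier R \<and> t \<in> S"
  by blast

lemma rfrac_cancel:
  assumes "a \<in> carrier R" "u \<in> S" "s \<in> S"
  shows "rfrac (u \<otimes> a) (u \<otimes> s) = rfrac a s"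
  using loc_setup.loc_frac_cancel[OF self_setup] assms by (simp add: self_simps)

theorem loc_ring_cring: "cring (loc_ring R S)"
proof (rule cringI)
  interpret A: abelian_group "loc_module R S (self_module R)"
    by (rule loc_setup.loc_abelian_group[OF self_setup])
  show "abelian_group (loc_ring R S)"
    by (rule abelian_groupI) (auto simp: loc_ring_simps A.a_ac intro: A.a_inv_closed A.l_neg)
  show "comm_monoid (loc_ring R S)"
    by (rule comm_monoidI)
      (auto simp: loc_ring_carrier loc_ring_simps(5) loc_mult_frac S_mult one_mem_S m_ac intro!: rfrac_mem)
  fix A B C assume "A \<in> carrier (loc_ring R S)" "B \<in> carrier (loc_ring R S)" "C \<in> carrier (loc_ring R S)"
  then obtain a s b t c r where h: "A = rfrac a s" "B = rfrac b t" "C = rfrac c r"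
    "a \<in> carrier R" "b \<in> carrier R" "c \<in> carrier R" "s \<in> S" "t \<in> S" "r \<in> S"
    unfolding loc_ring_carrier by blast
  have "(A \<oplus>\<^bsub>loc_ring R S\<^esub> B) \<otimes>\<^bsub>loc_ring R S\<^esub> C = rfrac ((t \<otimes> a \<oplus> s \<otimes> b) \<otimes> c) ((s \<otimes> t) \<otimes> r)"
    using h by (simp add: loc_ring_add_frac loc_mult_frac S_mult)
  also have "\<dots> = rfrac (r \<otimes> ((t \<otimes> a \<oplus> s \<otimes> b) \<otimes> c)) (r \<otimes> ((s \<otimes> t) \<otimes> r))"
    using h by (intro rfrac_cancel[symmetric]) (auto simp: S_mult)
  also have "r \<otimes> ((t \<otimes> a \<oplus> s \<otimes> b) \<otimes> c) = (t \<otimes> r) \<otimes> (a \<otimes> c) \<oplus> (s \<otimes> r) \<otimes> (b \<otimes> c)"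
    using h(4-) by (simp add: l_distr r_distr m_ac)
  also have "r \<otimes> ((s \<otimes> t) \<otimes> r) = (s \<otimes> r) \<otimes> (t \<otimes> r)"
    using h(4-) by (simp add: m_ac)
  also have "rfrac ((t \<otimes> r) \<otimes> (a \<otimes> c) \<oplus> (s \<otimes> r) \<otimes> (b \<otimes> c)) ((s \<otimes> r) \<otimes> (t \<otimes> r)) =
      A \<otimes>\<^bsub>loc_ring R S\<^esub> C \<oplus>\<^bsub>loc_ring R S\<^esub> B \<otimes>\<^bsub>loc_ring R S\<^esub> C"
    using h by (simp add: loc_ring_add_frac loc_mult_frac S_mult)
  finally show "(A \<oplus>\<^bsub>loc_ring R S\<^esub> B) \<otimes>\<^bsub>loc_ring R S\<^esub> C =
      A \<otimes>\<^bsub>loc_ring R S\<^esub> C \<oplus>\<^bsub>loc_ring R S\<^esub> B \<otimes>\<^bsub>loc_ring R S\<^esub> C" .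
qed

end

context loc_setup begin

theorem loc_module_module: "module (loc_ring R S) (loc_module R S M)"
proof (rule moduleI)
  show "cring (loc_ring R S)" by (rule loc_ring_cring)
  show "abelian_group (loc_module R S M)" by (rule loc_abelian_group)
next
  fix A B Z assume "A \<in> carrier (loc_ring R S)" "B \<in> carrier (loc_ring R S)" "Z \<in> carrier (loc_module R S M)"
  then obtain a s b t x r where h: "A = rfrac a s" "B = rfrac b t" "Z = loc_frac R S M x r"
    "a \<in> carrier R" "b \<in> carrier R" "x \<in> carrier M" "s \<in> S" "t \<in> S" "r \<in> S"
    unfolding loc_ring_carrier loc_carrier by blast
  have "(A \<oplus>\<^bsub>loc_ring R S\<^esub> B) \<odot>\<^bsub>loc_module R S M\<^esub> Z = loc_frac R S M ((t \<otimes> a \<oplus> s \<otimes> b) \<odot>\<^bsub>M\<^esub> x) ((s \<otimes> t) \<otimes> r)"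
    using h by (simp add: loc_ring_add_frac loc_smult_frac S_mult)
  also have "\<dots> = loc_frac R S M (r \<odot>\<^bsub>M\<^esub> ((t \<otimes> a \<oplus> s \<otimes> b) \<odot>\<^bsub>M\<^esub> x)) (r \<otimes> ((s \<otimes> t) \<otimes> r))"
    using h by (intro loc_frac_cancel[symmetric]) (auto simp: S_mult)
  also have "r \<odot>\<^bsub>M\<^esub> ((t \<otimes> a \<oplus> s \<otimes> b) \<odot>\<^bsub>M\<^esub> x) = (t \<otimes> r) \<odot>\<^bsub>M\<^esub> (a \<odot>\<^bsub>M\<^esub> x) \<oplus>\<^bsub>M\<^esub> (s \<otimes> r) \<odot>\<^bsub>M\<^esub> (b \<odot>\<^bsub>M\<^esub> x)"
    using h(4-) by (simp add: smult_l_distr smult_r_distr m_ac flip: smult_assoc1)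
  also have "r \<otimes> ((s \<otimes> t) \<otimes> r) = (s \<otimes> r) \<otimes> (t \<otimes> r)"
    using h(4-) by (simp add: m_ac)
  finally show "(A \<oplus>\<^bsub>loc_ring R S\<^esub> B) \<odot>\<^bsub>loc_module R S M\<^esub> Z =
      A \<odot>\<^bsub>loc_module R S M\<^esub> Z \<oplus>\<^bsub>loc_module R S M\<^esub> B \<odot>\<^bsub>loc_module R S M\<^esub> Z"
    using h by (simp add: loc_add_frac loc_smult_frac S_mult)
next
  fix A Z W assume "A \<in> carrier (loc_ring R S)" "Z \<in> carrier (loc_module R S M)" "W \<in> carrier (loc_module R S M)"
  then obtain a s y t x r where h: "A = rfrac a s" "W = loc_frac R S M y t" "Z = loc_frac R S M x r"
    "a \<in> carrier R" "y \<in> carrier M" "x \<in> carrier M" "s \<in> S" "t \<in> S" "r \<in> S"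
    unfolding loc_ring_carrier loc_carrier by blast
  have "A \<odot>\<^bsub>loc_module R S M\<^esub> (Z \<oplus>\<^bsub>loc_module R S M\<^esub> W) = loc_frac R S M (a \<odot>\<^bsub>M\<^esub> (t \<odot>\<^bsub>M\<^esub> x \<oplus>\<^bsub>M\<^esub> r \<odot>\<^bsub>M\<^esub> y)) (s \<otimes> (r \<otimes> t))"
    using h by (simp add: loc_add_frac loc_smult_frac S_mult)
  also have "\<dots> = loc_frac R S M (s \<odot>\<^bsub>M\<^esub> (a \<odot>\<^bsub>M\<^esub> (t \<odot>\<^bsub>M\<^esub> x \<oplus>\<^bsub>M\<^esub> r \<odot>\<^bsub>M\<^esub> y))) (s \<otimes> (s \<otimes> (r \<otimes> t)))"
    using h by (intro loc_frac_cancel[symmetric]) (auto simp: S_mult)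
  also have "s \<odot>\<^bsub>M\<^esub> (a \<odot>\<^bsub>M\<^esub> (t \<odot>\<^bsub>M\<^esub> x \<oplus>\<^bsub>M\<^esub> r \<odot>\<^bsub>M\<^esub> y)) = (s \<otimes> t) \<odot>\<^bsub>M\<^esub> (a \<odot>\<^bsub>M\<^esub> x) \<oplus>\<^bsub>M\<^esub> (s \<otimes> r) \<odot>\<^bsub>M\<^esub> (a \<odot>\<^bsub>M\<^esub> y)"
    using h(4-) by (simp add: smult_r_distr m_ac flip: smult_assoc1)
  also have "s \<otimes> (s \<otimes> (r \<otimes> t)) = (s \<otimes> r) \<otimes> (s \<otimes> t)"
    using h(4-) by (simp add: m_ac)
  finally show "A \<odot>\<^bsub>loc_module R S M\<^esub> (Z \<oplus>\<^bsub>loc_module R S M\<^esub> W) =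
      A \<odot>\<^bsub>loc_module R S M\<^esub> Z \<oplus>\<^bsub>loc_module R S M\<^esub> A \<odot>\<^bsub>loc_module R S M\<^esub> W"
    using h by (simp add: loc_add_frac loc_smult_frac S_mult)
qed (auto simp: loc_ring_carrier loc_carrier loc_smult_frac loc_mult_frac loc_ring_simps(5)
    S_mult one_mem_S m_assoc smult_assoc1 intro!: loc_frac_mem)

theorem loc_map_frac:
  assumes N: "module R N" and f: "f \<in> mod_hom R M N" and x: "x \<in> carrier M" and s: "s \<in> S"
  shows "loc_map R S N f (loc_frac R S M x s) = loc_frac R S N (f x) s"
proof -
  interpret N: loc_setup R S N
    using N by (simp add: loc_setup_def mult_subset_axioms)
  have "loc_frac R S N (f x') s' = loc_frac R S N (f x) s" if rel: "((x, s), (x', s')) \<in> loc_rel R S M" for x' s'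
  proof -
    obtain u where h: "x \<in> carrier M" "x' \<in> carrier M" "s \<in> S" "s' \<in> S" "u \<in> S"
      "(u \<otimes> s') \<odot>\<^bsub>M\<^esub> x = (u \<otimes> s) \<odot>\<^bsub>M\<^esub> x'"
      using rel by (elim loc_relE) blast
    have "f ((u \<otimes> s) \<odot>\<^bsub>M\<^esub> x') = f ((u \<otimes> s') \<odot>\<^bsub>M\<^esub> x)" by (simp add: h(6))
    then have "(u \<otimes> s) \<odot>\<^bsub>N\<^esub> f x' = (u \<otimes> s') \<odot>\<^bsub>N\<^esub> f x"
      using h(1-5) f by (simp add: mod_hom_def)
    then show ?thesis
      using h(1-5) f by (intro N.loc_frac_eqI N.loc_relI[of _ _ _ _ u]) (auto simp: mod_hom_def)
  qed
  then show ?thesis unfolding loc_map_def by (rule UN_loc_frac[OF x s])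
qed

theorem loc_map_hom:
  assumes N: "module R N" and f: "f \<in> mod_hom R M N"
  shows "loc_map R S N f \<in> mod_hom (loc_ring R S) (loc_module R S M) (loc_module R S N)"
proof -
  interpret N: loc_setup R S N
    using N by (simp add: loc_setup_def mult_subset_axioms)
  have f': "\<And>x. x \<in> carrier M \<Longrightarrow> f x \<in> carrier N"
     "\<And>x y. x \<in> carrier M \<Longrightarrow> y \<in> carrier M \<Longrightarrow> f (x \<oplus>\<^bsub>M\<^esub> y) = f x \<oplus>\<^bsub>N\<^esub> f y"
     "\<And>a x. a \<in> carrier R \<Longrightarrow> x \<in> carrier M \<Longrightarrow> f (a \<odot>\<^bsub>M\<^esub> x) = a \<odot>\<^bsub>N\<^esub> f x"
    using f by (auto simp: mod_hom_def)
  show ?thesis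
    unfolding mod_hom_def
    by (auto simp: loc_carrier loc_ring_carrier N.loc_carrier loc_map_frac[OF N f] loc_add_frac loc_smult_frac
        N.loc_add_frac N.loc_smult_frac f' S_mult intro!: N.loc_frac_mem)
qed

end

section \<open>The spectrum and the pure locus\<close>

definition Spec :: "('a, 'c) ring_scheme \<Rightarrow> 'a set set" where
  "Spec R = {p. primeideal p R}"

definition zariski :: "('a, 'c) ring_scheme \<Rightarrow> 'a set topology" where
  "zariski R = topology (\<lambda>U. \<exists>E\<subseteq>carrier R. U = {p \<in> Spec R. \<not> E \<subseteq> p})"

lemma zariski_istopology:
  assumes "cring R"
  shows "istopology (\<lambda>U. \<exists>E\<subseteq>carrier R. U = {p \<in> Spec R. \<not> E \<subseteq> p})"
  unfolding istopology_def
proof (intro conjI allI impI)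
  interpret cring R by fact
  fix U V assume "\<exists>E\<subseteq>carrier R. U = {p \<in> Spec R. \<not> E \<subseteq> p}" "\<exists>E\<subseteq>carrier R. V = {p \<in> Spec R. \<not> E \<subseteq> p}"
  then obtain E F where EF: "E \<subseteq> carrier R" "F \<subseteq> carrier R" "U = {p \<in> Spec R. \<not> E \<subseteq> p}" "V = {p \<in> Spec R. \<not> F \<subseteq> p}"
    by blast
  let ?G = "{a \<otimes>\<^bsub>R\<^esub> b | a b. a \<in> E \<and> b \<in> F}"
  have "\<not> ?G \<subseteq> p \<longleftrightarrow> \<not> E \<subseteq> p \<and> \<not> F \<subseteq> p" if "p \<in> Spec R" for p
  proof -
    interpret primeideal p R using that by (simp add: Spec_def)
    show ?thesis
    proof
      assume "\<not> ?G \<subseteq> p"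
      then obtain a b where "a \<in> E" "b \<in> F" "a \<otimes>\<^bsub>R\<^esub> b \<notin> p" by blast
      then show "\<not> E \<subseteq> p \<and> \<not> F \<subseteq> p"
        using EF(1,2) I_l_closed[of b a] I_r_closed[of a b] by blast
    next
      assume "\<not> E \<subseteq> p \<and> \<not> F \<subseteq> p"
      then obtain a b where "a \<in> E" "a \<notin> p" "b \<in> F" "b \<notin> p" by blast
      moreover from this have "a \<otimes>\<^bsub>R\<^esub> b \<notin> p" using EF(1,2) I_prime[of a b] by blast
      ultimately show "\<not> ?G \<subseteq> p" by blast
    qed
  qed
  then have "U \<inter> V = {p \<in> Spec R. \<not> ?G \<subseteq> p}" unfolding EF(3,4) by blast
  moreover have "?G \<subseteq> carrier R" using EF(1,2) by auto
  ultimately show "\<exists>E\<subseteq>carrier R. U \<inter> V = {p \<in> Spec R. \<not> E \<subseteq> p}" by blast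
next
  fix K assume "\<forall>U\<in>K. \<exists>E\<subseteq>carrier R. U = {p \<in> Spec R. \<not> E \<subseteq> p}"
  then obtain E where E: "\<And>U. U \<in> K \<Longrightarrow> E U \<subseteq> carrier R" "\<And>U. U \<in> K \<Longrightarrow> U = {p \<in> Spec R. \<not> E U \<subseteq> p}"
    by metis
  have "\<Union>K = {p \<in> Spec R. \<not> \<Union>(E ` K) \<subseteq> p}" using E(2) by blast
  moreover have "\<Union>(E ` K) \<subseteq> carrier R" using E(1) by blast
  ultimately show "\<exists>E\<subseteq>carrier R. \<Union>K = {p \<in> Spec R. \<not> E \<subseteq> p}" by blast
qed

lemma openin_zariski:
  assumes "cring R"
  shows "openin (zariski R) U \<longleftrightarrow> (\<exists>E\<subseteq>carrier R. U = {p \<in> Spec R. \<not> E \<subseteq> p})"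
  unfolding zariski_def topology_inverse'[OF zariski_istopology[OF assms]] ..

lemma topspace_zariski:
  assumes "cring R"
  shows "topspace (zariski R) = Spec R"
proof -
  have "openin (zariski R) (Spec R)"
    unfolding openin_zariski[OF assms]
  proof (intro exI conjI)
    show "Spec R = {p \<in> Spec R. \<not> carrier R \<subseteq> p}"
      using primeideal.I_notcarr ideal.Icarr primeideal.axioms(1) unfolding Spec_def by fast
  qed simp
  then show ?thesis
    unfolding topspace_def openin_zariski[OF assms] by blast
qed

definition pure_locus ::
    "('a, 'c) ring_scheme \<Rightarrow> ('a, 'p, 'x) module_scheme \<Rightarrow> ('a, 'm, 'y) module_scheme \<Rightarrow> ('p \<Rightarrow> 'm) \<Rightarrow> 'a set set" where
  "pure_locus R P M v = {p \<in> Spec R.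
     pure_map (loc_ring R (carrier R - p))
       (loc_module R (carrier R - p) P) (loc_module R (carrier R - p) M)
       (loc_map R (carrier R - p) M v)}"

end

theory Submission
  imports Defs
begin

text \<open>
  By the Mittag-Leffler property there is a linear map \<open>f\<close> from \<open>P\<close> to a finitely presented module
  \<open>Q\<close> such that \<open>f \<otimes> N\<close> and \<open>v \<otimes> N\<close> have the same kernel for every \<open>R\<close>-module \<open>N\<close>.  Purity of
  \<open>v\<^sub>p\<close> is a statement about these kernels for the modules \<open>N\<close> over \<open>R\<^sub>p\<close>, because
  \<open>P\<^sub>p \<otimes> N\<close> over \<open>R\<^sub>p\<close> is \<open>P \<otimes> N\<close> over \<open>R\<close> (\<open>loc_map_tensor_inj_iff\<close>).  So \<open>v\<^sub>p\<close> is pure if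
  and only if \<open>f\<^sub>p\<close> is, and \<open>f\<close> is a map between finitely presented modules.  Such a map is pure
  exactly when it splits; with denominators cleared, \<open>f\<^sub>p\<close> is pure if and only if some \<open>s \<notin> p\<close> and
  some linear \<open>r\<close> from \<open>Q\<close> to \<open>P\<close> satisfy \<open>r \<circ> f = s \<cdot> id\<close> (\<open>split_imp_pure\<close>, \<open>pure_imp_split\<close>).
  The set \<open>E\<close> of all \<open>s \<in> R\<close> for which such an \<open>r\<close> exists is independent of \<open>p\<close>, and the pure locus
  is the open set of all primes that do not contain \<open>E\<close>.

  The substance lies in constructing \<open>r\<close> from purity.  Present \<open>Q\<close> as a quotient
  \<open>\<phi> : F \<rightarrow> Q\<close> of \<open>F = R\<^sup>n\<close>.  To give \<open>r\<close> is to give a linear map \<open>\<psi> : F \<rightarrow> P\<close> that vanishes on the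
  finitely many relations of \<open>Q\<close> and takes prescribed values on lifts of the elements \<open>f p\<^sub>k\<close>, where
  the \<open>p\<^sub>k\<close> generate \<open>P\<close>.  Both kinds of conditions have the form \<open>\<psi> a\<^sub>i = s x\<^sub>i\<close> with
  \<open>\<phi> a\<^sub>i = f x\<^sub>i\<close>, \<open>i\<close> in a finite set \<open>I\<close>.  The test module that detects solvability is the
  localization of the cokernel \<open>T\<close> of the evaluation map from \<open>Hom F R\<close> to \<open>R\<^sup>I\<close>.  Let \<open>e\<^sub>i\<close> be the
  classes of the unit vectors.  The element \<open>\<Sum> x\<^sub>i \<otimes> e\<^sub>i\<close> of \<open>P \<otimes> T\<close> is mapped by \<open>f\<close> to
  \<open>\<Sum> \<phi> a\<^sub>i \<otimes> e\<^sub>i\<close>, which vanishes (\<open>relation_null\<close>).  Purity makes its image in \<open>P \<otimes> T\<^sub>p\<close> vanish.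
  Multiplying out, the family \<open>(x\<^sub>i)\<close> vanishes in the localized cokernel of the evaluation map from
  \<open>Hom F P\<close> to \<open>P\<^sup>I\<close>, and this says that \<open>\<psi>\<close> exists (\<open>null_solvable\<close>).
\<close>

section \<open>Elements of a tensor product\<close>

text \<open>
  The universal property of the tensor product on the level of formal sums, used to draw
  conclusions from the nullity of a formal sum.
\<close>

lemma tensor_null_lift:
  fixes M :: "('a, 'm, 'x) module_scheme" and N :: "('a, 'n, 'y) module_scheme"
  assumes M: "module R M" and N: "module R N" and G: "abelian_group G"
    and b: "\<And>x y. x \<in> carrier M \<Longrightarrow> y \<in> carrier N \<Longrightarrow> b x y \<in> carrier G"
    and add_left: "\<And>x x' y. x \<in> carrier M \<Longrightarrow> x' \<in> carrier M \<Longrightarrow> y \<in> carrier N \<Longrightarrow>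
      b (x \<oplus>\<^bsub>M\<^esub> x') y = b x y \<oplus>\<^bsub>G\<^esub> b x' y"
    and add_right: "\<And>x y y'. x \<in> carrier M \<Longrightarrow> y \<in> carrier N \<Longrightarrow> y' \<in> carrier N \<Longrightarrow>
      b x (y \<oplus>\<^bsub>N\<^esub> y') = b x y \<oplus>\<^bsub>G\<^esub> b x y'"
    and balanced: "\<And>a x y. a \<in> carrier R \<Longrightarrow> x \<in> carrier M \<Longrightarrow> y \<in> carrier N \<Longrightarrow>
      b (a \<odot>\<^bsub>M\<^esub> x) y = b x (a \<odot>\<^bsub>N\<^esub> y)"
  obtains h where
    "\<And>c d. Poly_Mapping.keys c \<subseteq> carrier M \<times> carrier N \<Longrightarrow> Poly_Mapping.keys d \<subseteq> carrier M \<times> carrier N \<Longrightarrow>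
      h (c + d) = h c \<oplus>\<^bsub>G\<^esub> h d"
    "\<And>x y. x \<in> carrier M \<Longrightarrow> y \<in> carrier N \<Longrightarrow> h (frag_of (x, y)) = b x y"
    "\<And>c. c \<in> tensor_null R M N \<Longrightarrow> h c = \<zero>\<^bsub>G\<^esub>"
proof -
  interpret M: module R M by fact
  interpret N: module R N by fact
  interpret G: abelian_group G by fact
  have "comm_group (add_monoid G)" by (rule G.a_comm_group)
  moreover have "(\<lambda>(x, y). b x y) ` (carrier M \<times> carrier N) \<subseteq> carrier (add_monoid G)"
    using b by auto
  ultimately obtain h where h: "h \<in> hom (free_pairs M N) (add_monoid G)"
    "\<And>z. z \<in> carrier M \<times> carrier N \<Longrightarrow> h (frag_of z) = (\<lambda>(x, y). b x y) z"
    by (rule comm_group.free_Abelian_group_universal) blast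
  interpret h: group_hom "free_pairs M N" "add_monoid G" h
    using h(1) G.a_group by (simp add: group_hom_def group_hom_axioms_def)
  have closed: "h c \<in> carrier G" if "Poly_Mapping.keys c \<subseteq> carrier M \<times> carrier N" for c
    using h.hom_closed[of c] that by simp
  have add: "h (c + d) = h c \<oplus>\<^bsub>G\<^esub> h d"
    if "Poly_Mapping.keys c \<subseteq> carrier M \<times> carrier N" "Poly_Mapping.keys d \<subseteq> carrier M \<times> carrier N" for c d
    using h.hom_mult[of c d] that by simp
  have zero: "h 0 = \<zero>\<^bsub>G\<^esub>" using h.hom_one by simp
  have of: "h (frag_of (x, y)) = b x y" if "x \<in> carrier M" "y \<in> carrier N" for x y
    using h(2)[of "(x, y)"] that by simp
  (* A relation is a difference c = d - e; it is killed once h d = h e. *)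
  have vanish: "h c = \<zero>\<^bsub>G\<^esub>" if "h d = h e" "d = c + e"
      "Poly_Mapping.keys c \<subseteq> carrier M \<times> carrier N" "Poly_Mapping.keys e \<subseteq> carrier M \<times> carrier N" for c d e
    using that add[of c e] closed[of c] closed[of e] by simp
  have null: "h c = \<zero>\<^bsub>G\<^esub>" if "c \<in> tensor_null R M N" for c
    using M N that
  proof (induction rule: tensor_null_induct)
    case zero
    show ?case by (rule \<open>h 0 = \<zero>\<^bsub>G\<^esub>\<close>)
  next
    case (rel c)
    note keys = tensor_rels_keys[OF M N rel]
    show ?case
      using rel[unfolded tensor_rels_def]
    proof (elim UnE CollectE exE conjE, goal_cases)
      case (1 x x' y)
      then show ?thesis
        using keys by (intro vanish[of "frag_of (x \<oplus>\<^bsub>M\<^esub> x', y)" "frag_of (x, y) + frag_of (x', y)"])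
          (auto simp: add of add_left dest!: subsetD[OF Poly_Mapping.keys_add])
    next
      case (2 x y y')
      then show ?thesis
        using keys by (intro vanish[of "frag_of (x, y \<oplus>\<^bsub>N\<^esub> y')" "frag_of (x, y) + frag_of (x, y')"])
          (auto simp: add of add_right dest!: subsetD[OF Poly_Mapping.keys_add])
    next
      case (3 a x y)
      then show ?thesis
        using keys by (intro vanish[of "frag_of (a \<odot>\<^bsub>M\<^esub> x, y)" "frag_of (x, a \<odot>\<^bsub>N\<^esub> y)"])
          (auto simp: of balanced)
    qed
  next
    case (minus c)
    then show ?case
      using add[of c "- c"] closed[of "- c"] zero tensor_null_keys[OF M N minus(1)] by simp
  next
    case (add c d)
    then show ?case
      using \<open>\<And>c d. _ \<Longrightarrow> _ \<Longrightarrow> h (c + d) = _\<close> tensor_null_keys[OF M N] by simp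
  qed
  show thesis by (rule that[of h]) (use add of null in auto)
qed

lemma tensor_null_balance:
  assumes "module R M" "module R N" "a \<in> carrier R"
    and "Poly_Mapping.keys c \<subseteq> carrier M \<times> carrier N"
  shows "pair_push (\<lambda>x. a \<odot>\<^bsub>M\<^esub> x) (\<lambda>y. y) c - pair_push (\<lambda>x. x) (\<lambda>y. a \<odot>\<^bsub>N\<^esub> y) c \<in> tensor_null R M N"
  using assms(4)
proof (induction c rule: pairs_induct)
  case (of x y)
  then show ?case using assms by (simp add: tensor_null_rel tensor_relsI)
next
  case (diff c d)
  then show ?case using tensor_null_diff[OF assms(1,2) diff] by (simp add: algebra_simps)
qed (simp add: tensor_null_zero)

lemma tensor_null_sum:
  "(\<And>i. i \<in> I \<Longrightarrow> c i \<in> tensor_null R M N) \<Longrightarrow> (\<Sum>i\<in>I. c i) \<in> tensor_null R M N"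
  by (induction I rule: infinite_finite_induct) (auto simp: tensor_null_zero tensor_null_add)

lemma tensor_null_zero_left:
  assumes "module R M" "module R N" "y \<in> carrier N"
  shows "frag_of (\<zero>\<^bsub>M\<^esub>, y) \<in> tensor_null R M N"
proof -
  interpret M: module R M by fact
  show ?thesis
    using tensor_null_minus[OF assms(1,2) tensor_null_rel[OF tensor_relsI(1)[of "\<zero>\<^bsub>M\<^esub>" M "\<zero>\<^bsub>M\<^esub>" y N R]]] assms(3)
    by simp
qed

lemma tensor_null_zero_right:
  assumes "module R M" "module R N" "x \<in> carrier M"
  shows "frag_of (x, \<zero>\<^bsub>N\<^esub>) \<in> tensor_null R M N"
proof -
  interpret N: module R N by fact
  show ?thesis
    using tensor_null_minus[OF assms(1,2) tensor_null_rel[OF tensor_relsI(2)[of x M "\<zero>\<^bsub>N\<^esub>" N "\<zero>\<^bsub>N\<^esub>" R]]] assms(3)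
    by simp
qed

lemma pair_push_sum: "pair_push f g (\<Sum>i\<in>I. c i) = (\<Sum>i\<in>I. pair_push f g (c i))"
  by (induction I rule: infinite_finite_induct) auto

section \<open>Linear maps, powers and quotients of modules\<close>

lemma mod_hom_zero:
  assumes "module R M" "module R N" "f \<in> mod_hom R M N"
  shows "f \<zero>\<^bsub>M\<^esub> = \<zero>\<^bsub>N\<^esub>"
proof -
  interpret M: module R M by fact
  interpret N: module R N by fact
  show ?thesis
    using mod_homD(3)[OF assms(3), of "\<zero>\<^bsub>R\<^esub>" "\<zero>\<^bsub>M\<^esub>"] mod_homD(1)[OF assms(3), of "\<zero>\<^bsub>M\<^esub>"] by simp
qed

lemma mod_hom_minus:
  assumes "module R M" "module R N" "f \<in> mod_hom R M N" "x \<in> carrier M"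
  shows "f (\<ominus>\<^bsub>M\<^esub> x) = \<ominus>\<^bsub>N\<^esub> f x"
proof -
  interpret M: module R M by fact
  interpret N: module R N by fact
  have "f (\<ominus>\<^bsub>M\<^esub> x) \<oplus>\<^bsub>N\<^esub> f x = \<zero>\<^bsub>N\<^esub>"
    using mod_homD(2)[OF assms(3), of "\<ominus>\<^bsub>M\<^esub> x" x] assms by (simp add: M.l_neg mod_hom_zero)
  then show ?thesis
    using N.minus_equality mod_homD(1)[OF assms(3)] assms(4) by (metis M.a_inv_closed)
qed

lemma equalizer_submodule:
  assumes "module R M" "module R N" "f \<in> mod_hom R M N" "g \<in> mod_hom R M N"
  shows "submodule {x \<in> carrier M. f x = g x} R M"
proof -
  interpret M: module R M by fact
  interpret N: module R N by fact
  show ?thesis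
    by (rule M.submoduleI)
      (auto simp: mod_homD[OF assms(3)] mod_homD[OF assms(4)]
        mod_hom_zero[OF assms(1-3)] mod_hom_zero[OF assms(1,2,4)]
        mod_hom_minus[OF assms(1-3)] mod_hom_minus[OF assms(1,2,4)])
qed

definition pow_module :: "'i set \<Rightarrow> ('a, 'm, 'x) module_scheme \<Rightarrow> ('a, 'i \<Rightarrow> 'm) module" where
  "pow_module I M = \<lparr>carrier = I \<rightarrow>\<^sub>E carrier M,
     monoid.mult = undefined, monoid.one = undefined,
     ring.zero = (\<lambda>i\<in>I. \<zero>\<^bsub>M\<^esub>),
     ring.add = (\<lambda>x y. \<lambda>i\<in>I. x i \<oplus>\<^bsub>M\<^esub> y i),
     smult = (\<lambda>a x. \<lambda>i\<in>I. a \<odot>\<^bsub>M\<^esub> x i)\<rparr>"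

lemma pow_module_simps:
  "carrier (pow_module I M) = I \<rightarrow>\<^sub>E carrier M"
  "\<zero>\<^bsub>pow_module I M\<^esub> = (\<lambda>i\<in>I. \<zero>\<^bsub>M\<^esub>)"
  "x \<oplus>\<^bsub>pow_module I M\<^esub> y = (\<lambda>i\<in>I. x i \<oplus>\<^bsub>M\<^esub> y i)"
  "a \<odot>\<^bsub>pow_module I M\<^esub> x = (\<lambda>i\<in>I. a \<odot>\<^bsub>M\<^esub> x i)"
  by (simp_all add: pow_module_def)

lemma pow_module_module:
  assumes "module R M"
  shows "module R (pow_module I M)"
proof -
  interpret M: module R M by fact
  show ?thesis
  proof (rule moduleI)
    show "abelian_group (pow_module I M)"
    proof (rule abelian_groupI)
      fix x assume "x \<in> carrier (pow_module I M)"
      then show "\<exists>y\<in>carrier (pow_module I M). y \<oplus>\<^bsub>pow_module I M\<^esub> x = \<zero>\<^bsub>pow_module I M\<^esub>"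
        by (intro bexI[of _ "\<lambda>i\<in>I. \<ominus>\<^bsub>M\<^esub> x i"])
          (auto simp: pow_module_def PiE_iff M.l_neg intro!: restrict_ext)
    qed (auto simp: pow_module_def PiE_iff M.a_ac fun_eq_iff restrict_def extensional_def)
  qed (auto simp: pow_module_def PiE_iff fun_eq_iff restrict_def extensional_def
      M.R.is_cring M.smult_l_distr M.smult_r_distr M.smult_assoc1)
qed

text \<open>
  The quotient by \<open>H\<close> is modelled on a system of representatives of the cosets of \<open>H\<close> instead of the
  cosets themselves.  The map induced by a linear map on quotients is then that map, applied to
  representatives.
\<close>

definition quot_rep :: "('a, 'm, 'x) module_scheme \<Rightarrow> 'm set \<Rightarrow> 'm \<Rightarrow> 'm" where
  "quot_rep M H x = (SOME y. y \<in> carrier M \<and> y \<ominus>\<^bsub>M\<^esub> x \<in> H)"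

definition quot_module :: "('a, 'm, 'x) module_scheme \<Rightarrow> 'm set \<Rightarrow> ('a, 'm) module" where
  "quot_module M H = \<lparr>carrier = quot_rep M H ` carrier M,
     monoid.mult = undefined, monoid.one = undefined,
     ring.zero = quot_rep M H \<zero>\<^bsub>M\<^esub>,
     ring.add = (\<lambda>x y. quot_rep M H (x \<oplus>\<^bsub>M\<^esub> y)),
     smult = (\<lambda>a x. quot_rep M H (a \<odot>\<^bsub>M\<^esub> x))\<rparr>"

context
  fixes R :: "('a, 'c) ring_scheme" (structure) and M :: "('a, 'm, 'x) module_scheme" and H
  assumes M: "module R M" and H: "submodule H R M"
begin

interpretation M: module R M by (rule M)

private lemma Hzero: "\<zero>\<^bsub>M\<^esub> \<in> H"
  using subgroup.one_closed[OF submodule.axioms(1)[OF H]] by simp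

lemma quot_rep:
  assumes "x \<in> carrier M"
  shows "quot_rep M H x \<in> carrier M" "quot_rep M H x \<ominus>\<^bsub>M\<^esub> x \<in> H"
proof -
  have "x \<ominus>\<^bsub>M\<^esub> x = \<zero>\<^bsub>M\<^esub>" using assms by (simp add: M.minus_eq M.r_neg)
  then have "\<exists>y. y \<in> carrier M \<and> y \<ominus>\<^bsub>M\<^esub> x \<in> H" using assms Hzero by auto
  then have "quot_rep M H x \<in> carrier M \<and> quot_rep M H x \<ominus>\<^bsub>M\<^esub> x \<in> H"
    unfolding quot_rep_def by (rule someI_ex)
  then show "quot_rep M H x \<in> carrier M" "quot_rep M H x \<ominus>\<^bsub>M\<^esub> x \<in> H" by auto
qed

text \<open>
  A coset determines its representative, since the defining predicate of the choice depends on
  the coset only.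
\<close>

lemma quot_rep_eq_iff:
  assumes x: "x \<in> carrier M" and y: "y \<in> carrier M"
  shows "quot_rep M H x = quot_rep M H y \<longleftrightarrow> x \<ominus>\<^bsub>M\<^esub> y \<in> H"
proof -
  have sym: "b \<ominus>\<^bsub>M\<^esub> a \<in> H" if "a \<ominus>\<^bsub>M\<^esub> b \<in> H" "a \<in> carrier M" "b \<in> carrier M" for a b
    using M.submoduleE(3)[OF H that(1)] that(2,3) by (simp add: M.minus_eq M.minus_add M.a_ac)
  have trans: "a \<ominus>\<^bsub>M\<^esub> c \<in> H" if "a \<ominus>\<^bsub>M\<^esub> b \<in> H" "b \<ominus>\<^bsub>M\<^esub> c \<in> H"
      "a \<in> carrier M" "b \<in> carrier M" "c \<in> carrier M" for a b c
    using M.submoduleE(5)[OF H that(1,2)] that(3-5)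
    by (simp add: M.minus_eq M.a_ac M.r_neg M.r_neg1 M.r_neg2)
  show ?thesis
  proof
    assume "quot_rep M H x = quot_rep M H y"
    then show "x \<ominus>\<^bsub>M\<^esub> y \<in> H"
      using trans[OF sym] quot_rep[OF x] quot_rep[OF y] x y by metis
  next
    assume "x \<ominus>\<^bsub>M\<^esub> y \<in> H"
    then have "z \<ominus>\<^bsub>M\<^esub> x \<in> H \<longleftrightarrow> z \<ominus>\<^bsub>M\<^esub> y \<in> H" if "z \<in> carrier M" for z
      using trans[OF _ _ that x y] trans[OF _ sym that y x] x y by blast
    then show "quot_rep M H x = quot_rep M H y"
      unfolding quot_rep_def by (metis (no_types, lifting))
  qed
qed

lemma quot_rep_zero_iff:
  assumes "x \<in> carrier M"
  shows "quot_rep M H x = quot_rep M H \<zero>\<^bsub>M\<^esub> \<longleftrightarrow> x \<in> H"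
proof -
  have "x \<ominus>\<^bsub>M\<^esub> \<zero>\<^bsub>M\<^esub> = x"
    using M.minus_equality[of "\<zero>\<^bsub>M\<^esub>" "\<zero>\<^bsub>M\<^esub>"] assms by (simp add: M.minus_eq del: M.add.inv_one)
  then show ?thesis using quot_rep_eq_iff[OF assms M.zero_closed] by simp
qed

end

lemma quot_rep_comp:
  assumes M: "module R M" and H: "submodule H R M" and N: "module R N" and K: "submodule K R N"
    and g: "g \<in> mod_hom R M N" and gH: "g ` H \<subseteq> K" and x: "x \<in> carrier M"
  shows "quot_rep N K (g (quot_rep M H x)) = quot_rep N K (g x)"
proof -
  interpret M: module R M by (rule M)
  interpret N: module R N by (rule N)
  note r = quot_rep[OF M H x]
  have "g (quot_rep M H x \<ominus>\<^bsub>M\<^esub> x) \<in> K" using r(2) gH by blast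
  moreover have "g (quot_rep M H x \<ominus>\<^bsub>M\<^esub> x) = g (quot_rep M H x) \<ominus>\<^bsub>N\<^esub> g x"
    using x r(1) by (simp add: M.minus_eq N.minus_eq mod_homD[OF g] mod_hom_minus[OF M N g])
  ultimately show ?thesis
    using x r(1) by (simp add: quot_rep_eq_iff[OF N K] mod_homD(1)[OF g])
qed

lemma quot_rep_add:
  assumes M: "module R M" and H: "submodule H R M" and x: "x \<in> carrier M" and y: "y \<in> carrier M"
  shows "quot_rep M H (quot_rep M H x \<oplus>\<^bsub>M\<^esub> quot_rep M H y) = quot_rep M H (x \<oplus>\<^bsub>M\<^esub> y)"
proof -
  interpret M: module R M by (rule M)
  note rx = quot_rep[OF M H x] and ry = quot_rep[OF M H y]
  have "(quot_rep M H x \<ominus>\<^bsub>M\<^esub> x) \<oplus>\<^bsub>M\<^esub> (quot_rep M H y \<ominus>\<^bsub>M\<^esub> y) \<in> H"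
    using rx(2) ry(2) M.submoduleE(5)[OF H] by blast
  also have "(quot_rep M H x \<ominus>\<^bsub>M\<^esub> x) \<oplus>\<^bsub>M\<^esub> (quot_rep M H y \<ominus>\<^bsub>M\<^esub> y)
      = (quot_rep M H x \<oplus>\<^bsub>M\<^esub> quot_rep M H y) \<ominus>\<^bsub>M\<^esub> (x \<oplus>\<^bsub>M\<^esub> y)"
    using rx(1) ry(1) x y by (simp add: M.minus_eq M.minus_add M.a_ac)
  finally show ?thesis using rx(1) ry(1) x y by (simp add: quot_rep_eq_iff[OF M H])
qed

lemma quot_module_simps:
  "carrier (quot_module M H) = quot_rep M H ` carrier M"
  "\<zero>\<^bsub>quot_module M H\<^esub> = quot_rep M H \<zero>\<^bsub>M\<^esub>"
  "x \<oplus>\<^bsub>quot_module M H\<^esub> y = quot_rep M H (x \<oplus>\<^bsub>M\<^esub> y)"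
  "a \<odot>\<^bsub>quot_module M H\<^esub> x = quot_rep M H (a \<odot>\<^bsub>M\<^esub> x)"
  by (simp_all add: quot_module_def)

context
  fixes R :: "('a, 'c) ring_scheme" and M :: "('a, 'm, 'x) module_scheme" and H
  assumes M: "module R M" and H: "submodule H R M"
begin

interpretation M: module R M by (rule M)

lemma quot_rep_hom: "quot_rep M H \<in> mod_hom R M (quot_module M H)"
proof (rule mod_homI)
  fix a x assume a: "a \<in> carrier R" and x: "x \<in> carrier M"
  have "(\<lambda>x. a \<odot>\<^bsub>M\<^esub> x) ` H \<subseteq> H" using M.submoduleE(4)[OF H] a by blast
  then show "quot_rep M H (a \<odot>\<^bsub>M\<^esub> x) = a \<odot>\<^bsub>quot_module M H\<^esub> quot_rep M H x"
    using quot_rep_comp[OF M H M H mod_hom_smult[OF M a] _ x] by (simp add: quot_module_simps)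
qed (auto simp: quot_module_simps quot_rep_add[OF M H])

lemma quot_module_module: "module R (quot_module M H)"
proof (rule moduleI)
  let ?Q = "quot_module M H" and ?r = "quot_rep M H"
  note hom = mod_homD(2,3)[OF quot_rep_hom, symmetric]
  have zero: "\<zero>\<^bsub>?Q\<^esub> = ?r \<zero>\<^bsub>M\<^esub>" by (simp add: quot_module_simps)
  have cr: "x \<in> carrier ?Q \<Longrightarrow> \<exists>y\<in>carrier M. x = ?r y" for x
    by (auto simp: quot_module_simps)
  have mem: "y \<in> carrier M \<Longrightarrow> ?r y \<in> carrier ?Q" for y
    by (auto simp: quot_module_simps)
  show "cring R" by (rule M.R.is_cring)
  show "abelian_group ?Q"
  proof (rule abelian_groupI)
    fix x assume "x \<in> carrier ?Q"
    then obtain y where "y \<in> carrier M" "x = ?r y" using cr by blast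
    then show "\<exists>z\<in>carrier ?Q. z \<oplus>\<^bsub>?Q\<^esub> x = \<zero>\<^bsub>?Q\<^esub>"
      by (intro bexI[of _ "?r (\<ominus>\<^bsub>M\<^esub> y)"]) (auto simp: hom zero mem M.l_neg)
  qed (auto simp: hom zero mem M.a_ac dest!: cr)
qed (auto simp: quot_module_simps(1) mod_homD(2,3)[OF quot_rep_hom, symmetric]
    M.smult_l_distr M.smult_r_distr M.smult_assoc1)

end

lemma quot_map_hom:
  assumes M: "module R M" and H: "submodule H R M" and N: "module R N" and K: "submodule K R N"
    and g: "g \<in> mod_hom R M N" and gH: "g ` H \<subseteq> K"
  shows "(\<lambda>x. quot_rep N K (g x)) \<in> mod_hom R (quot_module M H) (quot_module N K)"
proof (rule mod_homI)
  interpret M: module R M by (rule M)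
  note c = quot_rep_comp[OF assms] and homN = mod_homD[OF quot_rep_hom[OF N K]]
  have inM: "x \<in> carrier (quot_module M H) \<Longrightarrow> x \<in> carrier M" for x
    using quot_rep(1)[OF M H] by (auto simp: quot_module_simps(1))
  fix x assume x: "x \<in> carrier (quot_module M H)"
  then show "quot_rep N K (g x) \<in> carrier (quot_module N K)"
    using inM homN(1) mod_homD(1)[OF g] by blast
  fix a assume "a \<in> carrier R"
  then show "quot_rep N K (g (a \<odot>\<^bsub>quot_module M H\<^esub> x)) = a \<odot>\<^bsub>quot_module N K\<^esub> quot_rep N K (g x)"
    using inM[OF x] by (simp add: quot_module_simps(4)[of M] c mod_homD[OF g] homN(3))
next
  interpret M: module R M by (rule M)
  note c = quot_rep_comp[OF assms] and homN = mod_homD[OF quot_rep_hom[OF N K]]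
  have inM: "x \<in> carrier (quot_module M H) \<Longrightarrow> x \<in> carrier M" for x
    using quot_rep(1)[OF M H] by (auto simp: quot_module_simps(1))
  fix x y assume "x \<in> carrier (quot_module M H)" "y \<in> carrier (quot_module M H)"
  then show "quot_rep N K (g (x \<oplus>\<^bsub>quot_module M H\<^esub> y)) = quot_rep N K (g x) \<oplus>\<^bsub>quot_module N K\<^esub> quot_rep N K (g y)"
    using inM by (simp add: quot_module_simps(3)[of M] c mod_homD[OF g] homN(2))
qed

text \<open>
  Vanishing on the generators of the kernel of \<open>\<phi>\<close> suffices for \<open>\<psi>\<close> to factor through \<open>\<phi>\<close>.
\<close>

lemma mod_hom_descend:
  assumes F: "module R F" and Q: "module R Q" and P: "module R P"
    and \<phi>: "\<phi> \<in> mod_hom R F Q" and surj: "\<phi> ` carrier F = carrier Q"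
    and ker: "a_kernel F Q \<phi> = submodule_gen R F B" and B: "B \<subseteq> carrier F"
    and \<psi>: "\<psi> \<in> mod_hom R F P" and van: "\<And>b. b \<in> B \<Longrightarrow> \<psi> b = \<zero>\<^bsub>P\<^esub>"
  shows "\<exists>r\<in>mod_hom R Q P. \<forall>a\<in>carrier F. r (\<phi> a) = \<psi> a"
proof -
  interpret F: module R F by (rule F)
  interpret Q: module R Q by (rule Q)
  interpret P: module R P by (rule P)
  have "(\<lambda>_. \<zero>\<^bsub>P\<^esub>) \<in> mod_hom R F P" by (rule mod_homI) auto
  then have "submodule {x \<in> carrier F. \<psi> x = \<zero>\<^bsub>P\<^esub>} R F"
    by (rule equalizer_submodule[OF F P \<psi>])
  then have "a_kernel F Q \<phi> \<subseteq> {x \<in> carrier F. \<psi> x = \<zero>\<^bsub>P\<^esub>}"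
    unfolding ker by (rule submodule_gen_least) (use B van in auto)
  then have ker0: "\<psi> x = \<zero>\<^bsub>P\<^esub>" if "x \<in> carrier F" "\<phi> x = \<zero>\<^bsub>Q\<^esub>" for x
    using that by (auto simp: a_kernel_def')
  have eq: "\<psi> x = \<psi> y" if "x \<in> carrier F" "y \<in> carrier F" "\<phi> x = \<phi> y" for x y
  proof -
    have "\<phi> (x \<oplus>\<^bsub>F\<^esub> \<ominus>\<^bsub>F\<^esub> y) = \<zero>\<^bsub>Q\<^esub>"
      using that by (simp add: mod_homD[OF \<phi>] mod_hom_minus[OF F Q \<phi>] Q.M.r_neg)
    then have "\<psi> x \<oplus>\<^bsub>P\<^esub> \<ominus>\<^bsub>P\<^esub> \<psi> y = \<zero>\<^bsub>P\<^esub>"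
      using that ker0[of "x \<oplus>\<^bsub>F\<^esub> \<ominus>\<^bsub>F\<^esub> y"] by (simp add: mod_homD[OF \<psi>] mod_hom_minus[OF F P \<psi>])
    then show ?thesis
      using that mod_homD(1)[OF \<psi>] P.M.minus_equality[of "\<psi> x" "\<ominus>\<^bsub>P\<^esub> \<psi> y"] by simp
  qed
  define r where "r q = \<psi> (inv_into (carrier F) \<phi> q)" for q
  have r: "r (\<phi> a) = \<psi> a" if "a \<in> carrier F" for a
    unfolding r_def using that by (intro eq) (auto intro: inv_into_into f_inv_into_f)
  have "r \<in> mod_hom R Q P"
  proof (rule mod_homI)
    fix q assume "q \<in> carrier Q"
    then obtain a where a: "a \<in> carrier F" "q = \<phi> a" using surj by blast
    then show "r q \<in> carrier P" by (simp add: r mod_homD[OF \<psi>])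
    fix c assume "c \<in> carrier R"
    then show "r (c \<odot>\<^bsub>Q\<^esub> q) = c \<odot>\<^bsub>P\<^esub> r q"
      using a by (simp add: r mod_homD[OF \<psi>] flip: mod_homD(3)[OF \<phi>])
  next
    fix q q' assume "q \<in> carrier Q" "q' \<in> carrier Q"
    then obtain a a' where "a \<in> carrier F" "q = \<phi> a" "a' \<in> carrier F" "q' = \<phi> a'" using surj by blast
    then show "r (q \<oplus>\<^bsub>Q\<^esub> q') = r q \<oplus>\<^bsub>P\<^esub> r q'"
      by (simp add: r mod_homD[OF \<psi>] flip: mod_homD(2)[OF \<phi>])
  qed
  with r show ?thesis by blast
qed

section \<open>Tensoring with a module over a localization\<close>

text \<open>
  A module over the localization, regarded as a module over \<open>R\<close>.
\<close>

definition loc_restrict ::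
    "('a, 'c) ring_scheme \<Rightarrow> 'a set \<Rightarrow> (('a \<times> 'a) set, 'n, 'y) module_scheme \<Rightarrow> ('a, 'n) module" where
  "loc_restrict R S N = \<lparr>carrier = carrier N, monoid.mult = undefined, monoid.one = undefined,
     ring.zero = \<zero>\<^bsub>N\<^esub>, ring.add = ring.add N,
     smult = (\<lambda>a x. loc_frac R S (self_module R) a \<one>\<^bsub>R\<^esub> \<odot>\<^bsub>N\<^esub> x)\<rparr>"

lemma loc_restrict_simps [simp]:
  "carrier (loc_restrict R S N) = carrier N"
  "\<zero>\<^bsub>loc_restrict R S N\<^esub> = \<zero>\<^bsub>N\<^esub>"
  "ring.add (loc_restrict R S N) = ring.add N"
  "a \<odot>\<^bsub>loc_restrict R S N\<^esub> x = loc_frac R S (self_module R) a \<one>\<^bsub>R\<^esub> \<odot>\<^bsub>N\<^esub> x"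
  by (simp_all add: loc_restrict_def)

context mult_subset
begin

lemma rfrac_closed [simp]: "a \<in> carrier R \<Longrightarrow> s \<in> S \<Longrightarrow> rfrac a s \<in> carrier (loc_ring R S)"
  by (auto simp: loc_ring_carrier)

lemma rfrac_self: "s \<in> S \<Longrightarrow> rfrac s s = \<one>\<^bsub>loc_ring R S\<^esub>"
  using rfrac_cancel[of \<one> s \<one>] by (simp add: loc_ring_simps(5) one_mem_S)

lemma rfrac_mult_denom: "a \<in> carrier R \<Longrightarrow> s \<in> S \<Longrightarrow> rfrac a \<one> \<otimes>\<^bsub>loc_ring R S\<^esub> rfrac \<one> s = rfrac a s"
  by (simp add: loc_mult_frac one_mem_S)

lemma loc_restrict_module:
  assumes N: "module (loc_ring R S) N"
  shows "module R (loc_restrict R S N)"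
proof -
  interpret N: module "loc_ring R S" N by fact
  show ?thesis
  proof (rule moduleI)
    show "abelian_group (loc_restrict R S N)"
      by (rule abelian_groupI) (auto simp: N.a_ac intro: N.l_neg)
  next
    fix a b x assume "a \<in> carrier R" "b \<in> carrier R" "x \<in> carrier (loc_restrict R S N)"
    then show "(a \<oplus> b) \<odot>\<^bsub>loc_restrict R S N\<^esub> x = a \<odot>\<^bsub>loc_restrict R S N\<^esub> x \<oplus>\<^bsub>loc_restrict R S N\<^esub> b \<odot>\<^bsub>loc_restrict R S N\<^esub> x"
      "(a \<otimes> b) \<odot>\<^bsub>loc_restrict R S N\<^esub> x = a \<odot>\<^bsub>loc_restrict R S N\<^esub> (b \<odot>\<^bsub>loc_restrict R S N\<^esub> x)"
      by (simp_all add: one_mem_S loc_ring_add_frac loc_mult_frac flip: N.smult_l_distr N.smult_assoc1)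
  qed (auto simp: is_cring one_mem_S N.smult_r_distr simp flip: loc_ring_simps(5))
qed

lemma restrict_rfrac_smult:
  assumes N: "module (loc_ring R S) N" and "a \<in> carrier R" "s \<in> S" "t \<in> S" "x \<in> carrier N"
  shows "a \<odot>\<^bsub>loc_restrict R S N\<^esub> (rfrac \<one> t \<odot>\<^bsub>N\<^esub> x) = rfrac a t \<odot>\<^bsub>N\<^esub> x"
proof -
  interpret N: module "loc_ring R S" N by fact
  show ?thesis using assms(2-)
    by (simp add: one_mem_S rfrac_mult_denom flip: N.smult_assoc1)
qed

lemma loc_smult_hom:
  assumes N: "module (loc_ring R S) N" and A: "A \<in> carrier (loc_ring R S)"
  shows "(\<lambda>x. A \<odot>\<^bsub>N\<^esub> x) \<in> mod_hom R (loc_restrict R S N) (loc_restrict R S N)"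
proof -
  interpret N: module "loc_ring R S" N by fact
  note h = mod_homD[OF mod_hom_smult[OF N A]]
  show ?thesis
    by (rule mod_homI) (auto simp: h one_mem_S)
qed

end

context loc_setup
begin

lemma loc_incl_hom: "(\<lambda>x. loc_frac R S M x \<one>) \<in> mod_hom R M (loc_restrict R S (loc_module R S M))"
  by (rule mod_homI) (auto simp: one_mem_S loc_add_frac loc_smult_frac)

lemma loc_smult_incl:
  assumes "x \<in> carrier M" "s \<in> S"
  shows "rfrac \<one> s \<odot>\<^bsub>loc_module R S M\<^esub> loc_frac R S M x \<one> = loc_frac R S M x s"
  using assms by (simp add: loc_smult_frac one_mem_S)

text \<open>
  The map \<open>x \<otimes> y \<mapsto> x/1 \<otimes> y\<close> from the tensor product over \<open>R\<close> to the one over the localization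
  is well defined.
\<close>

lemma null_extend:
  assumes N: "module (loc_ring R S) N" and c: "c \<in> tensor_null R M (loc_restrict R S N)"
  shows "pair_push (\<lambda>x. loc_frac R S M x \<one>) (\<lambda>y. y) c \<in> tensor_null (loc_ring R S) (loc_module R S M) N"
  using module_axioms loc_restrict_module[OF N] c
proof (induction rule: tensor_null_induct)
  case (rel c)
  note i = mod_homD[OF loc_incl_hom, simplified]
  have "pair_push (\<lambda>x. loc_frac R S M x \<one>) (\<lambda>y. y) c \<in> tensor_rels (loc_ring R S) (loc_module R S M) N"
    using rel unfolding tensor_rels_def[of R]
  proof (elim UnE CollectE exE conjE, goal_cases)
    case (1 x x' y)
    then show ?case
      by (auto simp: i intro!: tensor_relsI(1) loc_frac_carrier one_mem_S)
  next
    case (2 x y y')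
    then show ?case
      by (auto intro!: tensor_relsI(2) loc_frac_carrier one_mem_S)
  next
    case (3 a x y)
    then show ?case
      by (auto simp: i intro!: tensor_relsI(3) loc_frac_carrier rfrac_closed one_mem_S)
  qed
  then show ?case by (rule tensor_null_rel)
next
  case (minus c)
  then show ?case using tensor_null_minus[OF loc_module_module N] by simp
next
  case (add c d)
  then show ?case using tensor_null_add by fastforce
qed (simp add: tensor_null_zero)

text \<open>
  The inverse map \<open>x/s \<otimes> y \<mapsto> x \<otimes> (1/s) y\<close>, which moves denominators to the second factor.  It is
  given on formal sums by choosing a fraction in each class; modulo null sums the choice does not
  matter (\<open>clear_denom_frac\<close>).
\<close>

definition clear_denom :: "(('a \<times> 'a) set, 'n, 'y) module_scheme \<Rightarrow> (('m \<times> 'a) set \<times> 'n \<Rightarrow>\<^sub>0 int) \<Rightarrow> ('m \<times> 'n \<Rightarrow>\<^sub>0 int)" where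
  "clear_denom N = frag_extend (\<lambda>(C, y). case SOME z. z \<in> C of (x, s) \<Rightarrow>
     frag_of (x, rfrac \<one> s \<odot>\<^bsub>N\<^esub> y))"

lemma clear_denom_simps:
  "clear_denom N 0 = 0"
  "clear_denom N (c + d) = clear_denom N c + clear_denom N d"
  "clear_denom N (c - d) = clear_denom N c - clear_denom N d"
  "clear_denom N (- c) = - clear_denom N c"
  by (simp_all add: clear_denom_def frag_extend_add frag_extend_diff frag_extend_minus)

text \<open>
  Two equal fractions become literally equal after enlarging both to a common form
  \<open>(a x)/(a s)\<close>, and enlarging by \<open>a\<close> changes nothing because
  \<open>a x \<otimes> (1/(a s)) y = x \<otimes> (a/(a s)) y = x \<otimes> (1/s) y\<close>.
\<close>

lemma clear_denom_frac:
  assumes N: "module (loc_ring R S) N" and x: "x \<in> carrier M" and s: "s \<in> S" and y: "y \<in> carrier N"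
  shows "clear_denom N (frag_of (loc_frac R S M x s, y)) - frag_of (x, rfrac \<one> s \<odot>\<^bsub>N\<^esub> y)
    \<in> tensor_null R M (loc_restrict R S N)"
proof -
  interpret N: module "loc_ring R S" N by fact
  let ?N = "loc_restrict R S N"
  have mN: "module R ?N" by (rule loc_restrict_module[OF N])
  have step: "frag_of (a \<odot>\<^bsub>M\<^esub> x, rfrac \<one> (a \<otimes> s) \<odot>\<^bsub>N\<^esub> y) - frag_of (x, rfrac \<one> s \<odot>\<^bsub>N\<^esub> y)
      \<in> tensor_null R M ?N" if "x \<in> carrier M" "a \<in> S" "s \<in> S" for a x s
  proof -
    have "a \<odot>\<^bsub>?N\<^esub> (rfrac \<one> (a \<otimes> s) \<odot>\<^bsub>N\<^esub> y) = rfrac (a \<otimes> \<one>) (a \<otimes> s) \<odot>\<^bsub>N\<^esub> y"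
      using restrict_rfrac_smult[OF N] that y one_mem_S S_mult by simp
    also have "\<dots> = rfrac \<one> s \<odot>\<^bsub>N\<^esub> y"
      using that by (subst rfrac_cancel) auto
    finally show ?thesis
      using tensor_relsI(3)[of a R x M "rfrac \<one> (a \<otimes> s) \<odot>\<^bsub>N\<^esub> y" ?N] that y
      by (simp del: loc_restrict_simps(4) add: tensor_null_rel S_mult)
  qed
  obtain x' s' where z: "(SOME z. z \<in> loc_frac R S M x s) = (x', s')" by fastforce
  have "(x, s) \<in> loc_frac R S M x s"
    using x s equiv_class_self[OF loc_rel_equiv] by (auto simp: loc_frac_def)
  then have "(x', s') \<in> loc_frac R S M x s" unfolding z[symmetric] by (rule someI)
  then have "((x, s), (x', s')) \<in> loc_rel R S M" by (simp add: loc_frac_def)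
  then obtain u where u: "x' \<in> carrier M" "s' \<in> S" "u \<in> S" "(u \<otimes> s') \<odot>\<^bsub>M\<^esub> x = (u \<otimes> s) \<odot>\<^bsub>M\<^esub> x'"
    by (elim loc_relE) blast
  have "frag_of ((u \<otimes> s) \<odot>\<^bsub>M\<^esub> x', rfrac \<one> ((u \<otimes> s) \<otimes> s') \<odot>\<^bsub>N\<^esub> y) - frag_of (x, rfrac \<one> s \<odot>\<^bsub>N\<^esub> y) \<in> tensor_null R M ?N"
    using step[of x "u \<otimes> s'" s] x s u by (simp add: S_mult m_ac)
  from tensor_null_diff[OF module_axioms mN this step[of x' "u \<otimes> s" s']]
  show ?thesis using u s by (simp add: clear_denom_def z S_mult)
qed

lemma clear_denom_null:
  assumes N: "module (loc_ring R S) N" and c: "c \<in> tensor_null (loc_ring R S) (loc_module R S M) N"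
  shows "clear_denom N c \<in> tensor_null R M (loc_restrict R S N)"
  using loc_module_module N c
proof (induction rule: tensor_null_induct)
  interpret N: module "loc_ring R S" N by fact
  let ?N = "loc_restrict R S N" and ?M = "loc_module R S M"
  have mN: "module R ?N" by (rule loc_restrict_module[OF N])
  note add0 = tensor_null_add[of _ R M ?N] and diff0 = tensor_null_diff[OF module_axioms mN]
  note cd = clear_denom_frac[OF N]
  note r = tensor_null_rel[of _ R M ?N]
  case (rel c)
  then show ?case
    unfolding tensor_rels_def[of "loc_ring R S"]
  proof (elim UnE CollectE exE conjE, goal_cases)
    case (1 C C' y)
    then obtain x s x' t where h: "C = loc_frac R S M x s" "C' = loc_frac R S M x' t"
      "x \<in> carrier M" "s \<in> S" "x' \<in> carrier M" "t \<in> S" by (auto simp: loc_carrier)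
    let ?y = "rfrac \<one> (s \<otimes> t) \<odot>\<^bsub>N\<^esub> y"
    have e: "t \<odot>\<^bsub>?N\<^esub> ?y = rfrac \<one> s \<odot>\<^bsub>N\<^esub> y" "s \<odot>\<^bsub>?N\<^esub> ?y = rfrac \<one> t \<odot>\<^bsub>N\<^esub> y"
      using rfrac_cancel[of \<one> t s] rfrac_cancel[of \<one> s t] h 1
      by (simp_all add: restrict_rfrac_smult[OF N] S_mult one_mem_S m_comm del: loc_restrict_simps(4))
    have y: "?y \<in> carrier ?N" using h 1 by (simp add: S_mult)
    have "frag_of (t \<odot>\<^bsub>M\<^esub> x \<oplus>\<^bsub>M\<^esub> s \<odot>\<^bsub>M\<^esub> x', ?y) - frag_of (t \<odot>\<^bsub>M\<^esub> x, ?y) - frag_of (s \<odot>\<^bsub>M\<^esub> x', ?y)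
      \<in> tensor_null R M ?N"
      using h y by (intro r tensor_relsI) auto
    from add0[OF add0[OF this r[OF tensor_relsI(3)[of t R x M ?y ?N]]] r[OF tensor_relsI(3)[of s R x' M ?y ?N]]]
    have "frag_of (t \<odot>\<^bsub>M\<^esub> x \<oplus>\<^bsub>M\<^esub> s \<odot>\<^bsub>M\<^esub> x', ?y) - frag_of (x, rfrac \<one> s \<odot>\<^bsub>N\<^esub> y)
       - frag_of (x', rfrac \<one> t \<odot>\<^bsub>N\<^esub> y) \<in> tensor_null R M ?N"
      using h y unfolding e by (simp add: algebra_simps)
    from diff0[OF diff0[OF add0[OF this cd[of "t \<odot>\<^bsub>M\<^esub> x \<oplus>\<^bsub>M\<^esub> s \<odot>\<^bsub>M\<^esub> x'" "s \<otimes> t" y]] cd[of x s y]] cd[of x' t y]]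
    show ?case
      using h 1(2-) unfolding 1(1) by (simp add: clear_denom_simps loc_add_frac S_mult algebra_simps)
  next
    case (2 C y y')
    then obtain x s where h: "C = loc_frac R S M x s" "x \<in> carrier M" "s \<in> S" by (auto simp: loc_carrier)
    have "frag_of (x, rfrac \<one> s \<odot>\<^bsub>N\<^esub> (y \<oplus>\<^bsub>N\<^esub> y')) - frag_of (x, rfrac \<one> s \<odot>\<^bsub>N\<^esub> y) - frag_of (x, rfrac \<one> s \<odot>\<^bsub>N\<^esub> y')
      \<in> tensor_null R M ?N"
      using r[OF tensor_relsI(2)[of x M "rfrac \<one> s \<odot>\<^bsub>N\<^esub> y" ?N "rfrac \<one> s \<odot>\<^bsub>N\<^esub> y'" R]] h 2
      by (simp add: N.smult_r_distr)
    from diff0[OF diff0[OF add0[OF this cd[of x s "y \<oplus>\<^bsub>N\<^esub> y'"]] cd[of x s y]] cd[of x s y']]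
    show ?case using h 2(2-) unfolding 2(1) by (simp add: clear_denom_simps algebra_simps)
  next
    case (3 A C y)
    then obtain a s x t where h: "A = rfrac a s" "C = loc_frac R S M x t"
      "a \<in> carrier R" "s \<in> S" "x \<in> carrier M" "t \<in> S" by (auto simp: loc_carrier loc_ring_carrier)
    let ?y = "rfrac \<one> (s \<otimes> t) \<odot>\<^bsub>N\<^esub> y"
    have y: "?y \<in> carrier ?N" using h 3 by (simp add: S_mult)
    have e: "a \<odot>\<^bsub>?N\<^esub> ?y = rfrac \<one> t \<odot>\<^bsub>N\<^esub> (A \<odot>\<^bsub>N\<^esub> y)"
      using h 3
      by (simp add: restrict_rfrac_smult[OF N] S_mult loc_mult_frac one_mem_S m_comm del: loc_restrict_simps(4) flip: N.smult_assoc1)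
    from r[OF tensor_relsI(3)[of a R x M ?y ?N]]
    have "frag_of (a \<odot>\<^bsub>M\<^esub> x, ?y) - frag_of (x, rfrac \<one> t \<odot>\<^bsub>N\<^esub> (A \<odot>\<^bsub>N\<^esub> y)) \<in> tensor_null R M ?N"
      unfolding e using y h by simp
    from diff0[OF add0[OF this cd[of "a \<odot>\<^bsub>M\<^esub> x" "s \<otimes> t" y]] cd[of x t "A \<odot>\<^bsub>N\<^esub> y"]]
    show ?case using h 3(2-) unfolding 3(1) by (simp add: clear_denom_simps loc_smult_frac S_mult algebra_simps)
  qed
next
  case (minus c)
  then show ?case
    using tensor_null_minus[OF module_axioms loc_restrict_module[OF N]] by (simp add: clear_denom_simps)
next
  case (add c d)
  then show ?case using tensor_null_add by (fastforce simp: clear_denom_simps)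
qed (simp add: tensor_null_zero clear_denom_simps)

theorem null_extend_iff:
  assumes N: "module (loc_ring R S) N" and c: "Poly_Mapping.keys c \<subseteq> carrier M \<times> carrier N"
  shows "pair_push (\<lambda>x. loc_frac R S M x \<one>) (\<lambda>y. y) c \<in> tensor_null (loc_ring R S) (loc_module R S M) N
    \<longleftrightarrow> c \<in> tensor_null R M (loc_restrict R S N)" (is "?e c \<in> ?K' \<longleftrightarrow> c \<in> ?K")
proof
  interpret N: module "loc_ring R S" N by fact
  note mN = loc_restrict_module[OF N]
  have "clear_denom N (?e c) - c \<in> ?K"
    using c
  proof (induction c rule: pairs_induct)
    case (of x y)
    then show ?case using clear_denom_frac[OF N of(1) one_mem_S of(2)]
      by (simp add: N.smult_one flip: loc_ring_simps(5))
  next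
    case (diff c d)
    then show ?case using tensor_null_diff[OF module_axioms mN diff]
      by (simp add: clear_denom_simps algebra_simps)
  qed (simp add: tensor_null_zero clear_denom_simps)
  moreover assume "?e c \<in> ?K'"
  ultimately show "c \<in> ?K"
    using tensor_null_diff[OF module_axioms mN clear_denom_null[OF N], of "?e c" "clear_denom N (?e c) - c"]
    by simp
qed (rule null_extend[OF N])

text \<open>
  Surjectivity of the comparison map: \<open>x/s \<otimes> y = x/1 \<otimes> (1/s) y\<close>.
\<close>

lemma extend_surj:
  assumes N: "module (loc_ring R S) N" and c: "Poly_Mapping.keys c \<subseteq> carrier (loc_module R S M) \<times> carrier N"
  shows "\<exists>d. Poly_Mapping.keys d \<subseteq> carrier M \<times> carrier N \<and>
    c - pair_push (\<lambda>x. loc_frac R S M x \<one>) (\<lambda>y. y) d \<in> tensor_null (loc_ring R S) (loc_module R S M) N"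
  using c
proof (induction c rule: pairs_induct)
  case zero
  show ?case by (intro exI[of _ 0]) (simp add: tensor_null_zero)
next
  interpret N: module "loc_ring R S" N by fact
  case (of C y)
  then obtain x s where h: "C = loc_frac R S M x s" "x \<in> carrier M" "s \<in> S" by (auto simp: loc_carrier)
  from tensor_null_rel[OF tensor_relsI(3)[of "rfrac \<one> s" "loc_ring R S" "loc_frac R S M x \<one>" "loc_module R S M" y N]]
  show ?case
    using h of(2) by (intro exI[of _ "frag_of (x, rfrac \<one> s \<odot>\<^bsub>N\<^esub> y)"]) (simp add: one_mem_S loc_smult_incl)
next
  case (diff c d)
  then obtain c' d' where
    h: "Poly_Mapping.keys c' \<subseteq> carrier M \<times> carrier N" "Poly_Mapping.keys d' \<subseteq> carrier M \<times> carrier N"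
    "c - pair_push (\<lambda>x. loc_frac R S M x \<one>) (\<lambda>y. y) c' \<in> tensor_null (loc_ring R S) (loc_module R S M) N"
    "d - pair_push (\<lambda>x. loc_frac R S M x \<one>) (\<lambda>y. y) d' \<in> tensor_null (loc_ring R S) (loc_module R S M) N"
    by blast
  have "Poly_Mapping.keys (c' - d') \<subseteq> carrier M \<times> carrier N"
    using h(1,2) keys_diff[of c' d'] by blast
  then show ?case
    using tensor_null_diff[OF loc_module_module N h(3,4)]
    by (intro exI[of _ "c' - d'"]) (simp add: algebra_simps)
qed

text \<open>
  Since \<open>M\<^sub>S \<otimes> N\<close> over \<open>R\<^sub>S\<close> is naturally \<open>M \<otimes> N\<close> over \<open>R\<close>, injectivity of \<open>f\<^sub>S \<otimes> N\<close> can be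
  tested on \<open>f \<otimes> N\<close>.
\<close>

theorem loc_map_tensor_inj_iff:
  assumes M': "module R M'" and f: "f \<in> mod_hom R M M'" and N: "module (loc_ring R S) N"
  shows "inj_on (tensor_map (loc_ring R S) (loc_module R S M') N (loc_map R S M' f) (\<lambda>y. y))
      (carrier (tensor (loc_ring R S) (loc_module R S M) N)) \<longleftrightarrow>
    (\<forall>c. Poly_Mapping.keys c \<subseteq> carrier M \<times> carrier N \<longrightarrow>
      pair_push f (\<lambda>y. y) c \<in> tensor_null R M' (loc_restrict R S N) \<longrightarrow> c \<in> tensor_null R M (loc_restrict R S N))"
proof -
  interpret M': loc_setup R S M'
    using M' by (simp add: loc_setup_def mult_subset_axioms)
  let ?K = "tensor_null (loc_ring R S) (loc_module R S M) N"
  let ?K' = "tensor_null (loc_ring R S) (loc_module R S M') N"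
  let ?e = "pair_push (\<lambda>x. loc_frac R S M x \<one>) (\<lambda>y. y)"
  let ?f = "pair_push (loc_map R S M' f) (\<lambda>y. y)"
  have push: "?f (?e c) \<in> ?K' \<longleftrightarrow> pair_push f (\<lambda>y. y) c \<in> tensor_null R M' (loc_restrict R S N)"
    if c: "Poly_Mapping.keys c \<subseteq> carrier M \<times> carrier N" for c
  proof -
    have "Poly_Mapping.keys (pair_push f (\<lambda>y. y) c) \<subseteq> carrier M' \<times> carrier N"
      using c by (rule pair_push_keys) (auto simp: mod_homD[OF f])
    moreover have "?f (?e c) = pair_push (\<lambda>x. loc_frac R S M' x \<one>) (\<lambda>y. y) (pair_push f (\<lambda>y. y) c)"
      unfolding pair_push_push using c
      by (rule pair_push_cong) (auto simp: loc_map_frac[OF M' f] one_mem_S)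
    ultimately show ?thesis by (simp add: M'.null_extend_iff[OF N])
  qed
  have "(\<forall>c. Poly_Mapping.keys c \<subseteq> carrier (loc_module R S M) \<times> carrier N \<longrightarrow> ?f c \<in> ?K' \<longrightarrow> c \<in> ?K) \<longleftrightarrow>
    (\<forall>c. Poly_Mapping.keys c \<subseteq> carrier M \<times> carrier N \<longrightarrow> ?f (?e c) \<in> ?K' \<longrightarrow> ?e c \<in> ?K)" (is "?l \<longleftrightarrow> ?r")
  proof
    assume ?l
    then show ?r
      using pair_push_keys[of _ "carrier M" "carrier N" "\<lambda>x. loc_frac R S M x \<one>" "carrier (loc_module R S M)" "\<lambda>y. y" "carrier N"]
      by (simp add: one_mem_S)
  next
    assume r: ?r
    show ?l
    proof (intro allI impI)
      fix c assume c: "Poly_Mapping.keys c \<subseteq> carrier (loc_module R S M) \<times> carrier N" "?f c \<in> ?K'"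
      obtain d where d: "Poly_Mapping.keys d \<subseteq> carrier M \<times> carrier N" "c - ?e d \<in> ?K"
        using extend_surj[OF N c(1)] by blast
      have "?f (c - ?e d) \<in> ?K'"
        by (rule pair_push_null[OF loc_module_module N M'.loc_module_module N loc_map_hom[OF M' f] mod_hom_id d(2)])
      from tensor_null_diff[OF M'.loc_module_module N c(2) this] have "?f (?e d) \<in> ?K'" by simp
      with r d(1) have "?e d \<in> ?K" by blast
      from tensor_null_add[OF this d(2)] show "c \<in> ?K" by simp
    qed
  qed
  then show ?thesis
    by (simp add: inj_tensor_iff[OF loc_module_module M'.loc_module_module N loc_map_hom[OF M' f]] push null_extend_iff[OF N] cong: imp_cong)
qed

end

section \<open>Solving linear equations after a pure map\<close>

definition unit_vec :: "('a, 'c) ring_scheme \<Rightarrow> nat \<Rightarrow> nat \<Rightarrow> nat \<Rightarrow> 'a" where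
  "unit_vec R n k = (\<lambda>j\<in>{..<n}. if j = k then \<one>\<^bsub>R\<^esub> else \<zero>\<^bsub>R\<^esub>)"

text \<open>
  Keeping the first \<open>k\<close> coordinates.  Induction on \<open>k\<close> extends statements from unit vectors to all
  vectors one coordinate at a time, without finite sums inside the module.
\<close>

definition trunc_vec :: "('a, 'c) ring_scheme \<Rightarrow> nat \<Rightarrow> nat \<Rightarrow> (nat \<Rightarrow> 'a) \<Rightarrow> nat \<Rightarrow> 'a" where
  "trunc_vec R n k b = (\<lambda>j\<in>{..<n}. if j < k then b j else \<zero>\<^bsub>R\<^esub>)"

lemma unit_vec_closed: "cring R \<Longrightarrow> unit_vec R n k \<in> carrier (free_mod R n)"
  using ring.ring_simprules(6)[OF cring.axioms(1)] ring.ring_simprules(2)[OF cring.axioms(1)]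
  by (auto simp: unit_vec_def free_mod_def)

lemma trunc_vec:
  assumes "cring R" "b \<in> carrier (free_mod R n)"
  shows "trunc_vec R n k b \<in> carrier (free_mod R n)"
    and "trunc_vec R n 0 b = \<zero>\<^bsub>free_mod R n\<^esub>"
    and "trunc_vec R n n b = b"
    and "k < n \<Longrightarrow> trunc_vec R n (Suc k) b =
      trunc_vec R n k b \<oplus>\<^bsub>free_mod R n\<^esub> b k \<odot>\<^bsub>free_mod R n\<^esub> unit_vec R n k"
    and "k < n \<Longrightarrow> b k \<in> carrier R"
proof -
  interpret cring R by fact
  have b: "j < n \<Longrightarrow> b j \<in> carrier R" "\<not> j < n \<Longrightarrow> b j = undefined" for j
    using assms(2) by (auto simp: free_mod_def PiE_iff extensional_def)
  show "trunc_vec R n k b \<in> carrier (free_mod R n)" "trunc_vec R n 0 b = \<zero>\<^bsub>free_mod R n\<^esub>" "trunc_vec R n n b = b" "k < n \<Longrightarrow> b k \<in> carrier R"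
    using b by (auto simp: trunc_vec_def unit_vec_def free_mod_def fun_eq_iff)
  show "trunc_vec R n (Suc k) b =
      trunc_vec R n k b \<oplus>\<^bsub>free_mod R n\<^esub> b k \<odot>\<^bsub>free_mod R n\<^esub> unit_vec R n k" if "k < n"
    using b that by (auto simp: trunc_vec_def unit_vec_def free_mod_def fun_eq_iff less_Suc_eq)
qed

lemma free_mod_hom_eqI:
  assumes M: "module R M" and g: "g \<in> mod_hom R (free_mod R n) M" and h: "h \<in> mod_hom R (free_mod R n) M"
    and eq: "\<And>k. k < n \<Longrightarrow> g (unit_vec R n k) = h (unit_vec R n k)"
    and b: "b \<in> carrier (free_mod R n)"
  shows "g b = h b"
proof -
  interpret M: module R M by fact
  note F = free_mod_module[OF M.R.is_cring, of n] and t = trunc_vec[OF M.R.is_cring b]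
  have "k \<le> n \<Longrightarrow> g (trunc_vec R n k b) = h (trunc_vec R n k b)" for k
  proof (induction k)
    case 0
    then show ?case by (simp add: t mod_hom_zero[OF F M g] mod_hom_zero[OF F M h])
  next
    case (Suc k)
    interpret F: module R "free_mod R n" by (rule F)
    show ?case using Suc by (simp add: t unit_vec_closed[OF M.R.is_cring] mod_homD[OF g] mod_homD[OF h] eq)
  qed
  from this[of n] show ?thesis by (simp add: t)
qed

text \<open>
  Fix vectors \<open>a\<^sub>i\<close> of \<open>F\<close> for \<open>i \<in> I\<close>.  A family \<open>x\<close> in \<open>V\<^sup>I\<close> lies in this submodule if and only if
  the equations \<open>\<psi> a\<^sub>i = x\<^sub>i\<close> have a linear solution \<open>\<psi> : F \<rightarrow> V\<close>.  The cokernel is thus the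
  obstruction to solving such equations.  It is functorial in \<open>V\<close>; the case \<open>V = R\<close> supplies the
  test module and the case \<open>V = P\<close> detects solutions in \<open>P\<close>.
\<close>

definition eval_image ::
    "('a, 'c) ring_scheme \<Rightarrow> ('a, 'f, 'z) module_scheme \<Rightarrow> 'i set \<Rightarrow> ('i \<Rightarrow> 'f) \<Rightarrow> ('a, 'm, 'x) module_scheme
      \<Rightarrow> ('i \<Rightarrow> 'm) set" where
  "eval_image R F I a V = (\<lambda>\<psi>. \<lambda>i\<in>I. \<psi> (a i)) ` mod_hom R F V"

definition eval_coker ::
    "('a, 'c) ring_scheme \<Rightarrow> ('a, 'f, 'z) module_scheme \<Rightarrow> 'i set \<Rightarrow> ('i \<Rightarrow> 'f) \<Rightarrow> ('a, 'm, 'x) module_scheme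
      \<Rightarrow> ('a, 'i \<Rightarrow> 'm) module" where
  "eval_coker R F I a V = quot_module (pow_module I V) (eval_image R F I a V)"

abbreviation eval_class ::
    "('a, 'c) ring_scheme \<Rightarrow> ('a, 'f, 'z) module_scheme \<Rightarrow> 'i set \<Rightarrow> ('i \<Rightarrow> 'f) \<Rightarrow> ('a, 'm, 'x) module_scheme
      \<Rightarrow> ('i \<Rightarrow> 'm) \<Rightarrow> 'i \<Rightarrow> 'm" where
  "eval_class R F I a V \<equiv> quot_rep (pow_module I V) (eval_image R F I a V)"

lemma eval_imageI: "\<psi> \<in> mod_hom R F V \<Longrightarrow> t = (\<lambda>i\<in>I. \<psi> (a i)) \<Longrightarrow> t \<in> eval_image R F I a V"
  unfolding eval_image_def by blast

lemma eval_image_submodule: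
  assumes F: "module R F" and V: "module R V" and a: "\<And>i. i \<in> I \<Longrightarrow> a i \<in> carrier F"
  shows "submodule (eval_image R F I a V) R (pow_module I V)"
proof -
  interpret F: module R F by fact
  interpret V: module R V by fact
  interpret VI: module R "pow_module I V" by (rule pow_module_module[OF V])
  have smult: "c \<odot>\<^bsub>pow_module I V\<^esub> t \<in> eval_image R F I a V"
    if t: "t \<in> eval_image R F I a V" and c: "c \<in> carrier R" for c t
  proof -
    obtain \<psi> where \<psi>: "\<psi> \<in> mod_hom R F V" "t = (\<lambda>i\<in>I. \<psi> (a i))"
      using t unfolding eval_image_def by blast
    have "(\<lambda>x. c \<odot>\<^bsub>V\<^esub> \<psi> x) \<in> mod_hom R F V"
      by (rule mod_hom_comp[OF \<psi>(1) mod_hom_smult[OF V c]])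
    moreover have "c \<odot>\<^bsub>pow_module I V\<^esub> t = (\<lambda>i\<in>I. c \<odot>\<^bsub>V\<^esub> \<psi> (a i))"
      by (auto simp: \<psi>(2) pow_module_simps)
    ultimately show ?thesis by (rule eval_imageI)
  qed
  have sub: "eval_image R F I a V \<subseteq> carrier (pow_module I V)"
    using a by (auto simp: eval_image_def pow_module_simps mod_homD)
  show ?thesis
  proof (rule VI.submoduleI)
    show "eval_image R F I a V \<subseteq> carrier (pow_module I V)" by (rule sub)
    have "(\<lambda>_. \<zero>\<^bsub>V\<^esub>) \<in> mod_hom R F V" by (rule mod_homI) auto
    then show "\<zero>\<^bsub>pow_module I V\<^esub> \<in> eval_image R F I a V"
      unfolding eval_image_def pow_module_simps by (intro image_eqI) auto
  next
    fix t assume t: "t \<in> eval_image R F I a V"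
    then have "\<ominus>\<^bsub>pow_module I V\<^esub> t = (\<ominus>\<^bsub>R\<^esub> \<one>\<^bsub>R\<^esub>) \<odot>\<^bsub>pow_module I V\<^esub> t"
      using sub by (subst VI.smult_l_minus) auto
    then show "\<ominus>\<^bsub>pow_module I V\<^esub> t \<in> eval_image R F I a V"
      using smult[OF t] by simp
  next
    fix t t' assume "t \<in> eval_image R F I a V" "t' \<in> eval_image R F I a V"
    then obtain \<psi> \<psi>' where \<psi>: "\<psi> \<in> mod_hom R F V" "t = (\<lambda>i\<in>I. \<psi> (a i))"
      "\<psi>' \<in> mod_hom R F V" "t' = (\<lambda>i\<in>I. \<psi>' (a i))"
      unfolding eval_image_def by blast
    have "(\<lambda>x. \<psi> x \<oplus>\<^bsub>V\<^esub> \<psi>' x) \<in> mod_hom R F V"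
      by (rule mod_homI) (auto simp: mod_homD[OF \<psi>(1)] mod_homD[OF \<psi>(3)] V.M.a_ac V.smult_r_distr)
    moreover have "t \<oplus>\<^bsub>pow_module I V\<^esub> t' = (\<lambda>i\<in>I. \<psi> (a i) \<oplus>\<^bsub>V\<^esub> \<psi>' (a i))"
      by (auto simp: \<psi>(2,4) pow_module_simps)
    ultimately show "t \<oplus>\<^bsub>pow_module I V\<^esub> t' \<in> eval_image R F I a V"
      by (rule eval_imageI)
  qed (rule smult)
qed

lemma pow_map_hom:
  assumes "g \<in> mod_hom R V W" "module R V"
  shows "(\<lambda>t. \<lambda>i\<in>I. g (t i)) \<in> mod_hom R (pow_module I V) (pow_module I W)"
proof -
  interpret V: module R V by fact
  show ?thesis
    by (rule mod_homI) (auto simp: pow_module_simps PiE_iff mod_homD[OF assms(1)] fun_eq_iff)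
qed

context
  fixes R :: "('a, 'c) ring_scheme" (structure) and F :: "('a, 'f, 'z) module_scheme"
    and I :: "'i set" and a :: "'i \<Rightarrow> 'f"
  assumes F: "module R F" and a: "\<And>i. i \<in> I \<Longrightarrow> a i \<in> carrier F"
begin

lemmas eval_quot = pow_module_module eval_image_submodule[OF F _ a]

lemma eval_coker_module: "module R V \<Longrightarrow> module R (eval_coker R F I a V)"
  unfolding eval_coker_def by (rule quot_module_module[OF eval_quot])

lemma eval_class_hom: "module R V \<Longrightarrow> eval_class R F I a V \<in> mod_hom R (pow_module I V) (eval_coker R F I a V)"
  unfolding eval_coker_def by (rule quot_rep_hom[OF eval_quot])

lemma eval_coker_carrier:
  "carrier (eval_coker R F I a V) = eval_class R F I a V ` carrier (pow_module I V)"
  by (simp add: eval_coker_def quot_module_simps)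

lemma eval_coker_map:
  assumes V: "module R V" and W: "module R W" and g: "g \<in> mod_hom R V W"
  shows "(\<lambda>t. eval_class R F I a W (\<lambda>i\<in>I. g (t i))) \<in> mod_hom R (eval_coker R F I a V) (eval_coker R F I a W)"
    and "t \<in> carrier (pow_module I V) \<Longrightarrow>
      eval_class R F I a W (\<lambda>i\<in>I. g (eval_class R F I a V t i)) = eval_class R F I a W (\<lambda>i\<in>I. g (t i))"
proof -
  have im: "(\<lambda>t. \<lambda>i\<in>I. g (t i)) ` eval_image R F I a V \<subseteq> eval_image R F I a W"
  proof clarify
    fix t assume "t \<in> eval_image R F I a V"
    then obtain \<psi> where \<psi>: "\<psi> \<in> mod_hom R F V" "t = (\<lambda>i\<in>I. \<psi> (a i))"
      unfolding eval_image_def by blast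
    then have "(\<lambda>i\<in>I. g (t i)) = (\<lambda>i\<in>I. g (\<psi> (a i)))" by auto
    then show "(\<lambda>i\<in>I. g (t i)) \<in> eval_image R F I a W"
      by (rule eval_imageI[OF mod_hom_comp[OF \<psi>(1) g]])
  qed
  show "(\<lambda>t. eval_class R F I a W (\<lambda>i\<in>I. g (t i))) \<in> mod_hom R (eval_coker R F I a V) (eval_coker R F I a W)"
    unfolding eval_coker_def
    by (rule quot_map_hom[OF eval_quot[OF V] eval_quot[OF W] pow_map_hom[OF g V] im])
  show "t \<in> carrier (pow_module I V) \<Longrightarrow>
      eval_class R F I a W (\<lambda>i\<in>I. g (eval_class R F I a V t i)) = eval_class R F I a W (\<lambda>i\<in>I. g (t i))"
    by (rule quot_rep_comp[OF eval_quot[OF V] eval_quot[OF W] pow_map_hom[OF g V] im])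
qed

end


abbreviation eval_basis :: "('a, 'c) ring_scheme \<Rightarrow> ('a, 'f, 'z) module_scheme \<Rightarrow> 'i set \<Rightarrow> ('i \<Rightarrow> 'f) \<Rightarrow> 'i \<Rightarrow> 'i \<Rightarrow> 'a" where
  "eval_basis R F I a i \<equiv>
     eval_class R F I a (self_module R) (\<lambda>j\<in>I. if j = i then \<one>\<^bsub>R\<^esub> else \<zero>\<^bsub>R\<^esub>)"

text \<open>
  Write \<open>q\<^sub>k\<close> for the images of the unit vectors under \<open>\<phi>\<close>.  Then
  \<open>\<Sum>\<^sub>i \<phi> a\<^sub>i \<otimes> e\<^sub>i = \<Sum>\<^sub>k q\<^sub>k \<otimes> \<Sum>\<^sub>i a\<^sub>i\<^sub>k e\<^sub>i\<close>, and the inner sum is the class of the family \<open>(a\<^sub>i\<^sub>k)\<^sub>i\<close>,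
  which is zero since the \<open>k\<close>-th coordinate functional on \<open>F\<close> evaluates to it.
\<close>

lemma relation_null:
  fixes R :: "('a, 'c) ring_scheme" and Q :: "('a, 'q, 'y) module_scheme" and a :: "'i \<Rightarrow> nat \<Rightarrow> 'a"
  assumes R: "cring R" and Q: "module R Q" and \<phi>: "\<phi> \<in> mod_hom R (free_mod R n) Q"
    and I: "finite I" and a: "\<And>i. i \<in> I \<Longrightarrow> a i \<in> carrier (free_mod R n)"
  defines "T \<equiv> eval_coker R (free_mod R n) I a (self_module R)"
    and "e \<equiv> eval_basis R (free_mod R n) I a"
  shows "(\<Sum>i\<in>I. frag_of (\<phi> (a i), e i)) \<in> tensor_null R Q T"
proof -
  let ?F = "free_mod R n" and ?V = "self_module R"
  interpret R: cring R by (rule R)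
  interpret S: mult_subset R "carrier R" by unfold_locales auto
  interpret Q: module R Q by (rule Q)
  have F: "module R ?F" by (rule free_mod_module[OF R])
  interpret F: module R ?F by (rule F)
  have V: "module R ?V" by (rule S.self_module_module)
  have T: "module R T" unfolding T_def by (rule eval_coker_module[OF F a V])
  interpret T: module R T by (rule T)
  define cl where "cl = eval_class R ?F I a ?V"
  have cl: "cl \<in> mod_hom R (pow_module I ?V) T"
    unfolding T_def cl_def by (rule eval_class_hom[OF F a V])
  have mem: "t \<in> carrier (pow_module I ?V) \<longleftrightarrow> t \<in> I \<rightarrow>\<^sub>E carrier R" for t
    by (simp add: pow_module_simps self_module_def)
  have e: "e i \<in> carrier T" for i
    unfolding e_def cl_def[symmetric] by (rule mod_homD(1)[OF cl]) (simp add: mem)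
  note add0 = tensor_null_add[of _ R Q T] and diff0 = tensor_null_diff[OF Q T]
  define u where "u c D = (\<lambda>i\<in>I. if i \<in> D then c i else \<zero>\<^bsub>R\<^esub>)" for c :: "'i \<Rightarrow> 'a" and D
  (* u c D is the family c, cut off outside D; the induction over D sums it up from unit vectors. *)
  have collect: "(\<Sum>i\<in>D. frag_of (c i \<odot>\<^bsub>Q\<^esub> q, e i)) - frag_of (q, cl (u c D))
      \<in> tensor_null R Q T"
    if "D \<subseteq> I" and c: "\<And>i. i \<in> I \<Longrightarrow> c i \<in> carrier R" and q: "q \<in> carrier Q" for D c q
    using finite_subset[OF \<open>D \<subseteq> I\<close> I] \<open>D \<subseteq> I\<close>
  proof (induction D rule: finite_induct)
    case empty
    have "u c {} = \<zero>\<^bsub>pow_module I ?V\<^esub>"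
      by (auto simp: u_def pow_module_simps self_module_def fun_eq_iff)
    then have z: "cl (u c {}) = \<zero>\<^bsub>T\<^esub>"
      using mod_hom_zero[OF pow_module_module[OF V] T cl] by (simp only:)
    show ?case unfolding z using tensor_null_minus[OF Q T tensor_null_zero_right[OF Q T q]] by simp
  next
    case (insert j D)
    have j: "j \<in> I" using insert.prems by simp
    have u: "u c D \<in> carrier (pow_module I ?V)" using c by (auto simp: u_def mem)
    have d: "(\<lambda>i\<in>I. if i = j then \<one>\<^bsub>R\<^esub> else \<zero>\<^bsub>R\<^esub>) \<in> carrier (pow_module I ?V)" by (auto simp: mem)
    have "u c (insert j D) = c j \<odot>\<^bsub>pow_module I ?V\<^esub> (\<lambda>i\<in>I. if i = j then \<one>\<^bsub>R\<^esub> else \<zero>\<^bsub>R\<^esub>) \<oplus>\<^bsub>pow_module I ?V\<^esub> u c D"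
      using c j insert.hyps by (auto simp: u_def fun_eq_iff pow_module_simps self_module_def)
    moreover have "c j \<odot>\<^bsub>pow_module I ?V\<^esub> (\<lambda>i\<in>I. if i = j then \<one>\<^bsub>R\<^esub> else \<zero>\<^bsub>R\<^esub>) \<in> carrier (pow_module I ?V)"
      using c[OF j] by (auto simp: pow_module_simps self_module_def)
    ultimately have split: "cl (u c (insert j D)) = c j \<odot>\<^bsub>T\<^esub> e j \<oplus>\<^bsub>T\<^esub> cl (u c D)"
      using mod_homD(2)[OF cl] mod_homD(3)[OF cl c[OF j] d] u by (simp add: e_def cl_def)
    have clu: "cl (u c D) \<in> carrier T" by (rule mod_homD(1)[OF cl u])
    have "(\<Sum>i\<in>D. frag_of (c i \<odot>\<^bsub>Q\<^esub> q, e i)) - frag_of (q, cl (u c D)) \<in> tensor_null R Q T"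
      using insert by auto
    from diff0[OF add0[OF this tensor_null_rel[OF tensor_relsI(3)[OF c[OF j] q e[of j]]]]
        tensor_null_rel[OF tensor_relsI(2)[OF q T.smult_closed[OF c[OF j] e[of j]] clu]]]
    show ?case
      unfolding split using insert.hyps by (simp add: algebra_simps)
  qed
  have coord: "(\<Sum>i\<in>I. frag_of (a i k \<odot>\<^bsub>Q\<^esub> q, e i)) \<in> tensor_null R Q T" if k: "k < n" and q: "q \<in> carrier Q" for k q
  proof -
    have "(\<lambda>b. b k) \<in> mod_hom R ?F ?V"
      by (rule mod_homI) (use k in \<open>auto simp: free_mod_def self_module_def\<close>)
    then have "(\<lambda>i\<in>I. a i k) \<in> eval_image R ?F I a ?V" by (rule eval_imageI) simp
    moreover have ak: "a i k \<in> carrier R" if "i \<in> I" for i using trunc_vec(5)[OF R a[OF that] k] .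
    ultimately have "cl (\<lambda>i\<in>I. a i k) = cl \<zero>\<^bsub>pow_module I ?V\<^esub>"
      unfolding cl_def
      by (subst quot_rep_zero_iff[OF pow_module_module[OF V] eval_image_submodule[OF F V a]]) (auto simp: mem)
    then have z: "cl (\<lambda>i\<in>I. a i k) = \<zero>\<^bsub>T\<^esub>" using mod_hom_zero[OF pow_module_module[OF V] T cl] by simp
    have "(\<Sum>i\<in>I. frag_of (a i k \<odot>\<^bsub>Q\<^esub> q, e i)) - frag_of (q, cl (u (\<lambda>i. a i k) I)) \<in> tensor_null R Q T"
      by (rule collect[OF subset_refl ak q])
    moreover have "u (\<lambda>i. a i k) I = (\<lambda>i\<in>I. a i k)" by (auto simp: u_def fun_eq_iff)
    ultimately show ?thesis
      using z add0[OF _ tensor_null_zero_right[OF Q T q]] by fastforce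
  qed
  (* The k-th step splits off the k-th coordinate of all the vectors at once. *)
  have "k \<le> n \<Longrightarrow> (\<Sum>i\<in>I. frag_of (\<phi> (trunc_vec R n k (a i)), e i)) \<in> tensor_null R Q T" for k
  proof (induction k)
    case 0
    show ?case
      by (rule tensor_null_sum)
        (simp add: trunc_vec[OF R a] mod_hom_zero[OF F Q \<phi>] tensor_null_zero_left[OF Q T e])
  next
    case (Suc k)
    let ?q = "\<phi> (unit_vec R n k)"
    have q: "?q \<in> carrier Q" by (rule mod_homD(1)[OF \<phi> unit_vec_closed[OF R]])
    have k: "k < n" using Suc.prems by simp
    have "(\<Sum>i\<in>I. frag_of (\<phi> (trunc_vec R n (Suc k) (a i)), e i) - frag_of (\<phi> (trunc_vec R n k (a i)), e i)
        - frag_of (a i k \<odot>\<^bsub>Q\<^esub> ?q, e i)) \<in> tensor_null R Q T"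
    proof (rule tensor_null_sum)
      fix i assume i: "i \<in> I"
      note t = trunc_vec[OF R a[OF i]]
      have "\<phi> (trunc_vec R n (Suc k) (a i)) = \<phi> (trunc_vec R n k (a i)) \<oplus>\<^bsub>Q\<^esub> a i k \<odot>\<^bsub>Q\<^esub> ?q"
        using k t(1) t(5)[OF k] by (simp add: t(4) mod_homD[OF \<phi>] unit_vec_closed[OF R])
      then show "frag_of (\<phi> (trunc_vec R n (Suc k) (a i)), e i) - frag_of (\<phi> (trunc_vec R n k (a i)), e i)
          - frag_of (a i k \<odot>\<^bsub>Q\<^esub> ?q, e i) \<in> tensor_null R Q T"
        using tensor_null_rel[OF tensor_relsI(1)[OF mod_homD(1)[OF \<phi> t(1)] Q.smult_closed[OF t(5)[OF k] q] e]] by simp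
    qed
    from add0[OF add0[OF this Suc.IH] coord[OF k q]] k
    show ?case by (simp add: sum_subtractf)
  qed
  from this[of n] show ?thesis by (simp add: trunc_vec[OF R a] cong: sum.cong)
qed

text \<open>
  Let \<open>T\<close> and \<open>W\<close> be the cokernels for \<open>R\<close> and for \<open>P\<close>.  Multiplication
  \<open>(z, (t\<^sub>i)\<^sub>i) \<mapsto> (t\<^sub>i z)\<^sub>i\<close> induces a balanced map from \<open>P \<times> T\<^sub>S\<close> to \<open>W\<^sub>S\<close>.  It sends
  \<open>\<Sum> x\<^sub>i \<otimes> e\<^sub>i\<close> to the class of \<open>x\<close>.  If the sum is null, this class vanishes in \<open>W\<^sub>S\<close>, hence some
  \<open>s \<in> S\<close> kills it in \<open>W\<close>, and the equations are solvable for \<open>s x\<close>.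
\<close>

lemma (in mult_subset) null_solvable:
  fixes P :: "('a, 'p, 'y) module_scheme" and a :: "'i \<Rightarrow> 'f"
  assumes F: "module R F" and P: "module R P"
    and I: "finite I" and a: "\<And>i. i \<in> I \<Longrightarrow> a i \<in> carrier F" and x: "\<And>i. i \<in> I \<Longrightarrow> x i \<in> carrier P"
    and null: "(\<Sum>i\<in>I. frag_of (x i, loc_frac R S (eval_coker R F I a (self_module R)) (eval_basis R F I a i) \<one>))
      \<in> tensor_null R P (loc_restrict R S (loc_module R S (eval_coker R F I a (self_module R))))"
  shows "\<exists>s\<in>S. \<exists>\<psi>\<in>mod_hom R F P. \<forall>i\<in>I. \<psi> (a i) = s \<odot>\<^bsub>P\<^esub> x i"
proof -
  let ?V = "self_module R"
  define T where "T = eval_coker R F I a ?V"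
  define W where "W = eval_coker R F I a P"
  define e where "e = eval_basis R F I a"
  have V: "module R ?V" by (rule self_module_module)
  have T: "module R T" unfolding T_def by (rule eval_coker_module[OF F a V])
  have W: "module R W" unfolding W_def by (rule eval_coker_module[OF F a P])
  interpret P: module R P by (rule P)
  interpret T: loc_setup R S T using T by (simp add: loc_setup_def mult_subset_axioms)
  interpret W: loc_setup R S W using W by (simp add: loc_setup_def mult_subset_axioms)
  let ?N = "loc_restrict R S (loc_module R S T)"
  have N: "module R ?N" by (rule loc_restrict_module[OF T.loc_module_module])
  define clV where "clV = eval_class R F I a ?V"
  define clP where "clP = eval_class R F I a P"
  have clV: "clV \<in> mod_hom R (pow_module I ?V) T" unfolding T_def clV_def by (rule eval_class_hom[OF F a V])
  have clP: "clP \<in> mod_hom R (pow_module I P) W" unfolding W_def clP_def by (rule eval_class_hom[OF F a P])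
  interpret PI: module R "pow_module I P" by (rule pow_module_module[OF P])
  have TV: "carrier T = clV ` carrier (pow_module I ?V)"
    unfolding T_def clV_def by (rule eval_coker_carrier[OF F a])
  define \<mu> where "\<mu> z t = clP (\<lambda>i\<in>I. t i \<odot>\<^bsub>P\<^esub> z)" for z t
  have smul: "(\<lambda>c. c \<odot>\<^bsub>P\<^esub> z) \<in> mod_hom R ?V P" if "z \<in> carrier P" for z
    by (rule mod_homI) (use that in \<open>auto simp: self_simps P.smult_l_distr P.smult_assoc1\<close>)
  have \<mu>: "\<mu> z \<in> mod_hom R T W" if "z \<in> carrier P" for z
    unfolding \<mu>_def[abs_def] clP_def T_def W_def by (rule eval_coker_map(1)[OF F a V P smul[OF that]])
  have \<mu>_cl: "\<mu> z (clV t) = clP (\<lambda>i\<in>I. t i \<odot>\<^bsub>P\<^esub> z)" if "z \<in> carrier P" "t \<in> carrier (pow_module I ?V)" for z t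
    unfolding \<mu>_def clP_def clV_def by (rule eval_coker_map(2)[OF F a V P smul[OF that(1)] that(2)])
  have sm: "(\<lambda>i\<in>I. t i \<odot>\<^bsub>P\<^esub> z) \<in> carrier (pow_module I P)" if "z \<in> carrier P" "t \<in> carrier (pow_module I ?V)" for z t
    using that by (auto simp: pow_module_simps self_simps)
  have \<mu>_add: "\<mu> (z \<oplus>\<^bsub>P\<^esub> z') u = \<mu> z u \<oplus>\<^bsub>W\<^esub> \<mu> z' u"
    if h: "z \<in> carrier P" "z' \<in> carrier P" "u \<in> carrier T" for z z' u
  proof -
    obtain t where t: "t \<in> carrier (pow_module I ?V)" "u = clV t" using h(3) TV by blast
    have "(\<lambda>i\<in>I. t i \<odot>\<^bsub>P\<^esub> (z \<oplus>\<^bsub>P\<^esub> z')) = (\<lambda>i\<in>I. t i \<odot>\<^bsub>P\<^esub> z) \<oplus>\<^bsub>pow_module I P\<^esub> (\<lambda>i\<in>I. t i \<odot>\<^bsub>P\<^esub> z')"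
      using h t by (auto simp: pow_module_simps self_simps P.smult_r_distr fun_eq_iff PiE_iff)
    then show ?thesis using h t by (simp add: \<mu>_cl mod_homD(2)[OF clP] sm)
  qed
  have \<mu>_smult: "\<mu> (c \<odot>\<^bsub>P\<^esub> z) u = c \<odot>\<^bsub>W\<^esub> \<mu> z u"
    if h: "c \<in> carrier R" "z \<in> carrier P" "u \<in> carrier T" for c z u
  proof -
    obtain t where t: "t \<in> carrier (pow_module I ?V)" "u = clV t" using h(3) TV by blast
    have "(\<lambda>i\<in>I. t i \<odot>\<^bsub>P\<^esub> (c \<odot>\<^bsub>P\<^esub> z)) = c \<odot>\<^bsub>pow_module I P\<^esub> (\<lambda>i\<in>I. t i \<odot>\<^bsub>P\<^esub> z)"
      using h t by (auto simp: pow_module_simps self_simps m_comm fun_eq_iff restrict_def PiE_iff simp flip: P.smult_assoc1)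
    then show ?thesis using h t by (simp add: \<mu>_cl mod_homD(3)[OF clP] sm)
  qed
  define b where "b z = loc_map R S W (\<mu> z)" for z
  have b: "b z (loc_frac R S T u s) = loc_frac R S W (\<mu> z u) s"
    if "z \<in> carrier P" "u \<in> carrier T" "s \<in> S" for z u s
    unfolding b_def by (rule T.loc_map_frac[OF W \<mu>[OF that(1)] that(2,3)])
  have b_hom: "b z \<in> mod_hom (loc_ring R S) (loc_module R S T) (loc_module R S W)" if "z \<in> carrier P" for z
    unfolding b_def by (rule T.loc_map_hom[OF W \<mu>[OF that]])
  have add_frac: "loc_frac R S W (w \<oplus>\<^bsub>W\<^esub> w') s = loc_frac R S W w s \<oplus>\<^bsub>loc_module R S W\<^esub> loc_frac R S W w' s"
    if "w \<in> carrier W" "w' \<in> carrier W" "s \<in> S" for w w' s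
    using that W.loc_frac_cancel[of "w \<oplus>\<^bsub>W\<^esub> w'" s s] by (simp add: W.loc_add_frac W.smult_r_distr)
  obtain h where h:
    "\<And>c d. Poly_Mapping.keys c \<subseteq> carrier P \<times> carrier ?N \<Longrightarrow> Poly_Mapping.keys d \<subseteq> carrier P \<times> carrier ?N \<Longrightarrow>
      h (c + d) = h c \<oplus>\<^bsub>loc_module R S W\<^esub> h d"
    "\<And>z y. z \<in> carrier P \<Longrightarrow> y \<in> carrier ?N \<Longrightarrow> h (frag_of (z, y)) = b z y"
    "\<And>c. c \<in> tensor_null R P ?N \<Longrightarrow> h c = \<zero>\<^bsub>loc_module R S W\<^esub>"
  proof (rule tensor_null_lift[OF P N W.loc_abelian_group])
    fix z y assume "z \<in> carrier P" "y \<in> carrier ?N"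
    then show "b z y \<in> carrier (loc_module R S W)" using mod_homD(1)[OF b_hom] by simp
  next
    fix z z' y assume "z \<in> carrier P" "z' \<in> carrier P" "y \<in> carrier ?N"
    then show "b (z \<oplus>\<^bsub>P\<^esub> z') y = b z y \<oplus>\<^bsub>loc_module R S W\<^esub> b z' y"
      by (auto simp: T.loc_carrier b \<mu>_add add_frac mod_homD(1)[OF \<mu>])
  next
    fix z y y' assume "z \<in> carrier P" "y \<in> carrier ?N" "y' \<in> carrier ?N"
    then show "b z (y \<oplus>\<^bsub>?N\<^esub> y') = b z y \<oplus>\<^bsub>loc_module R S W\<^esub> b z y'"
      using mod_homD(2)[OF b_hom] by simp
  next
    fix c z y assume "c \<in> carrier R" "z \<in> carrier P" "y \<in> carrier ?N"
    then show "b (c \<odot>\<^bsub>P\<^esub> z) y = b z (c \<odot>\<^bsub>?N\<^esub> y)"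
      by (auto simp: T.loc_carrier T.loc_smult_frac b \<mu>_smult mod_homD(3)[OF \<mu>] one_mem_S)
  qed blast
  have d: "(\<lambda>i\<in>I. if i = j then \<one> else \<zero>) \<in> carrier (pow_module I ?V)" for j
    by (auto simp: pow_module_simps self_simps)
  have e: "e i \<in> carrier T" for i
    unfolding e_def clV_def[symmetric] by (rule mod_homD(1)[OF clV d])
  define u where "u D = (\<lambda>i\<in>I. if i \<in> D then x i else \<zero>\<^bsub>P\<^esub>)" for D
  have key: "Poly_Mapping.keys (\<Sum>i\<in>D. frag_of (x i, loc_frac R S T (e i) \<one>)) \<subseteq> carrier P \<times> carrier ?N \<and>
      h (\<Sum>i\<in>D. frag_of (x i, loc_frac R S T (e i) \<one>)) =
      loc_frac R S W (clP (u D)) \<one>"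
    if "D \<subseteq> I" for D
    using finite_subset[OF that I] that
  proof (induction D rule: finite_induct)
    case empty
    have "u {} = \<zero>\<^bsub>pow_module I P\<^esub>"
      by (auto simp: u_def pow_module_simps fun_eq_iff)
    then have z: "clP (u {}) = \<zero>\<^bsub>W\<^esub>"
      using mod_hom_zero[OF pow_module_module[OF P] W clP] by (simp only:)
    show ?case unfolding z using h(3)[OF tensor_null_zero] by (simp add: W.loc_zero)
  next
    case (insert j D)
    let ?v = "\<lambda>i\<in>I. (if i = j then \<one> else \<zero>) \<odot>\<^bsub>P\<^esub> x j"
    have j: "j \<in> I" "D \<subseteq> I" using insert.prems by auto
    have u: "u D \<in> carrier (pow_module I P)" using x by (auto simp: u_def pow_module_simps)
    have v: "?v \<in> carrier (pow_module I P)" using x[OF j(1)] by (auto simp: pow_module_simps)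
    have "u (insert j D) = ?v \<oplus>\<^bsub>pow_module I P\<^esub> u D"
      using x j insert.hyps by (auto simp: u_def fun_eq_iff pow_module_simps)
    then have split: "clP (u (insert j D)) = clP ?v \<oplus>\<^bsub>W\<^esub> clP (u D)"
      using mod_homD(2)[OF clP v u] by simp
    have "(\<lambda>i\<in>I. (\<lambda>i\<in>I. if i = j then \<one> else \<zero>) i \<odot>\<^bsub>P\<^esub> x j) = ?v" by auto
    then have "\<mu> (x j) (e j) = clP ?v"
      using \<mu>_cl[OF x[OF j(1)] d[of j]] by (simp add: e_def clV_def)
    moreover have "loc_frac R S T (e j) \<one> \<in> carrier ?N" using e one_mem_S by simp
    moreover from this have "Poly_Mapping.keys (frag_of (x j, loc_frac R S T (e j) \<one>) + (\<Sum>i\<in>D. frag_of (x i, loc_frac R S T (e i) \<one>)))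
        \<subseteq> carrier P \<times> carrier ?N"
      using insert.IH[OF j(2)] x[OF j(1)] by (intro order.trans[OF Poly_Mapping.keys_add]) simp
    ultimately show ?case
      using insert.IH[OF j(2)] insert.hyps x[OF j(1)] e
      by (simp add: h(1,2) b one_mem_S split add_frac mod_homD(1)[OF clP u] mod_homD(1)[OF clP v])
  qed
  have xI: "(\<lambda>i\<in>I. x i) \<in> carrier (pow_module I P)" using x by (auto simp: pow_module_simps)
  have uI: "u I = (\<lambda>i\<in>I. x i)" by (auto simp: u_def fun_eq_iff)
  have "loc_frac R S W (clP (\<lambda>i\<in>I. x i)) \<one> = \<zero>\<^bsub>loc_module R S W\<^esub>"
    using key[OF subset_refl] h(3)[OF null[folded T_def e_def]] by (simp add: uI e_def)
  then obtain s where s: "s \<in> S" "s \<odot>\<^bsub>W\<^esub> clP (\<lambda>i\<in>I. x i) = \<zero>\<^bsub>W\<^esub>"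
    unfolding W.loc_zero
    using W.loc_frac_eq_iff[of "clP (\<lambda>i\<in>I. x i)" "\<zero>\<^bsub>W\<^esub>" \<one> \<one>] mod_homD(1)[OF clP xI] one_mem_S by auto
  have "clP (s \<odot>\<^bsub>pow_module I P\<^esub> (\<lambda>i\<in>I. x i)) = clP \<zero>\<^bsub>pow_module I P\<^esub>"
    using s mod_homD(3)[OF clP _ xI] mod_hom_zero[OF PI.module_axioms W clP] by simp
  then have "s \<odot>\<^bsub>pow_module I P\<^esub> (\<lambda>i\<in>I. x i) \<in> eval_image R F I a P"
    unfolding clP_def using s xI
    by (subst (asm) quot_rep_zero_iff[OF pow_module_module[OF P] eval_image_submodule[OF F P a]]) auto
  then obtain \<psi> where \<psi>: "\<psi> \<in> mod_hom R F P" "(\<lambda>i\<in>I. s \<odot>\<^bsub>P\<^esub> x i) = (\<lambda>i\<in>I. \<psi> (a i))"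
    unfolding eval_image_def pow_module_simps by (auto cong: restrict_cong)
  have "\<psi> (a i) = s \<odot>\<^bsub>P\<^esub> x i" if "i \<in> I" for i
    using fun_cong[OF \<psi>(2), of i] that by simp
  with s \<psi>(1) show ?thesis by blast
qed

section \<open>Purity and splitting\<close>

context mult_subset
begin

text \<open>
  A pure map between finitely presented modules over a localization has a retraction, up to a
  denominator.  The retraction is found by solving one finite system of linear equations in \<open>P\<close>.
  The type of \<open>N\<close> in the purity hypothesis is that of the localized test module of this system.
\<close>

lemma pure_imp_split:
  fixes P :: "('a, 'p, 'y) module_scheme" and Q :: "('a, 'q, 'z) module_scheme"
  assumes P: "finitely_presented R P" and Q: "finitely_presented R Q" and f: "f \<in> mod_hom R P Q"
    and inj: "\<And>(N :: (('a \<times> 'a) set, (((nat \<Rightarrow> 'a) \<times> 'p \<Rightarrow> 'a) \<times> 'a) set) module) c. module (loc_ring R S) N \<Longrightarrow>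
      Poly_Mapping.keys c \<subseteq> carrier P \<times> carrier N \<Longrightarrow>
      pair_push f (\<lambda>y. y) c \<in> tensor_null R Q (loc_restrict R S N) \<Longrightarrow> c \<in> tensor_null R P (loc_restrict R S N)"
  shows "\<exists>s\<in>S. \<exists>r\<in>mod_hom R Q P. \<forall>y\<in>carrier P. r (f y) = s \<odot>\<^bsub>P\<^esub> y"
proof -
  have mP: "module R P" and mQ: "module R Q" using P Q by (auto simp: finitely_presented_def)
  interpret P: module R P by (rule mP)
  interpret Q: module R Q by (rule mQ)
  obtain n \<phi> B where \<phi>: "\<phi> \<in> mod_hom R (free_mod R n) Q" "\<phi> ` carrier (free_mod R n) = carrier Q"
    and B: "finite B" "B \<subseteq> carrier (free_mod R n)" "a_kernel (free_mod R n) Q \<phi> = submodule_gen R (free_mod R n) B"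
    using Q unfolding finitely_presented_def by blast
  obtain m \<pi> where \<pi>: "\<pi> \<in> mod_hom R (free_mod R m) P" "\<pi> ` carrier (free_mod R m) = carrier P"
    using P unfolding finitely_presented_def by blast
  let ?F = "free_mod R n"
  have F: "module R ?F" by (rule free_mod_module[OF is_cring])
  interpret F: module R ?F by (rule F)
  define p where "p k = \<pi> (unit_vec R m k)" for k
  have G: "module R (free_mod R m)" by (rule free_mod_module[OF is_cring])
  interpret G: module R "free_mod R m" by (rule G)
  have p: "p k \<in> carrier P" for k
    unfolding p_def by (rule mod_homD(1)[OF \<pi>(1) unit_vec_closed[OF is_cring]])
  have "\<exists>a\<in>carrier ?F. \<phi> a = f (p k)" for k
    using mod_homD(1)[OF f p[of k]] \<phi>(2) by (metis imageE)
  then obtain lift where lift: "\<And>k. lift k \<in> carrier ?F" "\<And>k. \<phi> (lift k) = f (p k)" by metis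
  (* The first kind of index encodes the relations of Q, the second the condition r (f (p k)) = s (p k). *)
  define I where "I = (\<lambda>b. (b, \<zero>\<^bsub>P\<^esub>)) ` B \<union> (\<lambda>k. (lift k, p k)) ` {..<m}"
  have I: "finite I" using B(1) by (simp add: I_def)
  have "\<phi> b = \<zero>\<^bsub>Q\<^esub>" if "b \<in> B" for b
    using subsetD[OF submodule_gen_superset[of B R ?F] that] unfolding B(3)[symmetric] by (simp add: a_kernel_def')
  then have rel: "fst i \<in> carrier ?F" "snd i \<in> carrier P" "\<phi> (fst i) = f (snd i)" if "i \<in> I" for i
    using that lift p B(2) by (auto simp: I_def mod_hom_zero[OF mP mQ f])
  define T where "T = eval_coker R ?F I fst (self_module R)"
  define e where "e = eval_basis R ?F I fst"
  have T: "module R T" unfolding T_def by (rule eval_coker_module[OF F rel(1) self_module_module])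
  interpret T: loc_setup R S T using T by (simp add: loc_setup_def mult_subset_axioms)
  let ?N = "loc_module R S T"
  let ?\<xi> = "\<Sum>i\<in>I. frag_of (snd i, loc_frac R S T (e i) \<one>)"
  have e: "e i \<in> carrier T" for i
    unfolding e_def T_def
    by (rule mod_homD(1)[OF eval_class_hom[OF F rel(1) self_module_module]])
      (auto simp: pow_module_simps self_simps)
  have keys: "Poly_Mapping.keys ?\<xi> \<subseteq> carrier P \<times> carrier ?N"
  proof -
    have "Poly_Mapping.keys ?\<xi> \<subseteq> (\<Union>i\<in>I. Poly_Mapping.keys (frag_of (snd i, loc_frac R S T (e i) \<one>)))"
      by (rule keys_sum)
    also have "\<dots> \<subseteq> carrier P \<times> carrier ?N" using rel(2) e one_mem_S by auto
    finally show ?thesis .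
  qed
  have "(\<Sum>i\<in>I. frag_of (\<phi> (fst i), e i)) \<in> tensor_null R Q T"
    unfolding T_def e_def by (rule relation_null[OF is_cring mQ \<phi>(1) I rel(1)])
  then have "pair_push (\<lambda>q. q) (\<lambda>t. loc_frac R S T t \<one>) (\<Sum>i\<in>I. frag_of (\<phi> (fst i), e i))
      \<in> tensor_null R Q (loc_restrict R S ?N)"
    by (rule pair_push_null[OF mQ T mQ loc_restrict_module[OF T.loc_module_module] mod_hom_id T.loc_incl_hom])
  then have "pair_push f (\<lambda>y. y) ?\<xi> \<in> tensor_null R Q (loc_restrict R S ?N)"
    by (simp add: pair_push_sum rel(3))
  then have null: "?\<xi> \<in> tensor_null R P (loc_restrict R S ?N)"
    by (rule inj[OF T.loc_module_module keys])
  have "\<exists>s\<in>S. \<exists>\<psi>\<in>mod_hom R ?F P. \<forall>i\<in>I. \<psi> (fst i) = s \<odot>\<^bsub>P\<^esub> snd i"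
    by (rule null_solvable[OF F mP I rel(1,2) null[unfolded T_def e_def]])
  then obtain s \<psi> where s: "s \<in> S" and \<psi>: "\<psi> \<in> mod_hom R ?F P" "\<And>i. i \<in> I \<Longrightarrow> \<psi> (fst i) = s \<odot>\<^bsub>P\<^esub> snd i"
    by blast
  have "\<psi> b = \<zero>\<^bsub>P\<^esub>" if "b \<in> B" for b
    using \<psi>(2)[of "(b, \<zero>\<^bsub>P\<^esub>)"] s that by (simp add: I_def)
  then obtain r where r: "r \<in> mod_hom R Q P" "\<And>a. a \<in> carrier ?F \<Longrightarrow> r (\<phi> a) = \<psi> a"
    using mod_hom_descend[OF F mQ mP \<phi> B(3,2) \<psi>(1)] by blast
  have on_gen: "r (f (p k)) = s \<odot>\<^bsub>P\<^esub> p k" if "k < m" for k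
    using r(2)[OF lift(1)[of k]] \<psi>(2)[of "(lift k, p k)"] that by (simp add: lift(2) I_def)
  have "r (f y) = s \<odot>\<^bsub>P\<^esub> y" if "y \<in> carrier P" for y
  proof -
    have "y \<in> \<pi> ` carrier (free_mod R m)" unfolding \<pi>(2) by (rule that)
    then obtain b where b: "b \<in> carrier (free_mod R m)" "y = \<pi> b" by (elim imageE)
    let ?g = "\<lambda>b. r (f (\<pi> b))" and ?h = "\<lambda>b. s \<odot>\<^bsub>P\<^esub> \<pi> b"
    have g: "?g \<in> mod_hom R (free_mod R m) P"
      by (rule mod_hom_comp[OF mod_hom_comp[OF \<pi>(1) f] r(1)])
    have h: "?h \<in> mod_hom R (free_mod R m) P"
      by (rule mod_hom_comp[OF \<pi>(1) mod_hom_smult[OF mP S_carrier[OF s]]])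
    have "?g (unit_vec R m k) = ?h (unit_vec R m k)" if "k < m" for k
      using on_gen[OF that] by (simp only: p_def)
    from free_mod_hom_eqI[OF mP g h this b(1)] have "r (f (\<pi> b)) = s \<odot>\<^bsub>P\<^esub> \<pi> b" by simp
    with b(2) show ?thesis by simp
  qed
  with s r(1) show ?thesis by blast
qed

text \<open>
  A null image under \<open>f\<close> stays null under \<open>r\<close>, so \<open>s\<close> times the element is null; but \<open>s\<close> acts
  invertibly on \<open>N\<close>.
\<close>

lemma split_imp_pure:
  assumes P: "module R P" and Q: "module R Q" and f: "f \<in> mod_hom R P Q"
    and s: "s \<in> S" and r: "r \<in> mod_hom R Q P" "\<And>y. y \<in> carrier P \<Longrightarrow> r (f y) = s \<odot>\<^bsub>P\<^esub> y"
    and N: "module (loc_ring R S) N" and c: "Poly_Mapping.keys c \<subseteq> carrier P \<times> carrier N"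
    and null: "pair_push f (\<lambda>y. y) c \<in> tensor_null R Q (loc_restrict R S N)"
  shows "c \<in> tensor_null R P (loc_restrict R S N)"
proof -
  interpret N: module "loc_ring R S" N by (rule N)
  let ?N = "loc_restrict R S N"
  have mN: "module R ?N" by (rule loc_restrict_module[OF N])
  have c': "Poly_Mapping.keys c \<subseteq> carrier P \<times> carrier ?N" using c by simp
  have "pair_push r (\<lambda>y. y) (pair_push f (\<lambda>y. y) c) \<in> tensor_null R P ?N"
    by (rule pair_push_null[OF Q mN P mN r(1) mod_hom_id null])
  also have "pair_push r (\<lambda>y. y) (pair_push f (\<lambda>y. y) c) = pair_push (\<lambda>x. s \<odot>\<^bsub>P\<^esub> x) (\<lambda>y. y) c"
    unfolding pair_push_push using c by (rule pair_push_cong) (auto simp: r(2))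
  finally have "pair_push (\<lambda>x. s \<odot>\<^bsub>P\<^esub> x) (\<lambda>y. y) c \<in> tensor_null R P ?N" .
  from tensor_null_diff[OF P mN this tensor_null_balance[OF P mN S_carrier[OF s] c']]
  have "pair_push (\<lambda>x. x) (\<lambda>y. s \<odot>\<^bsub>?N\<^esub> y) c \<in> tensor_null R P ?N"
    by (simp only: diff_diff_eq2 add_diff_cancel_left')
  then have "pair_push (\<lambda>x. x) (\<lambda>y. rfrac \<one> s \<odot>\<^bsub>N\<^esub> y) (pair_push (\<lambda>x. x) (\<lambda>y. s \<odot>\<^bsub>?N\<^esub> y) c) \<in> tensor_null R P ?N"
    by (rule pair_push_null[OF P mN P mN mod_hom_id loc_smult_hom[OF N rfrac_closed[OF one_closed s]]])
  also have "pair_push (\<lambda>x. x) (\<lambda>y. rfrac \<one> s \<odot>\<^bsub>N\<^esub> y) (pair_push (\<lambda>x. x) (\<lambda>y. s \<odot>\<^bsub>?N\<^esub> y) c) = pair_push (\<lambda>x. x) (\<lambda>y. y) c"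
    unfolding pair_push_push using c
    by (rule pair_push_cong) (use s in \<open>auto simp: loc_mult_frac one_mem_S rfrac_self simp flip: N.smult_assoc1\<close>)
  finally show ?thesis by (simp add: pair_push_id)
qed

end

lemma dominate_null_iff:
  assumes "module R P" "module R Q" "module R M" "f \<in> mod_hom R P Q" "g \<in> mod_hom R P M"
    and "dominate R P Q M f g" "module R N" "Poly_Mapping.keys c \<subseteq> carrier P \<times> carrier N"
  shows "pair_push f (\<lambda>y. y) c \<in> tensor_null R Q N \<longleftrightarrow> pair_push g (\<lambda>y. y) c \<in> tensor_null R M N"
  using dominate_all[OF assms(1-7)] kernel_mem_iff[OF assms(1,2,7,4,8)] kernel_mem_iff[OF assms(1,3,7,5,8)]
  by simp

section \<open>Openness of the pure locus\<close>

theorem corollary3p68: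
  fixes R :: "('a, 'c) ring_scheme"
    and M :: "('a, 'm, 'x) module_scheme"
    and P :: "('a, 'p, 'y) module_scheme"
    and v :: "'p \<Rightarrow> 'm"
  assumes "cring R"
    and "module R M" and "mittag_leffler R M"
    and "module R P" and "finitely_presented R P"
    and "v \<in> mod_hom R P M"
  shows "openin (zariski R) (pure_locus R P M v)"
proof -
  obtain Q :: "('a, 'a list) module" and f where f: "f \<in> mod_hom R P Q"
    and Q: "finitely_presented R Q" and dom: "dominate R P Q M f v"
    using mittag_leffler_all[OF assms(3,5,6)] by blast
  have mQ: "module R Q" using Q by (simp add: finitely_presented_def)
  note dom_null = dominate_null_iff[OF assms(4) mQ assms(2) f assms(6) dom]
  (* The denominators over which f has a retraction form a set that does not mention any prime. *)
  define E where "E = {s \<in> carrier R. \<exists>r\<in>mod_hom R Q P. \<forall>y\<in>carrier P. r (f y) = s \<odot>\<^bsub>P\<^esub> y}"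
  have "pure_map (loc_ring R (carrier R - p)) (loc_module R (carrier R - p) P) (loc_module R (carrier R - p) M)
      (loc_map R (carrier R - p) M v) \<longleftrightarrow> \<not> E \<subseteq> p" if p: "p \<in> Spec R" for p
  proof -
    let ?S = "carrier R - p"
    interpret mult_subset R ?S using p by (intro primeideal_mult_subset) (simp add: Spec_def)
    interpret P: loc_setup R ?S P using assms(4) by (simp add: loc_setup_def mult_subset_axioms)
    interpret M: loc_setup R ?S M using assms(2) by (simp add: loc_setup_def mult_subset_axioms)
    note inj_iff = P.loc_map_tensor_inj_iff[OF assms(2,6)]
    show ?thesis
    proof
      assume pure: "pure_map (loc_ring R ?S) (loc_module R ?S P) (loc_module R ?S M) (loc_map R ?S M v)"
      have "\<exists>s\<in>?S. \<exists>r\<in>mod_hom R Q P. \<forall>y\<in>carrier P. r (f y) = s \<odot>\<^bsub>P\<^esub> y"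
      proof (rule pure_imp_split[OF assms(5) Q f])
        fix N :: "(('a \<times> 'a) set, (((nat \<Rightarrow> 'a) \<times> 'p \<Rightarrow> 'a) \<times> 'a) set) module" and c :: "_ \<Rightarrow>\<^sub>0 int"
        assume N: "module (loc_ring R ?S) N" and c: "Poly_Mapping.keys c \<subseteq> carrier P \<times> carrier N"
          and null: "pair_push f (\<lambda>y. y) c \<in> tensor_null R Q (loc_restrict R ?S N)"
        have "pair_push v (\<lambda>y. y) c \<in> tensor_null R M (loc_restrict R ?S N)"
          using null dom_null[OF loc_restrict_module[OF N]] c by simp
        then show "c \<in> tensor_null R P (loc_restrict R ?S N)"
          using pure_map_all[OF P.loc_module_module M.loc_module_module P.loc_map_hom[OF assms(2,6)] pure N]
            inj_iff[OF N] c by blast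
      qed
      then show "\<not> E \<subseteq> p" unfolding E_def by blast
    next
      assume "\<not> E \<subseteq> p"
      then obtain s r where s: "s \<in> ?S" and r: "r \<in> mod_hom R Q P" "\<And>y. y \<in> carrier P \<Longrightarrow> r (f y) = s \<odot>\<^bsub>P\<^esub> y"
        unfolding E_def by blast
      show "pure_map (loc_ring R ?S) (loc_module R ?S P) (loc_module R ?S M) (loc_map R ?S M v)"
        unfolding pure_map_def
      proof (intro allI impI)
        fix N :: "(('a \<times> 'a) set, ('a \<times> 'a) set list) module"
        assume N: "module (loc_ring R ?S) N"
        show "inj_on (tensor_map (loc_ring R ?S) (loc_module R ?S M) N (loc_map R ?S M v) (\<lambda>t. t))
            (carrier (tensor (loc_ring R ?S) (loc_module R ?S P) N))"
          unfolding inj_iff[OF N]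
          using split_imp_pure[OF assms(4) mQ f s r N] dom_null[OF loc_restrict_module[OF N]] by simp
      qed
    qed
  qed
  then have "pure_locus R P M v = {p \<in> Spec R. \<not> E \<subseteq> p}"
    unfolding pure_locus_def by blast
  moreover have "E \<subseteq> carrier R" by (auto simp: E_def)
  ultimately show ?thesis unfolding openin_zariski[OF assms(1)] by blast
qed

end
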